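(* (1) Suppose that for each $n$ the unitary matrix $U$ is the DFT matrix $F_{jk}=\frac{1}{\sqrt n}e^{-2\mathrm i\pi(j-1)(k-1)/n}$, $1\le j,k\le n$, or more generally that $|U_{ij}|^2=1/n$ almost surely for every $i,j\in\{1,\dots,n\}$. Then, as $n\to\infty$, $$n^{-1/2}\left(\mathcal T^{(n)}-\mathbb E\,\mathcal T^{(n)}\right)\longrightarrow \mathcal W^{(\infty)}$$ in distribution in $D([0,1]^2)$. (2) Suppose that for each $n$ the matrix $U$ is Haar distributed on $\mathbb U(n)$, or that for each $n$ it is Haar distributed on $\mathbb O(n)$. Then, as $n\to\infty$, $$n^{-1/2}\left(\mathcal T^{(n)}-\mathbb E\,\mathcal T^{(n)}\right)\longrightarrow \mathcal W^{(\infty)}$$ in distribution in $D([0,1]^2)$.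
   Context: For each $n$, $U=(U_{ij})_{1\le i,j\le n}$ is a (possibly random) $n\times n$ unitary matrix. $R_1,\dots,R_n$ and $C_1,\dots,C_n$ are two independent families of independent random variables uniformly distributed on $[0,1]$, and $(R_i,C_j)_{i,j}$ is independent of $U$. Define $$\mathcal T^{(n)}_{s,t}=\sum_{i,j=1}^n|U_{ij}|^2\,\mathbf 1_{R_i\le s}\,\mathbf 1_{C_j\le t},\qquad \mathcal T^{(n)}=\left(\mathcal T^{(n)}_{s,t},\ s,t\in[0,1]\right).$$ $\mathcal W^{(\infty)}$ is the centered Gaussian process with continuous paths on $[0,1]^2$ with covariance $$\mathbb E[\mathcal W^{(\infty)}(s,t)\mathcal W^{(\infty)}(s',t')]=ss'(t\wedge t')+(s\wedge s')tt'-2ss'tt'.$$ $D([0,1]^2)$ is the Skorokhod space of functions $[0,1]^2\to\mathbb R$ which at each point are right continuous (with respect to the natural partial order of $[0,1]^2$) and admit limits in all orthants, endowed with the (Bickel–Wichura) Skorokhod topology. *)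

theory Defs
  imports "HOL-Probability.Probability" "Jordan_Normal_Form.Schur_Decomposition"
begin

section \<open>The Skorokhod space of the unit square\<close>

definition unit_square :: "(real \<times> real) set" where
  "unit_square = {0..1} \<times> {0..1}"

text \<open>
  The four orthants at a point partition the square; \<open>True\<close> selects the closed side of a
  coordinate and \<open>False\<close> the open one. An orthant may be empty when the point lies on the
  boundary, and then the existence of a limit in it is no condition.
\<close>

definition orthant :: "bool \<Rightarrow> bool \<Rightarrow> real \<times> real \<Rightarrow> (real \<times> real) set" where
  "orthant a b p = {q \<in> unit_square.
     (if a then fst p \<le> fst q else fst q < fst p) \<and>
     (if b then snd p \<le> snd q else snd q < snd p)}"

text \<open>Functions on the square are represented as \<open>extensional\<close> functions.\<close>

definition skorokhod_D :: "(real \<times> real \<Rightarrow> real) set" where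
  "skorokhod_D = {f \<in> extensional unit_square. \<forall>p\<in>unit_square.
     (f \<longlongrightarrow> f p) (at p within orthant True True p) \<and>
     (\<forall>a b. \<exists>l. (f \<longlongrightarrow> l) (at p within orthant a b p))}"

definition time_change :: "(real \<Rightarrow> real) \<Rightarrow> bool" where
  "time_change \<tau> \<longleftrightarrow> strict_mono_on {0..1} \<tau> \<and> continuous_on {0..1} \<tau> \<and> \<tau> 0 = 0 \<and> \<tau> 1 = 1"

text \<open>
  The distance of Bickel and Wichura: the infimum, over all pairs \<open>(\<tau>, \<mu>)\<close> of time changes acting
  separately on the two coordinates, of the larger one of the uniform distances between
  \<open>x\<close> and \<open>y \<circ> (\<tau>, \<mu>)\<close> and between \<open>(\<tau>, \<mu>)\<close> and the identity.
  The value \<open>0\<close> off the space is immaterial (\<open>Metric_space\<close> asks for a total non-negative function).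
\<close>

definition skorokhod_close :: "real \<Rightarrow> (real \<times> real \<Rightarrow> real) \<Rightarrow> (real \<times> real \<Rightarrow> real) \<Rightarrow> bool" where
  "skorokhod_close e x y \<longleftrightarrow> (\<exists>\<tau> \<mu>. time_change \<tau> \<and> time_change \<mu> \<and>
     (\<forall>s\<in>{0..1}. \<bar>\<tau> s - s\<bar> \<le> e) \<and> (\<forall>t\<in>{0..1}. \<bar>\<mu> t - t\<bar> \<le> e) \<and>
     (\<forall>s\<in>{0..1}. \<forall>t\<in>{0..1}. \<bar>x (s, t) - y (\<tau> s, \<mu> t)\<bar> \<le> e))"

definition skorokhod_dist :: "(real \<times> real \<Rightarrow> real) \<Rightarrow> (real \<times> real \<Rightarrow> real) \<Rightarrow> real" where
  "skorokhod_dist x y =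
     (if x \<in> skorokhod_D \<and> y \<in> skorokhod_D then Inf {e. skorokhod_close e x y} else 0)"

lemma time_change_id: "time_change (\<lambda>x. x)"
  by (auto simp: time_change_def strict_mono_on_def intro: continuous_intros)

lemma time_change_mono:
  assumes "time_change \<tau>" "s \<in> {0..1}" "t \<in> {0..1}"
  shows "\<tau> s \<le> \<tau> t \<longleftrightarrow> s \<le> t"
  using assms unfolding time_change_def strict_mono_on_def
  by (metis less_eq_real_def not_le)

lemma time_change_in:
  assumes "time_change \<tau>" "s \<in> {0..1}"
  shows "\<tau> s \<in> {0..1}"
  using time_change_mono[OF assms(1), of 0 s] time_change_mono[OF assms(1), of s 1] assms
  by (auto simp: time_change_def)

lemma time_change_comp:
  assumes "time_change \<tau>" "time_change \<mu>"
  shows "time_change (\<lambda>x. \<mu> (\<tau> x))"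
proof -
  have im: "\<tau> ` {0..1} \<subseteq> {0..1}" using time_change_in[OF assms(1)] by blast
  have "continuous_on {0..1} (\<lambda>x. \<mu> (\<tau> x))"
    using assms continuous_on_compose2[OF _ _ im] by (auto simp: time_change_def)
  moreover have "strict_mono_on {0..1} (\<lambda>x. \<mu> (\<tau> x))"
    using assms im unfolding time_change_def strict_mono_on_def by (meson image_subset_iff)
  ultimately show ?thesis using assms by (simp add: time_change_def)
qed

lemma time_change_inverse:
  assumes "time_change \<tau>"
  obtains \<tau>' where "time_change \<tau>'" "\<And>s. s \<in> {0..1} \<Longrightarrow> \<tau>' (\<tau> s) = s"
    "\<And>s. s \<in> {0..1} \<Longrightarrow> \<tau> (\<tau>' s) = s"
proof -
  define g where "g = inv_into {0..1} \<tau>"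
  have inj: "inj_on \<tau> {0..1}"
    using assms strict_mono_on_imp_inj_on unfolding time_change_def by blast
  have im: "\<tau> ` {0..1} = {0..1}"
  proof (intro equalityI subsetI)
    fix y :: real assume "y \<in> {0..1}"
    then show "y \<in> \<tau> ` {0..1}"
      using IVT'[of \<tau> 0 y 1] assms unfolding time_change_def by fastforce
  qed (use time_change_in[OF assms] in blast)
  have gl: "g (\<tau> s) = s" if "s \<in> {0..1}" for s
    using that inj by (simp add: g_def)
  have lg: "\<tau> (g s) = s" "g s \<in> {0..1}" if "s \<in> {0..1}" for s
    using that im by (metis f_inv_into_f g_def, metis inv_into_into g_def)
  have cont: "continuous_on {0..1} g"
    using continuous_on_inv[of "{0..1}" \<tau> g] assms gl im unfolding time_change_def by auto
  have "strict_mono_on {0..1} g"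
    unfolding strict_mono_on_def using time_change_mono[OF assms] lg
    by (metis leD linorder_not_less)
  moreover have "g 0 = 0" "g 1 = 1"
    using gl[of 0] gl[of 1] assms by (auto simp: time_change_def)
  ultimately have "time_change g" using cont by (simp add: time_change_def)
  then show ?thesis using that gl lg(1) by blast
qed

lemma skorokhod_close_nonneg: "skorokhod_close e x y \<Longrightarrow> 0 \<le> e"
  unfolding skorokhod_close_def by force

lemma skorokhod_close_sym:
  assumes "skorokhod_close e x y"
  shows "skorokhod_close e y x"
proof -
  obtain l m where lm: "time_change l" "time_change m"
    "\<And>s. s \<in> {0..1} \<Longrightarrow> \<bar>l s - s\<bar> \<le> e" "\<And>s. s \<in> {0..1} \<Longrightarrow> \<bar>m s - s\<bar> \<le> e"
    "\<And>s t. s \<in> {0..1} \<Longrightarrow> t \<in> {0..1} \<Longrightarrow> \<bar>x (s, t) - y (l s, m t)\<bar> \<le> e"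
    using assms unfolding skorokhod_close_def by blast
  obtain l' where l': "time_change l'" "\<And>s. s \<in> {0..1} \<Longrightarrow> l (l' s) = s"
    using time_change_inverse[OF lm(1)] by metis
  obtain m' where m': "time_change m'" "\<And>s. s \<in> {0..1} \<Longrightarrow> m (m' s) = s"
    using time_change_inverse[OF lm(2)] by metis
  have "\<bar>l' s - s\<bar> \<le> e" "\<bar>m' s - s\<bar> \<le> e" if "s \<in> {0..1}" for s
    using lm(3)[of "l' s"] lm(4)[of "m' s"] l' m' time_change_in that by (auto simp: abs_minus_commute)
  moreover have "\<bar>y (s, t) - x (l' s, m' t)\<bar> \<le> e" if "s \<in> {0..1}" "t \<in> {0..1}" for s t
    using lm(5)[of "l' s" "m' t"] l' m' time_change_in that by (auto simp: abs_minus_commute)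
  ultimately show ?thesis unfolding skorokhod_close_def using l' m' by blast
qed

lemma skorokhod_close_trans:
  assumes "skorokhod_close e x y" "skorokhod_close d y z"
  shows "skorokhod_close (e + d) x z"
proof -
  obtain l m where lm: "time_change l" "time_change m"
    "\<And>s. s \<in> {0..1} \<Longrightarrow> \<bar>l s - s\<bar> \<le> e" "\<And>s. s \<in> {0..1} \<Longrightarrow> \<bar>m s - s\<bar> \<le> e"
    "\<And>s t. s \<in> {0..1} \<Longrightarrow> t \<in> {0..1} \<Longrightarrow> \<bar>x (s, t) - y (l s, m t)\<bar> \<le> e"
    using assms(1) unfolding skorokhod_close_def by blast
  obtain l' m' where lm': "time_change l'" "time_change m'"
    "\<And>s. s \<in> {0..1} \<Longrightarrow> \<bar>l' s - s\<bar> \<le> d" "\<And>s. s \<in> {0..1} \<Longrightarrow> \<bar>m' s - s\<bar> \<le> d"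
    "\<And>s t. s \<in> {0..1} \<Longrightarrow> t \<in> {0..1} \<Longrightarrow> \<bar>y (s, t) - z (l' s, m' t)\<bar> \<le> d"
    using assms(2) unfolding skorokhod_close_def by blast
  have "\<bar>l' (l s) - s\<bar> \<le> e + d" "\<bar>m' (m s) - s\<bar> \<le> e + d" if "s \<in> {0..1}" for s
    using lm(3,4)[OF that] lm'(3)[OF time_change_in[OF lm(1) that]]
      lm'(4)[OF time_change_in[OF lm(2) that]] by linarith+
  moreover have "\<bar>x (s, t) - z (l' (l s), m' (m t))\<bar> \<le> e + d" if "s \<in> {0..1}" "t \<in> {0..1}" for s t
    using lm(5)[OF that] lm'(5)[OF time_change_in[OF lm(1) that(1)] time_change_in[OF lm(2) that(2)]]
    by linarith
  ultimately show ?thesis unfolding skorokhod_close_def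
    using time_change_comp[OF lm(1) lm'(1)] time_change_comp[OF lm(2) lm'(2)] by blast
qed

lemma skorokhod_D_bounded:
  assumes f: "f \<in> skorokhod_D"
  shows "\<exists>B. \<forall>p\<in>unit_square. \<bar>f p\<bar> \<le> B"
proof -
  have "\<exists>V B. open V \<and> p \<in> V \<and> (\<forall>q\<in>V \<inter> unit_square. \<bar>f q\<bar> \<le> B)"
    if p: "p \<in> unit_square" for p
  proof -
    have "\<exists>V B. open V \<and> p \<in> V \<and> (\<forall>q\<in>V. q \<noteq> p \<longrightarrow> q \<in> orthant a b p \<longrightarrow> \<bar>f q\<bar> \<le> B)" for a b
    proof -
      obtain l where "(f \<longlongrightarrow> l) (at p within orthant a b p)"
        using f p unfolding skorokhod_D_def by blast
      then have "\<forall>\<^sub>F q in at p within orthant a b p. dist (f q) l < 1"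
        by (rule tendstoD) simp
      then obtain V where V: "open V" "p \<in> V"
        "\<And>q. q \<in> V \<Longrightarrow> q \<noteq> p \<Longrightarrow> q \<in> orthant a b p \<Longrightarrow> dist (f q) l < 1"
        unfolding eventually_at_topological by blast
      have "\<bar>f q\<bar> \<le> \<bar>l\<bar> + 1" if "q \<in> V" "q \<noteq> p" "q \<in> orthant a b p" for q
        using V(3)[OF that] by (simp add: dist_real_def)
      then show ?thesis using V by blast
    qed
    then obtain V B where VB: "\<And>a b. open (V a b)" "\<And>a b. p \<in> V a b"
      "\<And>a b q. q \<in> V a b \<Longrightarrow> q \<noteq> p \<Longrightarrow> q \<in> orthant a b p \<Longrightarrow> \<bar>f q\<bar> \<le> B a b"
      by metis
    define V' where "V' = V True True \<inter> V True False \<inter> V False True \<inter> V False False"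
    define B' where "B' = \<bar>f p\<bar> + \<bar>B True True\<bar> + \<bar>B True False\<bar> + \<bar>B False True\<bar> + \<bar>B False False\<bar>"
    have "\<bar>f q\<bar> \<le> B'" if q: "q \<in> V' \<inter> unit_square" for q
    proof (cases "q = p")
      case False
      define a b where "a = (fst p \<le> fst q)" and "b = (snd p \<le> snd q)"
      have "q \<in> orthant a b p" using q by (auto simp: orthant_def a_def b_def)
      moreover have "q \<in> V a b" using q unfolding V'_def by (cases a; cases b) auto
      ultimately have "\<bar>f q\<bar> \<le> B a b" using VB(3) False by blast
      then show ?thesis unfolding B'_def by (cases a; cases b) auto
    qed (simp add: B'_def)
    moreover have "open V'" unfolding V'_def by (intro open_Int VB)
    moreover have "p \<in> V'" unfolding V'_def using VB(2) by blast
    ultimately show ?thesis by blast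
  qed
  then obtain V B where VB: "\<And>p. p \<in> unit_square \<Longrightarrow> open (V p)"
    "\<And>p. p \<in> unit_square \<Longrightarrow> p \<in> V p"
    "\<And>p q. p \<in> unit_square \<Longrightarrow> q \<in> V p \<inter> unit_square \<Longrightarrow> \<bar>f q\<bar> \<le> B p"
    by metis
  have "compact unit_square" unfolding unit_square_def by (intro compact_Times compact_Icc)
  then obtain P where P: "P \<subseteq> unit_square" "finite P" "unit_square \<subseteq> (\<Union>p\<in>P. V p)"
    using VB(1,2) by (elim compactE_image[of unit_square unit_square V]) auto
  have "\<bar>f q\<bar> \<le> (\<Sum>p\<in>P. \<bar>B p\<bar>)" if q: "q \<in> unit_square" for q
  proof -
    obtain p where p: "p \<in> P" "q \<in> V p" using P q by blast
    then have "\<bar>f q\<bar> \<le> B p" using VB(3) P q by blast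
    also have "\<dots> \<le> \<bar>B p\<bar>" by simp
    also have "\<dots> \<le> (\<Sum>p\<in>P. \<bar>B p\<bar>)" using p P by (intro member_le_sum) auto
    finally show ?thesis .
  qed
  then show ?thesis by blast
qed

lemma skorokhod_close_ex:
  assumes "x \<in> skorokhod_D" "y \<in> skorokhod_D"
  shows "\<exists>e. skorokhod_close e x y"
proof -
  obtain A B where AB: "\<And>p. p \<in> unit_square \<Longrightarrow> \<bar>x p\<bar> \<le> A" "\<And>p. p \<in> unit_square \<Longrightarrow> \<bar>y p\<bar> \<le> B"
    using skorokhod_D_bounded assms by metis
  have "\<bar>x (s, t) - y (s, t)\<bar> \<le> A + B" if "s \<in> {0..1}" "t \<in> {0..1}" for s t
    using AB[of "(s, t)"] that by (fastforce simp: unit_square_def)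
  moreover from this[of 0 0] have "0 \<le> A + B" by simp
  ultimately have "skorokhod_close (A + B) x y"
    unfolding skorokhod_close_def using time_change_id by (intro exI[of _ "\<lambda>x. x"]) auto
  then show ?thesis by blast
qed

lemma skorokhod_close_eq:
  assumes x: "x \<in> skorokhod_D" and y: "y \<in> skorokhod_D"
    and c: "\<And>e. 0 < e \<Longrightarrow> skorokhod_close e x y"
  shows "x = y"
proof -
  have eq: "x p = y p" if p: "p \<in> unit_square" for p
  proof (rule ccontr)
    assume ne: "x p \<noteq> y p"
    define d where "d = dist (x p) (y p) / 4"
    have d: "0 < d" using ne by (simp add: d_def)
    have "\<forall>\<^sub>F q in at p within orthant True True p. dist (x q) (x p) < d"
      "\<forall>\<^sub>F q in at p within orthant True True p. dist (y q) (y p) < d"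
      using x y p d unfolding skorokhod_D_def by (auto intro: tendstoD)
    then obtain r0 r1 where r0: "0 < r0" "0 < r1"
       "\<And>q. q \<in> orthant True True p \<Longrightarrow> q \<noteq> p \<Longrightarrow> dist q p < r0 \<Longrightarrow> dist (x q) (x p) < d"
       "\<And>q. q \<in> orthant True True p \<Longrightarrow> q \<noteq> p \<Longrightarrow> dist q p < r1 \<Longrightarrow> dist (y q) (y p) < d"
      unfolding eventually_at by blast
    define r where "r = min r0 r1"
    have r: "0 < r" using r0 by (simp add: r_def)
    have close: "dist (x q) (x p) < d \<and> dist (y q) (y p) < d"
      if "q \<in> orthant True True p" "dist q p < r" for q
      using r0 that d by (cases "q = p") (auto simp: r_def)
    define h where "h = r / 8"
    obtain a b where ab: "p = (a, b)" by (cases p)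
    have ab01: "a \<in> {0..1}" "b \<in> {0..1}" using p ab by (auto simp: unit_square_def)
    define s t where "s = min (a + h) 1" and "t = min (b + h) 1"
    define g where "g = min h (min (if s = 1 then h else s - a) (if t = 1 then h else t - b))"
    have h: "0 < h" using r by (simp add: h_def)
    have st: "s \<in> {0..1}" "t \<in> {0..1}" "a \<le> s" "b \<le> t" "s \<le> a + h" "t \<le> b + h"
      using ab01 h by (auto simp: s_def t_def)
    have g: "0 < g" "g \<le> h" "s \<noteq> 1 \<Longrightarrow> g \<le> s - a" "t \<noteq> 1 \<Longrightarrow> g \<le> t - b"
      using h by (auto simp: g_def s_def t_def min_def split: if_splits)
    obtain l m where lm: "time_change l" "time_change m"
      "\<And>s. s \<in> {0..1} \<Longrightarrow> \<bar>l s - s\<bar> \<le> min g d" "\<And>s. s \<in> {0..1} \<Longrightarrow> \<bar>m s - s\<bar> \<le> min g d"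
      "\<And>s t. s \<in> {0..1} \<Longrightarrow> t \<in> {0..1} \<Longrightarrow> \<bar>x (s, t) - y (l s, m t)\<bar> \<le> min g d"
      using c[of "min g d"] g d unfolding skorokhod_close_def by auto
    have ge: "a \<le> l s" "b \<le> m t"
    proof -
      show "a \<le> l s"
      proof (cases "s = 1")
        case True then show ?thesis using lm(1) ab01 by (simp add: time_change_def)
      next
        case False then show ?thesis using lm(3)[OF st(1)] g(3) by (auto simp: abs_le_iff)
      qed
      show "b \<le> m t"
      proof (cases "t = 1")
        case True then show ?thesis using lm(2) ab01 by (simp add: time_change_def)
      next
        case False then show ?thesis using lm(4)[OF st(2)] g(4) by (auto simp: abs_le_iff)
      qed
    qed
    have le: "l s \<le> a + 2 * h" "m t \<le> b + 2 * h"
      using lm(3)[OF st(1)] lm(4)[OF st(2)] st g(2) by linarith+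
    have near: "dist (u, v) p < r" if "a \<le> u" "u \<le> a + 2 * h" "b \<le> v" "v \<le> b + 2 * h" for u v
    proof -
      have "dist (u, v) (a, b) \<le> \<bar>u - a\<bar> + \<bar>v - b\<bar>"
        using sqrt_sum_squares_le_sum_abs[of "u - a" "v - b"]
        by (simp add: dist_prod_def dist_real_def)
      also have "\<dots> \<le> 4 * h" using that by linarith
      also have "\<dots> < r" using r by (simp add: h_def)
      finally show ?thesis using ab by simp
    qed
    have "dist (x (s, t)) (x p) < d"
      using close[of "(s, t)"] near[of s t] st h ab by (auto simp: orthant_def unit_square_def)
    moreover have "dist (y (l s, m t)) (y p) < d"
      using close[of "(l s, m t)"] near[of "l s" "m t"] ge le ab
        time_change_in[OF lm(1) st(1)] time_change_in[OF lm(2) st(2)]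
      by (auto simp: orthant_def unit_square_def)
    moreover have "dist (x (s, t)) (y (l s, m t)) \<le> d"
      using lm(5)[OF st(1,2)] by (simp add: dist_real_def)
    ultimately have "dist (x p) (y p) < 3 * d"
      by (simp add: dist_real_def)
    then show False using d by (simp add: d_def)
  qed
  show ?thesis
    using x y eq by (intro extensionalityI[of x unit_square y]) (auto simp: skorokhod_D_def)
qed

lemma skorokhod_close_mono:
  assumes "skorokhod_close e x y" "e \<le> d"
  shows "skorokhod_close d x y"
proof -
  obtain l m where lm: "time_change l" "time_change m"
    "\<And>s. s \<in> {0..1} \<Longrightarrow> \<bar>l s - s\<bar> \<le> e" "\<And>s. s \<in> {0..1} \<Longrightarrow> \<bar>m s - s\<bar> \<le> e"
    "\<And>s t. s \<in> {0..1} \<Longrightarrow> t \<in> {0..1} \<Longrightarrow> \<bar>x (s, t) - y (l s, m t)\<bar> \<le> e"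
    using assms(1) unfolding skorokhod_close_def by blast
  have "\<forall>s\<in>{0..1}. \<bar>l s - s\<bar> \<le> d" "\<forall>s\<in>{0..1}. \<bar>m s - s\<bar> \<le> d"
    "\<forall>s\<in>{0..1}. \<forall>t\<in>{0..1}. \<bar>x (s, t) - y (l s, m t)\<bar> \<le> d"
    using order_trans[OF lm(3) assms(2)] order_trans[OF lm(4) assms(2)]
      order_trans[OF lm(5) assms(2)] by simp_all
  then show ?thesis unfolding skorokhod_close_def using lm(1,2) by metis
qed

lemma skorokhod_close_refl: "skorokhod_close 0 x x"
  unfolding skorokhod_close_def using time_change_id by (intro exI[of _ "\<lambda>x. x"]) auto

interpretation Skorokhod: Metric_space skorokhod_D skorokhod_dist
proof
  have bdd: "bdd_below {e. skorokhod_close e x y}" for x y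
    using skorokhod_close_nonneg by (intro bdd_belowI[of _ 0]) auto
  have dist_le: "skorokhod_dist x y \<le> e"
    if "skorokhod_close e x y" "x \<in> skorokhod_D" "y \<in> skorokhod_D" for e x y
    unfolding skorokhod_dist_def using that cInf_lower[OF _ bdd, of e x y] by simp
  fix x y
  show nonneg: "0 \<le> skorokhod_dist x y"
    unfolding skorokhod_dist_def
    using skorokhod_close_ex[of x y] by (auto intro!: cInf_greatest dest: skorokhod_close_nonneg)
  have "skorokhod_close e x y \<longleftrightarrow> skorokhod_close e y x" for e
    by (rule iffI; erule skorokhod_close_sym)
  then have "Inf {e. skorokhod_close e x y} = Inf {e. skorokhod_close e y x}"
    by presburger
  then show "skorokhod_dist x y = skorokhod_dist y x"
    unfolding skorokhod_dist_def by presburger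
  show "skorokhod_dist x y = 0 \<longleftrightarrow> x = y" if D: "x \<in> skorokhod_D" "y \<in> skorokhod_D"
  proof
    assume z: "skorokhod_dist x y = 0"
    have "skorokhod_close e x y" if e: "0 < e" for e
    proof -
      have "Inf {e. skorokhod_close e x y} < e" using z e D by (simp add: skorokhod_dist_def)
      moreover have "{e. skorokhod_close e x y} \<noteq> {}" using skorokhod_close_ex[OF D] by simp
      ultimately obtain e' where e': "skorokhod_close e' x y" "e' < e"
        using cInf_lessD[of "{e. skorokhod_close e x y}" e] by auto
      then show ?thesis by (intro skorokhod_close_mono[OF e'(1)]) simp
    qed
    then show "x = y" using skorokhod_close_eq[OF D] by blast
  next
    assume "x = y"
    then have "skorokhod_dist x y \<le> 0" using dist_le[OF skorokhod_close_refl D(1,1)] by simp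
    then show "skorokhod_dist x y = 0" using nonneg by linarith
  qed
  fix z
  assume D: "x \<in> skorokhod_D" "y \<in> skorokhod_D" "z \<in> skorokhod_D"
  show "skorokhod_dist x z \<le> skorokhod_dist x y + skorokhod_dist y z"
  proof (rule field_le_epsilon)
    fix e :: real assume e: "0 < e"
    have ex: "\<exists>d. skorokhod_close d u v \<and> d < skorokhod_dist u v + e / 2"
      if "u \<in> skorokhod_D" "v \<in> skorokhod_D" for u v
    proof -
      have "{e. skorokhod_close e u v} \<noteq> {}" using skorokhod_close_ex[OF that] by blast
      then show ?thesis
        using cInf_lessD[of "{e. skorokhod_close e u v}" "skorokhod_dist u v + e / 2"] e that
        by (auto simp: skorokhod_dist_def)
    qed
    obtain d1 where d1: "skorokhod_close d1 x y" "d1 < skorokhod_dist x y + e / 2"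
      using ex[OF D(1,2)] by auto
    obtain d2 where d2: "skorokhod_close d2 y z" "d2 < skorokhod_dist y z + e / 2"
      using ex[OF D(2,3)] by auto
    have "skorokhod_dist x z \<le> d1 + d2"
      by (rule dist_le[OF skorokhod_close_trans[OF d1(1) d2(1)] D(1,3)])
    then show "skorokhod_dist x z \<le> skorokhod_dist x y + skorokhod_dist y z + e"
      using d1(2) d2(2) by linarith
  qed
qed

definition skorokhod_topology :: "(real \<times> real \<Rightarrow> real) topology" where
  "skorokhod_topology = Skorokhod.mtopology"


section \<open>Convergence in distribution in a topological space\<close>

definition borel_of_topology :: "'s topology \<Rightarrow> 's measure" where
  "borel_of_topology T = sigma (topspace T) {A. openin T A}"

text \<open>
  The \<open>n\<close>-th random element may live on its own probability space. Measurability is part of the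
  notion, so that the expectations below are those of bounded measurable functions.
\<close>

definition converges_in_distribution ::
  "'s topology \<Rightarrow> (nat \<Rightarrow> 'w measure) \<Rightarrow> (nat \<Rightarrow> 'w \<Rightarrow> 's) \<Rightarrow> 'v measure \<Rightarrow> ('v \<Rightarrow> 's) \<Rightarrow> bool" where
  "converges_in_distribution T M X N Y \<longleftrightarrow>
     (\<forall>\<^sub>F n in sequentially. X n \<in> measurable (M n) (borel_of_topology T)) \<and>
     Y \<in> measurable N (borel_of_topology T) \<and>
     (\<forall>h :: 's \<Rightarrow> real. continuous_map T euclideanreal h \<and> bounded (h ` topspace T) \<longrightarrow>
        (\<lambda>n. \<integral>\<omega>. h (X n \<omega>) \<partial>M n) \<longlonglongrightarrow> (\<integral>\<omega>. h (Y \<omega>) \<partial>N))"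


section \<open>The limiting Gaussian process\<close>

text \<open>Degenerate Gaussian laws are allowed.\<close>

definition gaussian_rv :: "'v measure \<Rightarrow> ('v \<Rightarrow> real) \<Rightarrow> bool" where
  "gaussian_rv N X \<longleftrightarrow> X \<in> borel_measurable N \<and>
     (\<exists>m \<sigma>. 0 \<le> \<sigma> \<and> distr N borel X =
        (if \<sigma> = 0 then return borel m else density lborel (normal_density m \<sigma>)))"

definition gaussian_process :: "'v measure \<Rightarrow> 'i set \<Rightarrow> ('i \<Rightarrow> 'v \<Rightarrow> real) \<Rightarrow> bool" where
  "gaussian_process N I X \<longleftrightarrow>
     (\<forall>J a. finite J \<and> J \<subseteq> I \<longrightarrow> gaussian_rv N (\<lambda>\<omega>. \<Sum>p\<in>J. a p * X p \<omega>))"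

definition W_cov :: "real \<times> real \<Rightarrow> real \<times> real \<Rightarrow> real" where
  "W_cov = (\<lambda>(s, t) (s', t'). s * s' * min t t' + min s s' * t * t' - 2 * s * s' * t * t')"

definition is_W_infinity :: "'v measure \<Rightarrow> (real \<times> real \<Rightarrow> 'v \<Rightarrow> real) \<Rightarrow> bool" where
  "is_W_infinity N W \<longleftrightarrow> prob_space N \<and> gaussian_process N unit_square W \<and>
     (\<forall>\<omega>\<in>space N. continuous_on unit_square (\<lambda>p. W p \<omega>)) \<and>
     (\<forall>p\<in>unit_square. (\<integral>\<omega>. W p \<omega> \<partial>N) = 0) \<and>
     (\<forall>p\<in>unit_square. \<forall>q\<in>unit_square. (\<integral>\<omega>. W p \<omega> * W q \<omega> \<partial>N) = W_cov p q)"


section \<open>Random matrices\<close>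

definition unitary_group :: "nat \<Rightarrow> complex mat set" where
  "unitary_group n = {A \<in> carrier_mat n n. mat_adjoint A * A = 1\<^sub>m n}"

text \<open>
  Real orthogonal matrices, viewed as complex ones. The constant \<open>orthogonal_mat\<close> of the library
  is a different notion (pairwise orthogonal, non-zero columns).
\<close>

definition orthogonal_group :: "nat \<Rightarrow> complex mat set" where
  "orthogonal_group n =
     {A \<in> carrier_mat n n. elements_mat A \<subseteq> \<real> \<and> transpose_mat A * A = 1\<^sub>m n}"

text \<open>The Borel \<open>\<sigma>\<close>-algebra of a set \<open>G\<close> of \<open>n \<times> n\<close> matrices, generated by the entries.\<close>

definition mat_borel :: "nat \<Rightarrow> complex mat set \<Rightarrow> complex mat measure" where
  "mat_borel n G = vimage_algebra G (\<lambda>A. \<lambda>(i, j)\<in>{..<n} \<times> {..<n}. A $$ (i, j))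
     (\<Pi>\<^sub>M ij\<in>{..<n} \<times> {..<n}. borel)"

text \<open>
  \<open>U\<close> is distributed according to the Haar probability measure of the compact group \<open>G\<close>, i.e. the
  (unique, and automatically also right invariant) left invariant Borel probability measure.
\<close>

definition haar_distributed :: "nat \<Rightarrow> complex mat set \<Rightarrow> 'w measure \<Rightarrow> ('w \<Rightarrow> complex mat) \<Rightarrow> bool" where
  "haar_distributed n G M U \<longleftrightarrow> U \<in> measurable M (mat_borel n G) \<and>
     (let \<mu> = distr M (mat_borel n G) U in
        prob_space \<mu> \<and> (\<forall>V\<in>G. distr \<mu> (mat_borel n G) (\<lambda>A. V * A) = \<mu>))"

text \<open>Row and column indices start at \<open>0\<close> here, which absorbs the shifts \<open>j - 1\<close> and \<open>k - 1\<close>.\<close>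

definition dft_mat :: "nat \<Rightarrow> complex mat" where
  "dft_mat n = mat n n (\<lambda>(j, k).
     complex_of_real (1 / sqrt (real n)) * exp (- 2 * \<i> * complex_of_real pi * of_nat j * of_nat k / of_nat n))"


section \<open>The truncated process\<close>

text \<open>
  The setting for a fixed \<open>n\<close>: independence of the two independent families \<open>R\<close> and \<open>C\<close> of
  independent variables is independence of the single family indexed by the disjoint union.
  Independence of \<open>(R, C)\<close> and \<open>U\<close>, whose types differ, is that of the generated \<open>\<sigma>\<close>-algebras.
\<close>

definition truncation_setting ::
  "nat \<Rightarrow> 'w measure \<Rightarrow> ('w \<Rightarrow> complex mat) \<Rightarrow> (nat \<Rightarrow> 'w \<Rightarrow> real) \<Rightarrow> (nat \<Rightarrow> 'w \<Rightarrow> real) \<Rightarrow> bool" where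
  "truncation_setting n M U R C \<longleftrightarrow> prob_space M \<and>
     U \<in> measurable M (mat_borel n (unitary_group n)) \<and>
     (\<forall>i<n. distr M borel (R i) = uniform_measure lborel {0..1}) \<and>
     (\<forall>j<n. distr M borel (C j) = uniform_measure lborel {0..1}) \<and>
     prob_space.indep_vars M (\<lambda>_. borel) (case_sum R C) ({..<n} <+> {..<n}) \<and>
     prob_space.indep_set M
       (sets (vimage_algebra (space M) (\<lambda>\<omega>. \<lambda>k\<in>{..<n} <+> {..<n}. case_sum R C k \<omega>)
          (\<Pi>\<^sub>M k\<in>{..<n} <+> {..<n}. borel)))
       (sets (vimage_algebra (space M) U (mat_borel n (unitary_group n))))"

definition T_process ::
  "nat \<Rightarrow> ('w \<Rightarrow> complex mat) \<Rightarrow> (nat \<Rightarrow> 'w \<Rightarrow> real) \<Rightarrow> (nat \<Rightarrow> 'w \<Rightarrow> real) \<Rightarrow> real \<times> real \<Rightarrow> 'w \<Rightarrow> real" where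
  "T_process n U R C = (\<lambda>(s, t) \<omega>. \<Sum>i<n. \<Sum>j<n.
     (cmod (U \<omega> $$ (i, j)))\<^sup>2 * indicator {..s} (R i \<omega>) * indicator {..t} (C j \<omega>))"

definition normalized_T ::
  "nat \<Rightarrow> 'w measure \<Rightarrow> ('w \<Rightarrow> complex mat) \<Rightarrow> (nat \<Rightarrow> 'w \<Rightarrow> real) \<Rightarrow> (nat \<Rightarrow> 'w \<Rightarrow> real) \<Rightarrow>
     'w \<Rightarrow> real \<times> real \<Rightarrow> real" where
  "normalized_T n M U R C \<omega> = (\<lambda>p\<in>unit_square.
     (T_process n U R C p \<omega> - (\<integral>\<omega>'. T_process n U R C p \<omega>' \<partial>M)) / sqrt (real n))"

end

theory Submission
  imports Defs "HOL-Real_Asymp.Real_Asymp"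
begin

text \<open>
  The matrix \<open>A i j = \<bar>U i j\<bar>\<^sup>2\<close> is bistochastic. Centering the indicators of \<open>R i \<le> s\<close> and
  \<open>C j \<le> t\<close> therefore splits the process, after normalization, into
  \<open>t * E\<^sub>R s + s * E\<^sub>C t + Z s t\<close>, where \<open>E\<^sub>R\<close> and \<open>E\<^sub>C\<close> are the empirical processes of the two samples
  and \<open>Z\<close> is a bilinear form in the centered indicators with coefficients \<open>A i j / sqrt n\<close>.

  The terms of \<open>Z\<close> are orthogonal, so its second moments are of the order of \<open>E (\<Sum> (A i j)\<^sup>2) / n\<close>,
  and \<open>E (\<Sum> (A i j)\<^sup>2)\<close> is bounded: it is \<open>1\<close> in the flat case, and at most \<open>6\<close> under the Haar
  measure. Chaining in \<open>s\<close> and a union bound over \<open>t\<close> then make \<open>Z\<close> uniformly negligible.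

  The empirical processes are tight by chaining with fourth moments. The finite-dimensional
  distributions converge by characteristic functions and the Stone-Weierstrass theorem. It suffices
  to test the convergence on Lipschitz functions, and for these the process may be replaced by its
  restriction to a coarse grid, since the Skorokhod distance is below the uniform one.
\<close>

section \<open>Elements of the Skorokhod space\<close>

text \<open>Two obstacles fix the scales. The fourth moment of an increment of length h of an
  empirical process is at most 3 * h^2 + h / n; in the chaining sum the second term contributes a
  quantity of order a^8 / n on level a, which does not decay in a, so the chaining has to stop at a
  finite level l. Below that level only monotonicity is left: between neighbouring grid points the
  normalized centering moves by about sqrt n / 2^l, so 2^l must outgrow sqrt n. For Z only second
  moments of order h / n are at hand. Chaining in one variable costs powers of l, but the union over
  the 2^l + 1 values of the other costs a factor 2^l / n, so 2^l must stay well below n. The coarse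
  level q is separate and fixed before n, since the finite-dimensional limit needs a grid that does
  not grow. Measurability into the Borel sets of the Skorokhod topology is part of the claim. It is
  obtained by rounding the finitely many random coordinates: any function of a countably valued
  measurable variable is measurable, and pointwise metric limits preserve this.\<close>

definition orthant_limits :: "(real \<times> real \<Rightarrow> real) \<Rightarrow> bool" where
  "orthant_limits f \<longleftrightarrow> (\<forall>p\<in>unit_square.
     (f \<longlongrightarrow> f p) (at p within orthant True True p) \<and>
     (\<forall>a b. \<exists>l. (f \<longlongrightarrow> l) (at p within orthant a b p)))"

lemma orthant_subset: "orthant a b p \<subseteq> unit_square"
  by (auto simp: orthant_def)

text \<open>\<open>orthant_limits\<close> is the condition of \<open>skorokhod_D\<close> without
  \<open>extensional\<close>, so that sums and multiples can be formed with unrestricted functions;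
  the restriction is taken once, at the end, by this lemma.\<close>

lemma restrict_in_skorokhod_D:
  assumes "orthant_limits f"
  shows "restrict f unit_square \<in> skorokhod_D"
proof -
  have ev: "\<forall>\<^sub>F q in at p within orthant a b p. f q = restrict f unit_square q" for a b p
    using orthant_subset[of a b p] by (auto simp: eventually_at intro!: exI[of _ 1])
  have eq: "(restrict f unit_square \<longlongrightarrow> l) (at p within orthant a b p) \<longleftrightarrow>
      (f \<longlongrightarrow> l) (at p within orthant a b p)" for l a b p
    by (rule tendsto_cong[OF ev, symmetric])
  show ?thesis
    using assms unfolding skorokhod_D_def orthant_limits_def by (simp add: eq)
qed

lemma orthant_limits_add:
  assumes "orthant_limits f" "orthant_limits g"
  shows "orthant_limits (\<lambda>p. f p + g p)"
  using assms unfolding orthant_limits_def by (auto intro!: tendsto_add) (blast intro: tendsto_add)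

lemma orthant_limits_cmult:
  assumes "orthant_limits f"
  shows "orthant_limits (\<lambda>p. c * f p)"
  using assms unfolding orthant_limits_def
  by (auto intro!: tendsto_mult_left) (blast intro: tendsto_mult_left)

lemma orthant_limits_continuous:
  assumes "continuous_on unit_square f"
  shows "orthant_limits f"
proof -
  have "(f \<longlongrightarrow> f p) (at p within orthant a b p)" if "p \<in> unit_square" for a b p
    using assms that unfolding continuous_on_def
    by (intro tendsto_within_subset[OF _ orthant_subset]) blast
  then show ?thesis unfolding orthant_limits_def by blast
qed

lemma orthant_limits_sum:
  assumes "finite I" "\<And>i. i \<in> I \<Longrightarrow> orthant_limits (f i)"
  shows "orthant_limits (\<lambda>p. \<Sum>i\<in>I. f i p)"
  using assms
  by (induction I rule: finite_induct)
     (auto intro: orthant_limits_add orthant_limits_continuous continuous_on_const)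

text \<open>Right continuous piecewise constant maps without any topology on the codomain: the
  instances take values in \<open>bool\<close> (the comparison with a jump point) and in
  \<open>int\<close> (the floor).\<close>

definition right_step :: "(real \<Rightarrow> 'a) \<Rightarrow> bool" where
  "right_step \<phi> \<longleftrightarrow> (\<forall>x. \<exists>\<delta>>0. (\<forall>y. x \<le> y \<and> y < x + \<delta> \<longrightarrow> \<phi> y = \<phi> x) \<and>
     (\<exists>c. \<forall>y. x - \<delta> < y \<and> y < x \<longrightarrow> \<phi> y = c))"

lemma right_step_le: "right_step (\<lambda>s. r \<le> s)"
proof -
  have "\<exists>\<delta>>0. (\<forall>y. x \<le> y \<and> y < x + \<delta> \<longrightarrow> (r \<le> y) = (r \<le> x)) \<and>
     (\<exists>c. \<forall>y. x - \<delta> < y \<and> y < x \<longrightarrow> (r \<le> y) = c)" for x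
  proof -
    consider "r < x" | "r = x" | "x < r" by linarith
    then show ?thesis
    proof cases
      case 1 then show ?thesis by (intro exI[of _ "x - r"]) (auto intro!: exI[of _ True])
    next
      case 2 then show ?thesis by (intro exI[of _ 1]) (auto intro!: exI[of _ False])
    next
      case 3 then show ?thesis by (intro exI[of _ "r - x"]) (auto intro!: exI[of _ False])
    qed
  qed
  then show ?thesis unfolding right_step_def by blast
qed

lemma right_step_floor:
  fixes k :: real
  assumes "0 < k"
  shows "right_step (\<lambda>s. \<lfloor>k * s\<rfloor>)"
proof -
  have "\<exists>\<delta>>0. (\<forall>y. x \<le> y \<and> y < x + \<delta> \<longrightarrow> \<lfloor>k * y\<rfloor> = \<lfloor>k * x\<rfloor>) \<and>
     (\<exists>c. \<forall>y. x - \<delta> < y \<and> y < x \<longrightarrow> \<lfloor>k * y\<rfloor> = c)" for x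
  proof -
    \<comment> \<open>The distances from \<open>x\<close> to the first jump strictly above it and to
      the last jump strictly below it.\<close>
    define \<delta> where "\<delta> = min ((\<lfloor>k * x\<rfloor> + 1 - k * x) / k) ((k * x - (\<lceil>k * x\<rceil> - 1)) / k)"
    have "0 < of_int (\<lfloor>k * x\<rfloor> + 1) - k * x" "0 < k * x - of_int (\<lceil>k * x\<rceil> - 1)" by linarith+
    then have d: "0 < \<delta>" unfolding \<delta>_def using assms by simp
    have d1: "k * \<delta> \<le> \<lfloor>k * x\<rfloor> + 1 - k * x" "k * \<delta> \<le> k * x - (\<lceil>k * x\<rceil> - 1)"
      unfolding \<delta>_def using assms by (simp_all add: min_def field_simps)
    have 1: "\<lfloor>k * y\<rfloor> = \<lfloor>k * x\<rfloor>" if "x \<le> y" "y < x + \<delta>" for y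
    proof -
      have "k * x \<le> k * y" using that assms by simp
      moreover have "k * y < k * x + k * \<delta>"
        using that assms by (metis distrib_left mult_less_cancel_left_pos)
      ultimately show ?thesis using d1 by linarith
    qed
    have 2: "\<lfloor>k * y\<rfloor> = \<lceil>k * x\<rceil> - 1" if "x - \<delta> < y" "y < x" for y
    proof -
      have "k * y < k * x" using that assms by simp
      moreover have "k * x - k * \<delta> < k * y"
        using that assms by (metis right_diff_distrib mult_less_cancel_left_pos)
      ultimately show ?thesis using d1 by linarith
    qed
    show ?thesis using d 1 2 by blast
  qed
  then show ?thesis unfolding right_step_def by blast
qed

text \<open>\<open>\<pi>\<close> stands for \<open>fst\<close> or \<open>snd\<close>. Inside an
  orthant a coordinate stays on one side of its value at \<open>p\<close>, so a step map of it is
  constant near \<open>p\<close>; on the closed side the constant is the value at \<open>p\<close>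
  itself.\<close>

lemma right_step_eventually_const:
  fixes \<pi> :: "real \<times> real \<Rightarrow> real"
  assumes \<phi>: "right_step \<phi>" and \<pi>: "\<And>q. dist (\<pi> q) (\<pi> p) \<le> dist q p"
    and side: "\<And>q. q \<in> orthant a b p \<Longrightarrow> if d then \<pi> p \<le> \<pi> q else \<pi> q < \<pi> p"
  obtains c where "\<forall>\<^sub>F q in at p within orthant a b p. \<phi> (\<pi> q) = c" "d \<Longrightarrow> c = \<phi> (\<pi> p)"
proof -
  obtain \<delta> c where \<delta>: "0 < \<delta>" "\<forall>y. \<pi> p \<le> y \<and> y < \<pi> p + \<delta> \<longrightarrow> \<phi> y = \<phi> (\<pi> p)"
    "\<forall>y. \<pi> p - \<delta> < y \<and> y < \<pi> p \<longrightarrow> \<phi> y = c"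
    using \<phi>[unfolded right_step_def, THEN spec, of "\<pi> p"] by blast
  define c' where "c' = (if d then \<phi> (\<pi> p) else c)"
  have "\<phi> (\<pi> q) = c'" if "q \<in> orthant a b p" "dist q p < \<delta>" for q
    using side[OF that(1)] that(2) \<pi>[of q] spec[OF \<delta>(2), of "\<pi> q"] spec[OF \<delta>(3), of "\<pi> q"]
    unfolding c'_def by (cases d) (auto simp: dist_real_def abs_less_iff)
  then have "\<forall>\<^sub>F q in at p within orthant a b p. \<phi> (\<pi> q) = c'"
    unfolding eventually_at using \<delta>(1) by blast
  then show thesis by (rule that) (simp add: c'_def)
qed

text \<open>Both step maps are eventually constant within an orthant, hence \<open>g\<close> can be
  an arbitrary function.\<close>

lemma orthant_limits_step:
  assumes "right_step \<phi>" "right_step \<psi>"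
  shows "orthant_limits (\<lambda>p. g (\<phi> (fst p)) (\<psi> (snd p)))"
proof -
  have *: "\<exists>l. ((\<lambda>p. g (\<phi> (fst p)) (\<psi> (snd p))) \<longlongrightarrow> l) (at p within orthant a b p) \<and>
      (a \<longrightarrow> b \<longrightarrow> l = g (\<phi> (fst p)) (\<psi> (snd p)))" for p a b
  proof -
    obtain c where c: "\<forall>\<^sub>F q in at p within orthant a b p. \<phi> (fst q) = c" "a \<Longrightarrow> c = \<phi> (fst p)"
      by (rule right_step_eventually_const[OF assms(1), of fst p a b a])
        (auto simp: orthant_def dist_fst_le split: if_splits)
    obtain d where d: "\<forall>\<^sub>F q in at p within orthant a b p. \<psi> (snd q) = d" "b \<Longrightarrow> d = \<psi> (snd p)"
      by (rule right_step_eventually_const[OF assms(2), of snd p a b b])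
        (auto simp: orthant_def dist_snd_le split: if_splits)
    have "\<forall>\<^sub>F q in at p within orthant a b p. g (\<phi> (fst q)) (\<psi> (snd q)) = g c d"
      using c(1) d(1) by eventually_elim simp
    then have "((\<lambda>p. g (\<phi> (fst p)) (\<psi> (snd p))) \<longlongrightarrow> g c d) (at p within orthant a b p)"
      by (rule tendsto_eventually)
    then show ?thesis using c d by blast
  qed
  show ?thesis
    unfolding orthant_limits_def
  proof (intro ballI conjI allI)
    fix p a b
    show "\<exists>l. ((\<lambda>p. g (\<phi> (fst p)) (\<psi> (snd p))) \<longlongrightarrow> l) (at p within orthant a b p)"
      using * by blast
    show "((\<lambda>p. g (\<phi> (fst p)) (\<psi> (snd p))) \<longlongrightarrow> g (\<phi> (fst p)) (\<psi> (snd p))) (at p within orthant True True p)"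
      using *[of p True True] by auto
  qed
qed

lemma skorokhod_dist_le:
  assumes "skorokhod_close e x y" "x \<in> skorokhod_D" "y \<in> skorokhod_D"
  shows "skorokhod_dist x y \<le> e"
  unfolding skorokhod_dist_def
  using assms skorokhod_close_nonneg by (auto intro!: cInf_lower bdd_belowI[of _ 0])

lemma skorokhod_dist_le_uniform:
  assumes "x \<in> skorokhod_D" "y \<in> skorokhod_D" "\<And>p. p \<in> unit_square \<Longrightarrow> \<bar>x p - y p\<bar> \<le> e"
  shows "skorokhod_dist x y \<le> e"
proof (rule skorokhod_dist_le[OF _ assms(1,2)])
  have "0 \<le> e" using assms(3)[of "(0, 0)"] by (simp add: unit_square_def)
  then show "skorokhod_close e x y"
    unfolding skorokhod_close_def using time_change_id assms(3)
    by (intro exI[of _ "\<lambda>x. x"]) (auto simp: unit_square_def)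
qed

section \<open>Measurability of random elements of the Skorokhod space\<close>

text \<open>An open set \<open>A\<close> is the union of the sets \<open>C m\<close> of points at
  distance at least \<open>1 / Suc m\<close> from its complement, and the limit lies in
  \<open>A\<close> iff the sequence finally stays in one of the \<open>C m\<close>. This turns the
  preimage of \<open>A\<close> into a countable union of countable intersections.\<close>

lemma (in Metric_space) measurable_borel_of_limit:
  assumes f: "\<And>k. f k \<in> measurable N (borel_of_topology mtopology)"
    and g: "\<And>\<omega>. \<omega> \<in> space N \<Longrightarrow> g \<omega> \<in> M"
    and lim: "\<And>\<omega>. \<omega> \<in> space N \<Longrightarrow> (\<lambda>k::nat. d (f k \<omega>) (g \<omega>)) \<longlonglongrightarrow> 0"
  shows "g \<in> measurable N (borel_of_topology mtopology)"
proof -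
  have fM: "f k \<omega> \<in> M" if "\<omega> \<in> space N" for k \<omega>
    using measurable_space[OF f that] by (simp add: borel_of_topology_def space_measure_of_conv)
  have sets: "sets (borel_of_topology mtopology) = sigma_sets M {A. openin mtopology A}"
    unfolding borel_of_topology_def using openin_subset[of mtopology]
    by (subst sets_measure_of) auto
  have op: "A \<in> sets (borel_of_topology mtopology)" if "openin mtopology A" for A
    using that sets by (auto intro: sigma_sets.Basic)
  have space: "space (borel_of_topology mtopology) = M"
    by (simp add: borel_of_topology_def space_measure_of_conv)
  show ?thesis
    unfolding borel_of_topology_def
  proof (rule measurable_sigma_sets)
    show "sets (sigma (topspace mtopology) (Collect (openin mtopology))) =
        sigma_sets M {A. openin mtopology A}"
      using sets by (simp add: borel_of_topology_def)
    show "{A. openin mtopology A} \<subseteq> Pow M" using openin_subset[of mtopology] by auto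
    show "g \<in> space N \<rightarrow> M" using g by auto
    fix A assume "A \<in> {A. openin mtopology A}"
    then have A: "openin mtopology A" by simp
    define C where "C m = M - (\<Union>y\<in>M - A. mball y (1 / Suc m))" for m :: nat
    have "C m \<in> sets (borel_of_topology mtopology)" for m
    proof -
      have "openin mtopology (\<Union>y\<in>M - A. mball y (1 / Suc m))" by auto
      then show ?thesis unfolding C_def using op op[OF openin_topspace] by (auto)
    qed
    then have meas[measurable]: "f k -` C m \<inter> space N \<in> sets N" for k m
      using measurable_sets[OF f] by blast
    have "g -` A \<inter> space N = (\<Union>m. \<Union>K. \<Inter>k\<in>{K..}. f k -` C m \<inter> space N)"
    proof (intro equalityI subsetI)
      fix \<omega> assume "\<omega> \<in> g -` A \<inter> space N"
      then have \<omega>: "\<omega> \<in> space N" "g \<omega> \<in> A" by auto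
      obtain r where r: "0 < r" "mball (g \<omega>) r \<subseteq> A"
        using A \<omega> unfolding openin_mtopology by blast
      obtain m where m: "1 / Suc m < r / 2"
        using r by (meson half_gt_zero nat_approx_posE)
      obtain K where K: "\<And>k. k \<ge> K \<Longrightarrow> \<bar>d (f k \<omega>) (g \<omega>)\<bar> < r / 2"
        using LIMSEQ_D[OF lim[OF \<omega>(1)], of "r / 2"] r by auto
      have "f k \<omega> \<in> C m" if k: "k \<ge> K" for k
        unfolding C_def
      proof (intro DiffI fM[OF \<omega>(1)] notI)
        assume "f k \<omega> \<in> (\<Union>y\<in>M - A. mball y (1 / Suc m))"
        then obtain y where y: "y \<in> M" "y \<notin> A" "d y (f k \<omega>) < 1 / Suc m" by auto
        have "d (g \<omega>) y \<le> d (g \<omega>) (f k \<omega>) + d (f k \<omega>) y"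
          by (intro triangle g \<omega> fM y)
        also have "\<dots> < r" using K[OF k] y(3) m by (simp add: commute)
        finally have "y \<in> mball (g \<omega>) r" using y g[OF \<omega>(1)] by simp
        then show False using r y by auto
      qed
      then show "\<omega> \<in> (\<Union>m. \<Union>K. \<Inter>k\<in>{K..}. f k -` C m \<inter> space N)" using \<omega> by auto
    next
      fix \<omega> assume "\<omega> \<in> (\<Union>m. \<Union>K. \<Inter>k\<in>{K..}. f k -` C m \<inter> space N)"
      then obtain m K where mK: "\<And>k. k \<ge> K \<Longrightarrow> f k \<omega> \<in> C m" "\<omega> \<in> space N" by auto
      have "g \<omega> \<in> A"
      proof (rule ccontr)
        assume n: "g \<omega> \<notin> A"
        obtain K' where K': "\<And>k. k \<ge> K' \<Longrightarrow> \<bar>d (f k \<omega>) (g \<omega>)\<bar> < 1 / Suc m"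
          using LIMSEQ_D[OF lim[OF mK(2)], of "1 / Suc m"] by auto
        have "f (max K K') \<omega> \<in> mball (g \<omega>) (1 / Suc m)"
          using K'[of "max K K'"] g[OF mK(2)] fM[OF mK(2)] by (simp add: commute)
        then show False using mK(1)[of "max K K'"] n g[OF mK(2)] unfolding C_def by auto
      qed
      then show "\<omega> \<in> g -` A \<inter> space N" using mK by simp
    qed
    also have "\<dots> \<in> sets N" by measurable
    finally show "g -` A \<inter> space N \<in> sets N" .
  qed
qed

section \<open>Rounding of coordinates to dyadic numbers\<close>

definition dyadic_ceil :: "nat \<Rightarrow> real \<Rightarrow> real" where
  "dyadic_ceil k x = of_int \<lceil>2 ^ k * x\<rceil> / 2 ^ k"

lemma dyadic_ceil_bounds: "x \<le> dyadic_ceil k x" "dyadic_ceil k x \<le> x + (1/2) ^ k"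
proof -
  have "2 ^ k * x \<le> of_int \<lceil>2 ^ k * x\<rceil>" by simp
  then show "x \<le> dyadic_ceil k x" by (simp add: dyadic_ceil_def field_simps)
  have "of_int \<lceil>2 ^ k * x\<rceil> \<le> 2 ^ k * x + 1" by simp
  then show "dyadic_ceil k x \<le> x + (1/2) ^ k"
    by (simp add: dyadic_ceil_def field_simps)
qed

text \<open>Together with \<open>x \<le> dyadic_ceil k x\<close>, this shows that rounding up
  preserves the cases \<open>x \<le> 0\<close>, \<open>x = 1\<close> and \<open>x > 1\<close> at
  every level. Only the points strictly between 0 and 1 have to be moved by a time change.\<close>

lemma dyadic_ceil_simps: "x \<le> 0 \<Longrightarrow> dyadic_ceil k x \<le> 0" "dyadic_ceil k 1 = 1"
proof -
  show "dyadic_ceil k x \<le> 0" if "x \<le> 0"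
    using that by (simp add: dyadic_ceil_def divide_le_0_iff mult_le_0_iff)
  have "\<lceil>(2 ^ k :: real)\<rceil> = 2 ^ k" by (metis ceiling_of_int of_int_numeral of_int_power)
  then show "dyadic_ceil k 1 = 1" by (simp add: dyadic_ceil_def)
qed

text \<open>Neither continuity nor measurability of \<open>F\<close> is assumed. After rounding, the
  coordinate vector takes countably many values, so that every function of it is measurable; the
  hypothesis \<open>lim\<close> then leads back to the original coordinates.\<close>

lemma (in Metric_space) measurable_borel_of_discretized:
  assumes J: "finite J" and v: "\<And>j. j \<in> J \<Longrightarrow> v j \<in> borel_measurable N"
    and F: "\<And>x. F x \<in> M"
    and lim: "\<And>x. (\<lambda>k. d (F (\<lambda>j\<in>J. dyadic_ceil k (x j))) (F (\<lambda>j\<in>J. x j))) \<longlonglongrightarrow> 0"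
  shows "(\<lambda>\<omega>. F (\<lambda>j\<in>J. v j \<omega>)) \<in> measurable N (borel_of_topology mtopology)"
proof (rule measurable_borel_of_limit)
  have space: "space (borel_of_topology mtopology) = M"
    by (simp add: borel_of_topology_def space_measure_of_conv)
  fix k
  define A :: "('b \<Rightarrow> int) set" where "A = (\<Pi>\<^sub>E j\<in>J. UNIV)"
  define u where "u = (\<lambda>\<omega>. \<lambda>j\<in>J. \<lceil>2 ^ k * v j \<omega>\<rceil>)"
  have A: "countable A" unfolding A_def using J by (intro countable_PiE) auto
  have "u \<in> measurable N (count_space A)"
    unfolding measurable_count_space_eq_countable[OF A]
  proof (intro conjI ballI)
    show "u \<in> space N \<rightarrow> A" by (auto simp: u_def A_def)
    fix a assume a: "a \<in> A"
    have "u -` {a} \<inter> space N = {\<omega> \<in> space N. \<forall>j\<in>J. \<lceil>2 ^ k * v j \<omega>\<rceil> = a j}"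
    proof -
      have "u \<omega> = a \<longleftrightarrow> (\<forall>j\<in>J. \<lceil>2 ^ k * v j \<omega>\<rceil> = a j)" for \<omega>
      proof
        assume "\<forall>j\<in>J. \<lceil>2 ^ k * v j \<omega>\<rceil> = a j"
        then show "u \<omega> = a"
          using a by (intro extensionalityI[of _ J]) (auto simp: u_def A_def PiE_def)
      qed (auto simp: u_def)
      then show ?thesis by auto
    qed
    also have "\<dots> \<in> sets N"
      using v by (intro sets.sets_Collect_finite_All J) measurable
    finally show "u -` {a} \<inter> space N \<in> sets N" .
  qed
  moreover have "(\<lambda>a. F (\<lambda>j\<in>J. of_int (a j) / 2 ^ k)) \<in> measurable (count_space A) (borel_of_topology mtopology)"
    using F space by simp
  ultimately have "(\<lambda>\<omega>. F (\<lambda>j\<in>J. of_int (u \<omega> j) / 2 ^ k)) \<in> measurable N (borel_of_topology mtopology)"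
    by (rule measurable_compose)
  moreover have "(\<lambda>j\<in>J. of_int (u \<omega> j) / 2 ^ k) = (\<lambda>j\<in>J. dyadic_ceil k (v j \<omega>))" for \<omega>
    by (auto simp: u_def dyadic_ceil_def fun_eq_iff)
  ultimately show "(\<lambda>\<omega>. F (\<lambda>j\<in>J. dyadic_ceil k (v j \<omega>))) \<in> measurable N (borel_of_topology mtopology)"
    by simp
qed (use F lim in auto)

lemma borel_measurable_comp_continuous_map:
  assumes X: "X \<in> measurable M (borel_of_topology T)" and h: "continuous_map T euclideanreal h"
  shows "(\<lambda>\<omega>. h (X \<omega>)) \<in> borel_measurable M"
proof -
  have "h \<in> measurable (borel_of_topology T) borel"
  proof (rule borel_measurableI)
    fix S :: "real set" assume "open S"
    then have "openin T {x \<in> topspace T. h x \<in> S}"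
      using h by (simp add: continuous_map)
    moreover have "h -` S \<inter> space (borel_of_topology T) = {x \<in> topspace T. h x \<in> S}"
      by (auto simp: borel_of_topology_def space_measure_of_conv)
    ultimately show "h -` S \<inter> space (borel_of_topology T) \<in> sets (borel_of_topology T)"
      unfolding borel_of_topology_def
      by (subst sets_measure_of) (auto dest: openin_subset intro: sigma_sets.Basic)
  qed
  then show ?thesis using X by (rule measurable_compose[rotated])
qed

text \<open>
  Only the position of a coordinate relative to the path parameters matters for the path, and
  a piecewise linear time change matches the discretized coordinates with the original ones.
\<close>

lemma time_change_dyadic_ceil:
  fixes x :: "'i \<Rightarrow> real"
  assumes I: "finite I" and e: "0 < e"
  shows "\<forall>\<^sub>F k in sequentially. \<exists>\<tau>. time_change \<tau> \<and> (\<forall>s\<in>{0..1}. \<bar>\<tau> s - s\<bar> \<le> e) \<and>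
    (\<forall>i\<in>I. \<forall>s\<in>{0..1}. x i \<le> s \<longleftrightarrow> dyadic_ceil k (x i) \<le> \<tau> s)"
proof -
  define X where "X = x ` I \<inter> {0<..<1}"
  define Y where "Y = X \<union> {0, 1}"
  have X: "finite X" "finite Y" using I by (auto simp: X_def Y_def)
  define P where "P = (Y \<times> Y) \<inter> {(u, w). u \<noteq> w}"
  have P: "finite P" "(0, 1) \<in> P" using X by (auto simp: P_def Y_def)
  \<comment> \<open>The least gap between two distinct points of \<open>Y\<close>. The endpoints
    belong to \<open>Y\<close> so that the tents below vanish there.\<close>
  define \<delta> where "\<delta> = Min ((\<lambda>(u, w). \<bar>u - w\<bar>) ` P)"
  have "\<delta> \<in> (\<lambda>(u, w). \<bar>u - w\<bar>) ` P" unfolding \<delta>_def using P by (intro Min_in) auto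
  then have \<delta>0: "0 < \<delta>" by (auto simp: P_def)
  have \<delta>: "\<delta> \<le> \<bar>u - w\<bar>" if "u \<in> Y" "w \<in> Y" "u \<noteq> w" for u w
  proof -
    have "(\<lambda>(u, w). \<bar>u - w\<bar>) (u, w) \<in> (\<lambda>(u, w). \<bar>u - w\<bar>) ` P"
      using that by (intro imageI) (simp add: P_def)
    then show ?thesis unfolding \<delta>_def using P by (intro Min_le) auto
  qed
  define m where "m = real (card X)"
  have "(\<lambda>k. m * (1/2) ^ k) \<longlonglongrightarrow> m * 0"
    by (intro tendsto_mult_left LIMSEQ_power_zero) simp
  then have "\<forall>\<^sub>F k in sequentially. m * (1/2) ^ k < min \<delta> e"
    using \<delta>0 e by (intro order_tendstoD(2)) auto
  then show ?thesis
  proof eventually_elim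
    case (elim k)
    \<comment> \<open>A tent of half-width \<open>\<delta>\<close> at \<open>u\<close>, which
      vanishes at all other points of \<open>Y\<close>. Hence \<open>\<tau>\<close> moves each
      \<open>u\<close> in \<open>X\<close> exactly to its rounding and fixes 0 and 1.\<close>
    define \<phi> where "\<phi> u s = max 0 (1 - \<bar>s - u\<bar> / \<delta>)" for u s :: real
    define c where "c u = dyadic_ceil k u - u" for u
    have c: "0 \<le> c u" "c u \<le> (1/2) ^ k" for u
      using dyadic_ceil_bounds[where x = u and k = k] by (auto simp: c_def)
    define \<tau> where "\<tau> s = s + (\<Sum>u\<in>X. c u * \<phi> u s)" for s
    have \<phi>1: "0 \<le> \<phi> u s" "\<phi> u s \<le> 1" for u s using \<delta>0 by (auto simp: \<phi>_def)
    have lip: "\<bar>\<phi> u s - \<phi> u t\<bar> \<le> \<bar>s - t\<bar> / \<delta>" for u s t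
    proof -
      have "\<bar>\<phi> u s - \<phi> u t\<bar> \<le> \<bar>\<bar>s - u\<bar> / \<delta> - \<bar>t - u\<bar> / \<delta>\<bar>" unfolding \<phi>_def by linarith
      also have "\<dots> = \<bar>\<bar>s - u\<bar> - \<bar>t - u\<bar>\<bar> / \<delta>"
        using \<delta>0 by (simp flip: diff_divide_distrib add: abs_divide)
      also have "\<dots> \<le> \<bar>s - t\<bar> / \<delta>" using \<delta>0 by (intro divide_right_mono) linarith+
      finally show ?thesis .
    qed
    \<comment> \<open>The perturbation has Lipschitz constant at most
      \<open>m * (1/2) ^ k / \<delta>\<close>, which is below 1 for the levels considered, so it
      cannot destroy the growth of the identity.\<close>
    have "\<tau> s < \<tau> t" if "s < t" for s t
    proof -
      have "(\<Sum>u\<in>X. c u * \<phi> u s) - (\<Sum>u\<in>X. c u * \<phi> u t) = (\<Sum>u\<in>X. c u * (\<phi> u s - \<phi> u t))"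
        by (simp add: right_diff_distrib sum_subtractf)
      also have "\<dots> \<le> (\<Sum>u\<in>X. (1/2) ^ k * (\<bar>s - t\<bar> / \<delta>))"
      proof (intro sum_mono)
        fix u
        have "c u * (\<phi> u s - \<phi> u t) \<le> c u * \<bar>\<phi> u s - \<phi> u t\<bar>"
          using c by (intro mult_left_mono) auto
        also have "\<dots> \<le> (1/2) ^ k * (\<bar>s - t\<bar> / \<delta>)" using c lip by (intro mult_mono) auto
        finally show "c u * (\<phi> u s - \<phi> u t) \<le> (1/2) ^ k * (\<bar>s - t\<bar> / \<delta>)" .
      qed
      also have "\<dots> = (m * (1/2) ^ k) * ((t - s) / \<delta>)" using that by (simp add: m_def)
      also have "\<dots> < \<delta> * ((t - s) / \<delta>)" using elim that \<delta>0 by (intro mult_strict_right_mono) auto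
      also have "\<dots> = t - s" using \<delta>0 by simp
      finally show ?thesis unfolding \<tau>_def by linarith
    qed
    then have mono: "strict_mono_on {0..1} \<tau>" by (auto simp: strict_mono_on_def)
    have cont: "continuous_on {0..1} \<tau>"
      unfolding \<tau>_def \<phi>_def using \<delta>0 by (intro continuous_intros) auto
    have \<phi>Y: "\<phi> u w = 0" if "u \<in> X" "w \<in> Y" "u \<noteq> w" for u w
      using \<delta>[of w u] that \<delta>0 by (auto simp: \<phi>_def Y_def max_def field_simps)
    have \<tau>Y: "\<tau> w = w" if "w \<in> Y" "w \<notin> X" for w
    proof -
      have "c u * \<phi> u w = 0" if "u \<in> X" for u
        using \<phi>Y[OF that \<open>w \<in> Y\<close>] \<open>w \<notin> X\<close> that by auto
      then show ?thesis unfolding \<tau>_def by simp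
    qed
    have \<tau>01: "\<tau> 0 = 0" "\<tau> 1 = 1" by (rule \<tau>Y; auto simp: X_def Y_def)+
    have \<tau>X: "\<tau> w = dyadic_ceil k w" if "w \<in> X" for w
    proof -
      have "(\<Sum>u\<in>X. c u * \<phi> u w) = (\<Sum>u\<in>X. if u = w then c w else 0)"
        using \<phi>Y[of _ w] that by (intro sum.cong) (auto simp: Y_def \<phi>_def)
      also have "\<dots> = c w" using that X by simp
      finally show ?thesis by (simp add: \<tau>_def c_def)
    qed
    have tc: "time_change \<tau>" using mono cont \<tau>01 by (simp add: time_change_def)
    have close: "\<bar>\<tau> s - s\<bar> \<le> e" for s
    proof -
      have "0 \<le> (\<Sum>u\<in>X. c u * \<phi> u s)" using c \<phi>1 by (intro sum_nonneg) simp
      moreover have "(\<Sum>u\<in>X. c u * \<phi> u s) \<le> (\<Sum>u\<in>X. (1/2) ^ k * 1)"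
        using c \<phi>1 by (intro sum_mono mult_mono) auto
      ultimately show ?thesis using elim by (simp add: \<tau>_def m_def)
    qed
    have pat: "x i \<le> s \<longleftrightarrow> dyadic_ceil k (x i) \<le> \<tau> s" if i: "i \<in> I" and s: "s \<in> {0..1}" for i s
    proof -
      have s': "\<tau> s \<in> {0..1}" by (rule time_change_in[OF tc s])
      consider "x i \<le> 0" | "x i \<in> X" | "x i = 1" | "1 < x i"
        using i by (force simp: X_def)
      then show ?thesis
      proof cases
        case 1
        have "x i \<le> s" using 1 s by simp
        moreover have "dyadic_ceil k (x i) \<le> \<tau> s"
          using dyadic_ceil_simps(1)[OF 1, of k] s' by simp
        ultimately show ?thesis by simp
      next
        case 2
        then have "x i \<in> {0..1}" by (auto simp: X_def)
        then show ?thesis using time_change_mono[OF tc _ s, of "x i"] \<tau>X[OF 2] by simp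
      next
        case 3
        then show ?thesis
          using time_change_mono[OF tc _ s, of 1] \<tau>01 by (simp add: dyadic_ceil_simps)
      next
        case 4
        then show ?thesis using dyadic_ceil_bounds(1)[where x = "x i" and k = k] s s' by auto
      qed
    qed
    show ?case using tc close pat by blast
  qed
qed

text \<open>The normalized process as a deterministic function of finitely many real coordinates:
  \<open>Inl (i, j)\<close> carries the squared modulus of an entry, \<open>Inr (Inl i)\<close> a
  row variable and \<open>Inr (Inr j)\<close> a column variable. The mean is written in its closed
  form, which \<open>expectation_T\<close> justifies later.\<close>

definition trunc_path :: "nat \<Rightarrow> (nat \<times> nat + nat + nat \<Rightarrow> real) \<Rightarrow> real \<times> real \<Rightarrow> real" where
  "trunc_path n v = (\<lambda>p\<in>unit_square. ((\<Sum>i<n. \<Sum>j<n. v (Inl (i, j)) *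
     indicator {..fst p} (v (Inr (Inl i))) * indicator {..snd p} (v (Inr (Inr j)))) -
     real n * fst p * snd p) / sqrt (real n))"

lemma trunc_path_in_D: "trunc_path n v \<in> skorokhod_D"
proof -
  have 1: "orthant_limits (\<lambda>p. v (Inl (i, j)) *
      indicator {..fst p} (v (Inr (Inl i))) * indicator {..snd p} (v (Inr (Inr j))))" for i j
  proof -
    have "orthant_limits (\<lambda>p. (\<lambda>a b. if a \<and> b then v (Inl (i, j)) else 0)
        (v (Inr (Inl i)) \<le> fst p) (v (Inr (Inr j)) \<le> snd p))"
      by (intro orthant_limits_step right_step_le)
    then show ?thesis by (rule arg_cong[where f = orthant_limits, THEN iffD1, rotated])
        (auto simp: indicator_def)
  qed
  have 2: "orthant_limits (\<lambda>p. - (real n * fst p * snd p))"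
    by (intro orthant_limits_continuous continuous_intros)
  have "orthant_limits (\<lambda>p. (1 / sqrt (real n)) * ((\<Sum>i<n. \<Sum>j<n. v (Inl (i, j)) *
     indicator {..fst p} (v (Inr (Inl i))) * indicator {..snd p} (v (Inr (Inr j)))) +
     - (real n * fst p * snd p)))"
    by (intro orthant_limits_cmult orthant_limits_add orthant_limits_sum 1 2) auto
  then show ?thesis
    using restrict_in_skorokhod_D unfolding trunc_path_def by fastforce
qed

definition trunc_coords :: "nat \<Rightarrow> (nat \<times> nat + nat + nat) set" where
  "trunc_coords n = ({..<n} \<times> {..<n}) <+> ({..<n} <+> {..<n})"

lemma finite_trunc_coords: "finite (trunc_coords n)"
  by (simp add: trunc_coords_def)

text \<open>One time change per axis aligns all rounded jump locations with the original ones, so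
  all indicators agree. What remains is the rounding of the \<open>n * n\<close> coefficients and
  the displacement of the smooth centering.\<close>

lemma trunc_path_discretized:
  "(\<lambda>k. skorokhod_dist (trunc_path n (\<lambda>j\<in>trunc_coords n. dyadic_ceil k (x j)))
     (trunc_path n (\<lambda>j\<in>trunc_coords n. x j))) \<longlonglongrightarrow> 0"
proof (cases "n = 0")
  case True
  then have "trunc_path n v = trunc_path n w" for v w by (simp add: trunc_path_def)
  then have "skorokhod_dist (trunc_path n v) (trunc_path n w) = 0" for v w
    using Skorokhod.mdist_zero[OF trunc_path_in_D] by metis
  then show ?thesis by simp
next
  case False
  let ?P = "\<lambda>k. trunc_path n (\<lambda>j\<in>trunc_coords n. dyadic_ceil k (x j))"
  let ?Q = "trunc_path n (\<lambda>j\<in>trunc_coords n. x j)"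
  have n: "0 < sqrt (real n)" using False by simp
  show ?thesis
  proof (rule LIMSEQ_I)
    fix e :: real assume e: "0 < e"
    \<comment> \<open>Half of the budget \<open>e / 2\<close> goes to rounding the coefficients,
      half to the centering, which moves by at most \<open>real n * (2 * e1)\<close> before the
      division by \<open>sqrt n\<close>.\<close>
    define e1 where "e1 = min (e / 2) (sqrt (real n) * e / (8 * real n))"
    have e1: "0 < e1" "e1 \<le> e / 2" "e1 * (2 * real n) \<le> sqrt n * e / 4"
      using e n False by (auto simp: e1_def min_def field_simps)
    have "(\<lambda>k. (real n)\<^sup>2 * (1/2) ^ k) \<longlonglongrightarrow> (real n)\<^sup>2 * 0"
      by (intro tendsto_mult_left LIMSEQ_power_zero) simp
    moreover have "(real n)\<^sup>2 * 0 < sqrt n * e / 4" using n e by simp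
    ultimately have "\<forall>\<^sub>F k in sequentially. (real n)\<^sup>2 * (1/2) ^ k < sqrt n * e / 4"
      by (rule order_tendstoD(2))
    moreover note time_change_dyadic_ceil[OF finite_lessThan[of n] e1(1), of "\<lambda>i. x (Inr (Inl i))"]
    moreover note time_change_dyadic_ceil[OF finite_lessThan[of n] e1(1), of "\<lambda>i. x (Inr (Inr i))"]
    ultimately have "\<forall>\<^sub>F k in sequentially. skorokhod_close (e / 2) ?Q (?P k)"
    proof eventually_elim
      case (elim k)
      obtain \<tau> where \<tau>: "time_change \<tau>" "\<And>s. s\<in>{0..1} \<Longrightarrow> \<bar>\<tau> s - s\<bar> \<le> e1"
        "\<And>i s. i < n \<Longrightarrow> s \<in> {0..1} \<Longrightarrow> x (Inr (Inl i)) \<le> s \<longleftrightarrow> dyadic_ceil k (x (Inr (Inl i))) \<le> \<tau> s"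
        using elim(2) by auto
      obtain \<mu> where \<mu>: "time_change \<mu>" "\<And>s. s\<in>{0..1} \<Longrightarrow> \<bar>\<mu> s - s\<bar> \<le> e1"
        "\<And>i s. i < n \<Longrightarrow> s \<in> {0..1} \<Longrightarrow> x (Inr (Inr i)) \<le> s \<longleftrightarrow> dyadic_ceil k (x (Inr (Inr i))) \<le> \<mu> s"
        using elim(3) by auto
      have "\<bar>?Q (s, t) - ?P k (\<tau> s, \<mu> t)\<bar> \<le> e / 2" if s: "s \<in> {0..1}" and t: "t \<in> {0..1}" for s t
      proof -
        have s': "\<tau> s \<in> {0..1}" "\<mu> t \<in> {0..1}"
          using time_change_in[OF \<tau>(1) s] time_change_in[OF \<mu>(1) t] by auto
        \<comment> \<open>The same indicators occur in both paths, because the time changes preserve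
          the comparisons with the jump locations.\<close>
        define I where "I i j = (indicator {..s} (x (Inr (Inl i))) * indicator {..t} (x (Inr (Inr j))) :: real)" for i j
        have Q: "?Q (s, t) = ((\<Sum>i<n. \<Sum>j<n. x (Inl (i, j)) * I i j) - real n * s * t) / sqrt n"
          using s t by (auto simp: trunc_path_def unit_square_def I_def trunc_coords_def mult.assoc
              intro!: arg_cong2[where f = "(-)"] sum.cong)
        have P: "?P k (\<tau> s, \<mu> t) = ((\<Sum>i<n. \<Sum>j<n. dyadic_ceil k (x (Inl (i, j))) * I i j) - real n * \<tau> s * \<mu> t) / sqrt n"
          using s' \<tau>(3)[OF _ s] \<mu>(3)[OF _ t]
          by (auto simp: trunc_path_def unit_square_def I_def trunc_coords_def mult.assoc indicator_def
              intro!: arg_cong2[where f = "(-)"] sum.cong)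
        have "?Q (s, t) - ?P k (\<tau> s, \<mu> t) = ((\<Sum>i<n. \<Sum>j<n. (x (Inl (i, j)) - dyadic_ceil k (x (Inl (i, j)))) * I i j)
            + real n * (\<tau> s * \<mu> t - s * t)) / sqrt n"
          unfolding P Q by (simp add: algebra_simps sum_subtractf diff_divide_distrib add_divide_distrib)
        also have "\<bar>\<dots>\<bar> = \<bar>(\<Sum>i<n. \<Sum>j<n. (x (Inl (i, j)) - dyadic_ceil k (x (Inl (i, j)))) * I i j)
            + real n * (\<tau> s * \<mu> t - s * t)\<bar> / sqrt n" using n by (simp add: abs_divide)
        also have "\<dots> \<le> (sqrt n * e / 4 + sqrt n * e / 4) / sqrt n"
        proof (intro divide_right_mono order_trans[OF abs_triangle_ineq] add_mono)
          have "\<bar>\<Sum>i<n. \<Sum>j<n. (x (Inl (i, j)) - dyadic_ceil k (x (Inl (i, j)))) * I i j\<bar>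
              \<le> (\<Sum>i<n. \<Sum>j<n. \<bar>(x (Inl (i, j)) - dyadic_ceil k (x (Inl (i, j)))) * I i j\<bar>)"
            by (intro order_trans[OF sum_abs] sum_mono sum_abs)
          also have "\<dots> \<le> (\<Sum>i<n. \<Sum>j<n. (1/2) ^ k)"
          proof (intro sum_mono)
            fix i j
            have "\<bar>x (Inl (i, j)) - dyadic_ceil k (x (Inl (i, j)))\<bar> \<le> (1/2) ^ k"
              using dyadic_ceil_bounds[where x = "x (Inl (i, j))" and k = k] by (simp add: abs_le_iff)
            moreover have "\<bar>I i j\<bar> \<le> 1" by (auto simp: I_def indicator_def)
            ultimately show "\<bar>(x (Inl (i, j)) - dyadic_ceil k (x (Inl (i, j)))) * I i j\<bar> \<le> (1/2) ^ k"
              unfolding abs_mult using mult_mono[of _ "(1/2) ^ k" _ 1] by fastforce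
          qed
          also have "\<dots> = (real n)\<^sup>2 * (1/2) ^ k" by (simp add: power2_eq_square)
          finally show "\<bar>\<Sum>i<n. \<Sum>j<n. (x (Inl (i, j)) - dyadic_ceil k (x (Inl (i, j)))) * I i j\<bar> \<le> sqrt n * e / 4"
            using elim(1) by simp
          have "\<bar>\<tau> s * \<mu> t - s * t\<bar> = \<bar>(\<tau> s - s) * \<mu> t + s * (\<mu> t - t)\<bar>" by (simp add: algebra_simps)
          also have "\<dots> \<le> \<bar>\<tau> s - s\<bar> * \<bar>\<mu> t\<bar> + \<bar>s\<bar> * \<bar>\<mu> t - t\<bar>"
            by (metis abs_mult abs_triangle_ineq)
          also have "\<dots> \<le> e1 * 1 + 1 * e1"
            using \<tau>(2)[OF s] \<mu>(2)[OF t] s t s' e1 by (intro add_mono mult_mono) auto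
          finally have "\<bar>real n * (\<tau> s * \<mu> t - s * t)\<bar> \<le> real n * (2 * e1)"
            by (simp add: abs_mult mult_left_mono)
          then show "\<bar>real n * (\<tau> s * \<mu> t - s * t)\<bar> \<le> sqrt n * e / 4" using e1(3) by (simp add: mult_ac)
        qed (use n in auto)
        also have "\<dots> = e / 2" using n by (simp add: field_simps)
        finally show ?thesis .
      qed
      moreover have "\<bar>\<tau> s - s\<bar> \<le> e / 2" "\<bar>\<mu> s - s\<bar> \<le> e / 2" if "s \<in> {0..1}" for s
        using \<tau>(2)[OF that] \<mu>(2)[OF that] e1(2) by auto
      ultimately show ?case unfolding skorokhod_close_def using \<tau>(1) \<mu>(1) by blast
    qed
    then have "\<forall>\<^sub>F k in sequentially. norm (skorokhod_dist (?P k) ?Q - 0) < e"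
    proof eventually_elim
      case (elim k)
      have "skorokhod_dist ?Q (?P k) \<le> e / 2"
        by (rule skorokhod_dist_le[OF elim trunc_path_in_D trunc_path_in_D])
      then show ?case using e Skorokhod.nonneg Skorokhod.commute by (simp add: abs_of_nonneg)
    qed
    then show "\<exists>N. \<forall>k\<ge>N. norm (skorokhod_dist (?P k) ?Q - 0) < e"
      by (simp add: eventually_sequentially)
  qed
qed

lemma measurable_trunc_path:
  assumes "\<And>j. j \<in> trunc_coords n \<Longrightarrow> v j \<in> borel_measurable M"
  shows "(\<lambda>\<omega>. trunc_path n (\<lambda>j\<in>trunc_coords n. v j \<omega>)) \<in> measurable M (borel_of_topology skorokhod_topology)"
  unfolding skorokhod_topology_def
  using finite_trunc_coords assms trunc_path_in_D trunc_path_discretized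
  by (rule Skorokhod.measurable_borel_of_discretized)

section \<open>Piecewise constant paths on dyadic grids\<close>

definition dyadic_floor :: "nat \<Rightarrow> real \<Rightarrow> real" where
  "dyadic_floor k x = of_int \<lfloor>2 ^ k * x\<rfloor> / 2 ^ k"

definition dyadic_grid :: "nat \<Rightarrow> (real \<times> real) set" where
  "dyadic_grid k = (\<lambda>(i, j). (real i / 2 ^ k, real j / 2 ^ k)) ` ({..2 ^ k} \<times> {..2 ^ k})"

text \<open>Each cell takes the value at its lower left corner, which makes the path right
  continuous. \<open>v\<close> is read on \<open>dyadic_grid k\<close> only, so a step path is a
  Lipschitz function of finitely many numbers.\<close>

definition step_path :: "nat \<Rightarrow> (real \<times> real \<Rightarrow> real) \<Rightarrow> real \<times> real \<Rightarrow> real" where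
  "step_path k v = (\<lambda>p\<in>unit_square. v (dyadic_floor k (fst p), dyadic_floor k (snd p)))"

lemma dyadic_point_in_unit:
  assumes "i \<le> 2 ^ k"
  shows "real i / 2 ^ k \<in> {0..1}"
  using assms by (simp flip: of_nat_le_iff)

lemma finite_dyadic_grid: "finite (dyadic_grid k)"
  by (simp add: dyadic_grid_def)

lemma dyadic_grid_subset: "dyadic_grid k \<subseteq> unit_square"
  using dyadic_point_in_unit by (auto simp: dyadic_grid_def unit_square_def)

lemma dyadic_floor_eq:
  assumes "x \<in> {0..1}"
  obtains i where "i \<le> 2 ^ k" "dyadic_floor k x = real i / 2 ^ k"
proof
  have "0 \<le> \<lfloor>2 ^ k * x\<rfloor>" using assms by simp
  then show "dyadic_floor k x = real (nat \<lfloor>2 ^ k * x\<rfloor>) / 2 ^ k" by (simp add: dyadic_floor_def)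
  have "2 ^ k * x \<le> 2 ^ k" using assms by simp
  then have "\<lfloor>2 ^ k * x\<rfloor> \<le> \<lfloor>(2::real) ^ k\<rfloor>" by (intro floor_mono)
  also have "\<dots> = 2 ^ k" by (metis floor_of_int of_int_numeral of_int_power)
  finally show "nat \<lfloor>2 ^ k * x\<rfloor> \<le> 2 ^ k" by (simp add: nat_le_iff)
qed

lemma dyadic_floor_grid:
  assumes "p \<in> unit_square"
  shows "(dyadic_floor k (fst p), dyadic_floor k (snd p)) \<in> dyadic_grid k"
proof -
  have p: "fst p \<in> {0..1}" "snd p \<in> {0..1}" using assms by (auto simp: unit_square_def)
  obtain i where i: "i \<le> 2 ^ k" "dyadic_floor k (fst p) = real i / 2 ^ k"
    by (rule dyadic_floor_eq[OF p(1)])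
  obtain j where j: "j \<le> 2 ^ k" "dyadic_floor k (snd p) = real j / 2 ^ k"
    by (rule dyadic_floor_eq[OF p(2)])
  show ?thesis using i j by (auto simp: dyadic_grid_def image_iff intro!: bexI[of _ "(i, j)"])
qed

lemma dyadic_floor_bounds: "dyadic_floor k x \<le> x" "x \<le> dyadic_floor k x + (1/2) ^ k"
proof -
  have "of_int \<lfloor>2 ^ k * x\<rfloor> \<le> 2 ^ k * x" by simp
  then show "dyadic_floor k x \<le> x" by (simp add: dyadic_floor_def field_simps)
  have "2 ^ k * x \<le> of_int \<lfloor>2 ^ k * x\<rfloor> + 1" by linarith
  then show "x \<le> dyadic_floor k x + (1/2) ^ k"
    by (simp add: dyadic_floor_def field_simps)
qed

lemma step_path_in_D: "step_path k v \<in> skorokhod_D"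
proof -
  have "orthant_limits (\<lambda>p. (\<lambda>a b. v (of_int a / 2 ^ k, of_int b / 2 ^ k))
      \<lfloor>2 ^ k * fst p\<rfloor> \<lfloor>2 ^ k * snd p\<rfloor>)"
    by (intro orthant_limits_step right_step_floor) auto
  then show ?thesis
    unfolding step_path_def dyadic_floor_def by (intro restrict_in_skorokhod_D) simp
qed

lemma step_path_dist:
  assumes "\<And>p. p \<in> dyadic_grid k \<Longrightarrow> \<bar>v p - w p\<bar> \<le> e"
  shows "skorokhod_dist (step_path k v) (step_path k w) \<le> e"
  using assms dyadic_floor_grid
  by (intro skorokhod_dist_le_uniform step_path_in_D) (simp add: step_path_def)

lemma step_path_restrict: "step_path k (\<lambda>j\<in>dyadic_grid k. v j) = step_path k v"
  using dyadic_floor_grid by (auto simp: step_path_def fun_eq_iff)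

lemma measurable_step_path:
  assumes v: "\<And>p. p \<in> dyadic_grid k \<Longrightarrow> v p \<in> borel_measurable M"
  shows "(\<lambda>\<omega>. step_path k (\<lambda>p. v p \<omega>)) \<in> measurable M (borel_of_topology skorokhod_topology)"
proof -
  have "(\<lambda>l. skorokhod_dist (step_path k (\<lambda>j\<in>dyadic_grid k. dyadic_ceil l (x j)))
      (step_path k (\<lambda>j\<in>dyadic_grid k. x j))) \<longlonglongrightarrow> 0" for x
  proof (rule tendsto_sandwich[OF _ _ tendsto_const LIMSEQ_power_zero[of "1/2"]])
    show "\<forall>\<^sub>F l in sequentially. skorokhod_dist (step_path k (\<lambda>j\<in>dyadic_grid k. dyadic_ceil l (x j)))
      (step_path k (\<lambda>j\<in>dyadic_grid k. x j)) \<le> (1/2) ^ l"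
    proof (intro always_eventually allI step_path_dist)
      fix l p
      show "p \<in> dyadic_grid k \<Longrightarrow> \<bar>(\<lambda>j\<in>dyadic_grid k. dyadic_ceil l (x j)) p - (\<lambda>j\<in>dyadic_grid k. x j) p\<bar> \<le> (1/2) ^ l"
        using dyadic_ceil_bounds[where x = "x p" and k = l] by (simp add: abs_le_iff)
    qed
  qed (auto simp: Skorokhod.nonneg)
  then have "(\<lambda>\<omega>. step_path k (\<lambda>j\<in>dyadic_grid k. v j \<omega>)) \<in> measurable M (borel_of_topology skorokhod_topology)"
    unfolding skorokhod_topology_def using finite_dyadic_grid v step_path_in_D
    by (intro Skorokhod.measurable_borel_of_discretized)
  then show ?thesis by (simp add: step_path_restrict)
qed

section \<open>Testing weak convergence on trigonometric polynomials\<close>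

text \<open>The phase \<open>c\<close> makes the sines available; the product-to-sum formula turns
  this linear span into an algebra, as Stone-Weierstrass requires. Expectations of the generators
  are read off from characteristic functions.\<close>

inductive_set trig_polys :: "'i set \<Rightarrow> (('i \<Rightarrow> real) \<Rightarrow> real) set" for J where
  cos: "(\<lambda>x. cos (c + (\<Sum>j\<in>J. a j * x j))) \<in> trig_polys J"
| scale: "f \<in> trig_polys J \<Longrightarrow> (\<lambda>x. k * f x) \<in> trig_polys J"
| add: "f \<in> trig_polys J \<Longrightarrow> g \<in> trig_polys J \<Longrightarrow> (\<lambda>x. f x + g x) \<in> trig_polys J"

lemma trig_polys_const: "(\<lambda>x. k) \<in> trig_polys J"
proof -
  have "(\<lambda>x. k * cos (0 + (\<Sum>j\<in>J. 0 * x j))) \<in> trig_polys J"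
    by (rule trig_polys.scale[OF trig_polys.cos[where a = "\<lambda>_. 0"]])
  then show ?thesis by simp
qed

lemma trig_polys_mult_cos:
  assumes "g \<in> trig_polys J"
  shows "(\<lambda>x. cos (c + (\<Sum>j\<in>J. a j * x j)) * g x) \<in> trig_polys J"
  using assms
proof induction
  case (cos c' a')
  have eq: "cos (c + (\<Sum>j\<in>J. a j * x j)) * cos (c' + (\<Sum>j\<in>J. a' j * x j)) =
    (1/2) * (cos ((c - c') + (\<Sum>j\<in>J. (a j - a' j) * x j)) + cos ((c + c') + (\<Sum>j\<in>J. (a j + a' j) * x j)))" for x
  proof -
    have 1: "(c - c') + (\<Sum>j\<in>J. (a j - a' j) * x j) = (c + (\<Sum>j\<in>J. a j * x j)) - (c' + (\<Sum>j\<in>J. a' j * x j))"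
      by (simp add: left_diff_distrib sum_subtractf)
    have 2: "(c + c') + (\<Sum>j\<in>J. (a j + a' j) * x j) = (c + (\<Sum>j\<in>J. a j * x j)) + (c' + (\<Sum>j\<in>J. a' j * x j))"
      by (simp add: distrib_right sum.distrib)
    show ?thesis unfolding 1 2 by (simp add: cos_times_cos)
  qed
  show ?case unfolding eq by (intro trig_polys.intros)
next
  case (scale f k)
  then show ?case using trig_polys.scale[OF scale.IH, of k] by (simp add: mult_ac)
next
  case (add f g)
  then show ?case using trig_polys.add[OF add.IH] by (simp add: distrib_left)
qed

lemma trig_polys_mult:
  assumes "f \<in> trig_polys J" "g \<in> trig_polys J"
  shows "(\<lambda>x. f x * g x) \<in> trig_polys J"
  using assms
proof induction
  case (cos c a)
  then show ?case by (rule trig_polys_mult_cos)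
next
  case (scale f k)
  then show ?case using trig_polys.scale[OF scale.IH, of k] by (simp add: mult_ac)
next
  case (add f g)
  then show ?case using trig_polys.add[OF add.IH] by (simp add: distrib_right)
qed

lemma trig_polys_sin:
  assumes "finite J" "j \<in> J"
  shows "(\<lambda>x. sin (\<kappa> * x j)) \<in> trig_polys J"
proof -
  have "(\<lambda>x. cos (- pi / 2 + (\<Sum>i\<in>J. (if i = j then \<kappa> else 0) * x i))) \<in> trig_polys J"
    by (rule trig_polys.cos)
  moreover have "(\<Sum>i\<in>J. (if i = j then \<kappa> else 0) * x i) = \<kappa> * x j" for x :: "'a \<Rightarrow> real"
    using assms by (simp add: if_distrib[of "\<lambda>c. c * _"] cong: if_cong)
  moreover have "cos (- pi / 2 + y) = sin y" for y :: real
    using cos_add[of "- pi / 2" y] by simp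
  ultimately show ?thesis by simp
qed

lemma compact_unit_cube:
  "compact {x :: 'i \<Rightarrow> real. \<forall>j. x j \<in> {-1..1}}"
proof -
  have "compactin (product_topology (\<lambda>_::'i. euclidean) UNIV) (\<Pi>\<^sub>E j\<in>UNIV. {-1..1::real})"
    unfolding compactin_PiE by auto
  moreover have "(\<Pi>\<^sub>E j\<in>UNIV. {-1..1::real}) = {x :: 'i \<Rightarrow> real. \<forall>j. x j \<in> {-1..1}}"
    by (auto simp: PiE_def)
  ultimately show ?thesis by (simp add: euclidean_product_topology compactin_euclidean_iff)
qed

text \<open>
  On the box the coordinates are recovered from \<open>sin (x j / (2 K))\<close> by the arcsine, so that a
  polynomial approximation of \<open>g\<close> in these sines is a trigonometric polynomial which is also
  bounded outside of the box.
\<close>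

lemma trig_poly_approx:
  fixes g :: "(nat \<Rightarrow> real) \<Rightarrow> real"
  assumes J: "finite J" and K: "0 < K" and e: "0 < e"
    and bound: "\<And>x. \<bar>g x\<bar> \<le> B" and L: "0 \<le> L"
    and lip: "\<And>x y. \<bar>g x - g y\<bar> \<le> L * (\<Sum>j\<in>J. \<bar>x j - y j\<bar>)"
  obtains f where "f \<in> trig_polys J" "\<And>x. \<bar>f x\<bar> \<le> B + e"
    "\<And>x. (\<And>j. j \<in> J \<Longrightarrow> \<bar>x j\<bar> \<le> K) \<Longrightarrow> \<bar>g x - f x\<bar> \<le> e"
proof -
  define S where "S = {x :: nat \<Rightarrow> real. \<forall>j. x j \<in> {-1..1}} "
  define s :: "(nat \<Rightarrow> real) \<Rightarrow> nat \<Rightarrow> real" where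
    "s x j = (if j \<in> J then sin (1 / (2 * K) * x j) else 0)" for x j
  \<comment> \<open>Stone-Weierstrass is applied on the cube of the sines, to the functions whose
    pullback along \<open>s\<close> is a trigonometric polynomial.\<close>
  define R where "R = {f. continuous_on S f \<and> (\<lambda>x. f (s x)) \<in> trig_polys J}"
  \<comment> \<open>Coordinates outside \<open>J\<close> are pinned to 0, where \<open>s\<close>
    takes them; distinct points of \<open>S'\<close> therefore differ in a coordinate of
    \<open>J\<close>.\<close>
  define S' where "S' = {x \<in> S. \<forall>j. j \<notin> J \<longrightarrow> x j = 0}"
  have "closed {x :: nat \<Rightarrow> real. \<forall>j. j \<notin> J \<longrightarrow> x j = 0}"
  proof -
    have "closed {x :: nat \<Rightarrow> real. x j = 0}" for j
      by (intro closed_Collect_eq continuous_intros continuous_on_product_coordinates)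
    then have "closed (\<Inter>j\<in>-J. {x :: nat \<Rightarrow> real. x j = 0})" by blast
    also have "(\<Inter>j\<in>-J. {x :: nat \<Rightarrow> real. x j = 0}) = {x. \<forall>j. j \<notin> J \<longrightarrow> x j = 0}" by auto
    finally show ?thesis .
  qed
  then have "compact (S \<inter> {x. \<forall>j. j \<notin> J \<longrightarrow> x j = 0})"
    using compact_unit_cube unfolding S_def by (intro compact_Int_closed)
  also have "S \<inter> {x. \<forall>j. j \<notin> J \<longrightarrow> x j = 0} = S'" by (auto simp: S'_def)
  finally have compact: "compact S'" .
  interpret function_ring_on R S'
  proof
    show "compact S'" by fact
    show "continuous_on S' f" if "f \<in> R" for f
      using that continuous_on_subset[of S f S'] by (auto simp: R_def S'_def)
    show "(\<lambda>x. f x + g x) \<in> R" if "f \<in> R" "g \<in> R" for f g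
      using that unfolding R_def by (auto intro!: continuous_intros trig_polys.add)
    show "(\<lambda>x. f x * g x) \<in> R" if "f \<in> R" "g \<in> R" for f g
      using that unfolding R_def by (auto intro!: continuous_intros trig_polys_mult)
    show "(\<lambda>_. c) \<in> R" for c by (simp add: R_def trig_polys_const)
    fix x y assume "x \<in> S'" "y \<in> S'" "x \<noteq> y"
    have "\<exists>j\<in>J. x j \<noteq> y j"
    proof (rule ccontr)
      assume "\<not> (\<exists>j\<in>J. x j \<noteq> y j)"
      then have "x j = y j" for j
        using \<open>x \<in> S'\<close> \<open>y \<in> S'\<close> by (cases "j \<in> J") (auto simp: S'_def)
      then show False using \<open>x \<noteq> y\<close> by auto
    qed
    then obtain j where j: "j \<in> J" "x j \<noteq> y j" by blast
    have "(\<lambda>x. x j) \<in> R"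
      using j trig_polys_sin[OF J j(1), of "1 / (2 * K)"] unfolding R_def s_def
      by (auto intro!: continuous_on_subset[OF continuous_on_product_coordinates])
    with j(2) show "\<exists>f\<in>R. f x \<noteq> f y" by (intro bexI[of _ "\<lambda>x. x j"])
  qed
  define G where "G x = g (\<lambda>j. 2 * K * arcsin (x j))" for x :: "nat \<Rightarrow> real"
  have "continuous_on S' G"
    unfolding continuous_on_def
  proof
    fix x assume x: "x \<in> S'"
    have c: "((\<lambda>y. arcsin (y j)) \<longlongrightarrow> arcsin (x j)) (at x within S')" for j
    proof -
      have "continuous_on S' (\<lambda>y. arcsin (y j))"
      proof (rule continuous_on_arcsin)
        show "continuous_on S' (\<lambda>y. y j)"
          by (rule continuous_on_subset[OF continuous_on_product_coordinates subset_UNIV])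
      qed (auto simp: S'_def S_def)
      then show ?thesis using x by (simp add: continuous_on_def)
    qed
    have "((\<lambda>y. L * (\<Sum>j\<in>J. \<bar>2 * K * arcsin (y j) - 2 * K * arcsin (x j)\<bar>)) \<longlongrightarrow>
        L * (\<Sum>j\<in>J. \<bar>2 * K * arcsin (x j) - 2 * K * arcsin (x j)\<bar>)) (at x within S')"
      by (intro tendsto_intros c)
    then have "((\<lambda>y. L * (\<Sum>j\<in>J. \<bar>2 * K * arcsin (y j) - 2 * K * arcsin (x j)\<bar>)) \<longlongrightarrow> 0) (at x within S')"
      by simp
    then have "((\<lambda>y. G y - G x) \<longlongrightarrow> 0) (at x within S')"
      by (rule Lim_null_comparison[rotated]) (auto simp: G_def intro!: always_eventually lip)
    then show "(G \<longlongrightarrow> G x) (at x within S')" by (simp add: LIM_zero_iff)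
  qed
  then obtain P where P: "P \<in> R" "\<And>x. x \<in> S' \<Longrightarrow> \<bar>G x - P x\<bar> < e"
    using Stone_Weierstrass_basic[OF _ e, of G] by blast
  have sS: "s x \<in> S'" for x by (auto simp: s_def S'_def S_def)
  show thesis
  proof
    show "(\<lambda>x. P (s x)) \<in> trig_polys J" using P(1) by (simp add: R_def)
    show "\<bar>P (s x)\<bar> \<le> B + e" for x
      using P(2)[OF sS[of x]] bound[of "\<lambda>j. 2 * K * arcsin (s x j)"] by (simp add: G_def)
    show "\<bar>g x - P (s x)\<bar> \<le> e" if x: "\<And>j. j \<in> J \<Longrightarrow> \<bar>x j\<bar> \<le> K" for x
    proof -
      have "2 * K * arcsin (s x j) = x j" if j: "j \<in> J" for j
      proof -
        have "\<bar>1 / (2 * K) * x j\<bar> \<le> 1 / 2"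
          using x[OF j] K by (simp add: abs_mult field_simps)
        also have "\<dots> \<le> pi / 2" using pi_gt3 by simp
        finally have "- (pi / 2) \<le> 1 / (2 * K) * x j" "1 / (2 * K) * x j \<le> pi / 2"
          unfolding abs_le_iff by linarith+
        then have "arcsin (sin (1 / (2 * K) * x j)) = 1 / (2 * K) * x j"
          by (rule arcsin_sin)
        then show ?thesis using j K by (simp add: s_def)
      qed
      then have "\<bar>g x - G (s x)\<bar> \<le> L * (\<Sum>j\<in>J. 0)"
        unfolding G_def by (intro order_trans[OF lip] mult_left_mono L sum_mono) auto
      then show ?thesis using P(2)[OF sS[of x]] by simp
    qed
  qed
qed

lemma trig_polys_bounded:
  assumes "f \<in> trig_polys J"
  shows "\<exists>C. \<forall>x. \<bar>f x\<bar> \<le> C"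
  using assms
proof induction
  case (cos c a)
  then show ?case using abs_cos_le_one by blast
next
  case (scale f k)
  then obtain C where "\<bar>f x\<bar> \<le> C" for x by blast
  then have "\<bar>k * f x\<bar> \<le> \<bar>k\<bar> * C" for x unfolding abs_mult by (intro mult_left_mono) auto
  then show ?case by blast
next
  case (add f g)
  then obtain C D where "\<bar>f x\<bar> \<le> C" "\<bar>g x\<bar> \<le> D" for x by blast
  then have "\<bar>f x + g x\<bar> \<le> C + D" for x by (intro order_trans[OF abs_triangle_ineq] add_mono)
  then show ?case by blast
qed

lemma trig_polys_measurable:
  assumes "f \<in> trig_polys J" "\<And>j. j \<in> J \<Longrightarrow> v j \<in> borel_measurable M"
  shows "(\<lambda>\<omega>. f (\<lambda>j. v j \<omega>)) \<in> borel_measurable M"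
  using assms by induction (auto intro!: borel_measurable_continuous_onI[of cos, THEN measurable_compose[rotated]] continuous_intros)

lemma trig_polys_integrable:
  assumes "prob_space M" "f \<in> trig_polys J" "\<And>j. j \<in> J \<Longrightarrow> v j \<in> borel_measurable M"
  shows "integrable M (\<lambda>\<omega>. f (\<lambda>j. v j \<omega>))"
proof -
  interpret prob_space M by fact
  obtain C where "\<And>x. \<bar>f x\<bar> \<le> C" using trig_polys_bounded[OF assms(2)] by blast
  then show ?thesis
    by (intro integrable_const_bound[where B = C] trig_polys_measurable[OF assms(2,3)]) auto
qed

lemma trig_polys_expectation_tendsto:
  assumes M: "\<And>n. prob_space (M n)" and N: "prob_space N"
    and V: "\<And>n j. j \<in> J \<Longrightarrow> V n j \<in> borel_measurable (M n)"
    and W: "\<And>j. j \<in> J \<Longrightarrow> W j \<in> borel_measurable N"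
    and lim: "\<And>a c. (\<lambda>n. \<integral>\<omega>. cos (c + (\<Sum>j\<in>J. a j * V n j \<omega>)) \<partial>M n) \<longlonglongrightarrow>
      (\<integral>\<omega>. cos (c + (\<Sum>j\<in>J. a j * W j \<omega>)) \<partial>N)"
    and f: "f \<in> trig_polys J"
  shows "(\<lambda>n. \<integral>\<omega>. f (\<lambda>j. V n j \<omega>) \<partial>M n) \<longlonglongrightarrow> (\<integral>\<omega>. f (\<lambda>j. W j \<omega>) \<partial>N)"
  using f
proof induction
  case (cos c a)
  show ?case by (rule lim)
next
  case (scale f k)
  then show ?case by (simp add: tendsto_mult_left)
next
  case (add f g)
  have "integrable (M n) (\<lambda>\<omega>. f (\<lambda>j. V n j \<omega>))" "integrable (M n) (\<lambda>\<omega>. g (\<lambda>j. V n j \<omega>))" for n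
    using add V by (intro trig_polys_integrable[of _ _ J] M; simp)+
  moreover have "integrable N (\<lambda>\<omega>. f (\<lambda>j. W j \<omega>))" "integrable N (\<lambda>\<omega>. g (\<lambda>j. W j \<omega>))"
    using add W by (intro trig_polys_integrable[of _ _ J] N; simp)+
  ultimately show ?case using tendsto_add[OF add.IH] by simp
qed

lemma (in prob_space) expectation_diff_le:
  fixes F G :: "'a \<Rightarrow> real"
  assumes F: "F \<in> borel_measurable M" "\<And>\<omega>. \<omega> \<in> space M \<Longrightarrow> \<bar>F \<omega>\<bar> \<le> a"
    and G: "G \<in> borel_measurable M" "\<And>\<omega>. \<omega> \<in> space M \<Longrightarrow> \<bar>G \<omega>\<bar> \<le> b"
    and E: "E \<in> events" "prob E \<le> \<pi>" and \<eta>: "0 \<le> \<eta>"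
    and close: "\<And>\<omega>. \<omega> \<in> space M - E \<Longrightarrow> \<bar>F \<omega> - G \<omega>\<bar> \<le> \<eta>"
  shows "\<bar>expectation F - expectation G\<bar> \<le> \<eta> + (a + b) * \<pi>"
proof -
  obtain \<omega>0 where "\<omega>0 \<in> space M" using not_empty by blast
  then have ab: "0 \<le> a + b" using F(2)[of \<omega>0] G(2)[of \<omega>0] by linarith
  have int: "integrable M F" "integrable M G"
    using F by (intro integrable_const_bound[where B = a]) (use G in \<open>auto intro: integrable_const_bound[where B = b]\<close>)
  have "\<bar>expectation F - expectation G\<bar> = \<bar>expectation (\<lambda>\<omega>. F \<omega> - G \<omega>)\<bar>" using int by simp
  also have "\<dots> \<le> expectation (\<lambda>\<omega>. \<bar>F \<omega> - G \<omega>\<bar>)" by (rule integral_abs_bound)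
  also have "\<dots> \<le> expectation (\<lambda>\<omega>. \<eta> + (a + b) * indicator E \<omega>)"
  proof (rule integral_mono)
    fix \<omega> assume \<omega>: "\<omega> \<in> space M"
    show "\<bar>F \<omega> - G \<omega>\<bar> \<le> \<eta> + (a + b) * indicator E \<omega>"
      using F(2)[OF \<omega>] G(2)[OF \<omega>] close[of \<omega>] \<omega> \<eta> by (cases "\<omega> \<in> E") auto
  qed (use int E in \<open>auto simp: emeasure_eq_measure\<close>)
  also have "\<dots> = \<eta> + (a + b) * prob E"
    using E by (subst Bochner_Integration.integral_add) (auto simp: prob_space emeasure_eq_measure)
  also have "\<dots> \<le> \<eta> + (a + b) * \<pi>" using E(2) ab by (intro add_left_mono mult_left_mono)
  finally show ?thesis .
qed

lemma (in prob_space) prob_abs_gt_le: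
  fixes X :: "'a \<Rightarrow> real"
  assumes X: "X \<in> borel_measurable M" "integrable M (\<lambda>\<omega>. (X \<omega>)\<^sup>2)" and K: "0 < K"
    and c: "expectation (\<lambda>\<omega>. (X \<omega>)\<^sup>2) \<le> c"
  shows "prob {\<omega> \<in> space M. K < \<bar>X \<omega>\<bar>} \<le> c / K\<^sup>2"
proof -
  have [measurable]: "X \<in> borel_measurable M" by fact
  have "prob {\<omega> \<in> space M. K < \<bar>X \<omega>\<bar>} \<le> prob {\<omega> \<in> space M. K\<^sup>2 \<le> (X \<omega>)\<^sup>2}"
    using K by (intro finite_measure_mono) (auto simp: abs_le_square_iff[symmetric])
  also have "\<dots> \<le> expectation (\<lambda>\<omega>. (X \<omega>)\<^sup>2) / K\<^sup>2"
    using K by (intro integral_Markov_inequality_measure[where A = "space M" and u = "\<lambda>\<omega>. (X \<omega>)\<^sup>2"]) (use X K in auto)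
  also have "\<dots> \<le> c / K\<^sup>2" using c by (intro divide_right_mono) auto
  finally show ?thesis .
qed

text \<open>Chebyshev's inequality and a union bound confine all coordinates to the box of size
  \<open>K\<close> up to probability \<open>card J * c / K^2\<close>. On the box \<open>f\<close> is
  close to \<open>g\<close>; outside of it only the bounds \<open>B\<close> and \<open>B + e\<close>
  are used.\<close>

lemma (in prob_space) trig_approx_expectation:
  fixes V :: "'i \<Rightarrow> 'a \<Rightarrow> real" and c :: real
  assumes J: "finite J" and V: "\<And>j. j \<in> J \<Longrightarrow> V j \<in> borel_measurable M"
    and V2: "\<And>j. j \<in> J \<Longrightarrow> integrable M (\<lambda>\<omega>. (V j \<omega>)\<^sup>2)"
      "\<And>j. j \<in> J \<Longrightarrow> expectation (\<lambda>\<omega>. (V j \<omega>)\<^sup>2) \<le> c"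
    and K: "0 < K" and e: "0 \<le> e" and c: "0 \<le> c"
    and f: "f \<in> trig_polys J" "\<And>x. \<bar>f x\<bar> \<le> B + e"
    and g: "(\<lambda>\<omega>. g (\<lambda>j. V j \<omega>)) \<in> borel_measurable M" "\<And>x. \<bar>g x\<bar> \<le> B"
    and close: "\<And>x. (\<And>j. j \<in> J \<Longrightarrow> \<bar>x j\<bar> \<le> K) \<Longrightarrow> \<bar>g x - f x\<bar> \<le> e"
  shows "\<bar>expectation (\<lambda>\<omega>. g (\<lambda>j. V j \<omega>)) - expectation (\<lambda>\<omega>. f (\<lambda>j. V j \<omega>))\<bar> \<le>
    e + (2 * B + e) * (card J * c / K\<^sup>2)"
proof -
  note V[measurable]
  define E where "E = {\<omega> \<in> space M. \<exists>j\<in>J. K < \<bar>V j \<omega>\<bar>}"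
  have [measurable]: "E \<in> sets M" unfolding E_def using J by measurable
  have "prob E = prob (\<Union>j\<in>J. {\<omega> \<in> space M. K < \<bar>V j \<omega>\<bar>})"
    by (rule arg_cong[where f = prob]) (auto simp: E_def)
  also have "\<dots> \<le> (\<Sum>j\<in>J. prob {\<omega> \<in> space M. K < \<bar>V j \<omega>\<bar>})"
    using J by (intro finite_measure_subadditive_finite) auto
  also have "\<dots> \<le> (\<Sum>j\<in>J. c / K\<^sup>2)" by (intro sum_mono prob_abs_gt_le V V2 K)
  finally have pE: "prob E \<le> card J * c / K\<^sup>2" by simp
  have "\<bar>expectation (\<lambda>\<omega>. g (\<lambda>j. V j \<omega>)) - expectation (\<lambda>\<omega>. f (\<lambda>j. V j \<omega>))\<bar> \<le>
      e + (B + (B + e)) * (card J * c / K\<^sup>2)"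
  proof (rule expectation_diff_le[OF g(1) g(2) _ f(2) \<open>E \<in> sets M\<close> pE e])
    show "(\<lambda>\<omega>. f (\<lambda>j. V j \<omega>)) \<in> borel_measurable M" by (rule trig_polys_measurable[OF f(1) V])
    show "\<bar>g (\<lambda>j. V j \<omega>) - f (\<lambda>j. V j \<omega>)\<bar> \<le> e" if "\<omega> \<in> space M - E" for \<omega>
      using close[of "\<lambda>j. V j \<omega>"] that by (force simp: E_def)
  qed
  then show ?thesis by (simp add: algebra_simps)
qed

text \<open>The Lipschitz bound makes \<open>g\<close> continuous for the product topology and
  independent of the coordinates outside \<open>J\<close>. The index type is \<open>nat\<close>
  because a map into a countable product is Borel as soon as its coordinates are.\<close>

lemma lipschitz_measurable:
  fixes g :: "(nat \<Rightarrow> real) \<Rightarrow> real"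
  assumes J: "finite J" and L: "0 \<le> L"
    and lip: "\<And>x y. \<bar>g x - g y\<bar> \<le> L * (\<Sum>j\<in>J. \<bar>x j - y j\<bar>)"
    and V: "\<And>j. j \<in> J \<Longrightarrow> V j \<in> borel_measurable M"
  shows "(\<lambda>\<omega>. g (\<lambda>j. V j \<omega>)) \<in> borel_measurable M"
proof -
  have res: "g x = g (\<lambda>j. if j \<in> J then x j else 0)" for x
    using lip[of x "\<lambda>j. if j \<in> J then x j else 0"] by simp
  have "continuous_on UNIV g"
    unfolding continuous_on_def
  proof
    fix x :: "nat \<Rightarrow> real"
    have c: "((\<lambda>y. y j) \<longlongrightarrow> x j) (at x)" for j
      using continuous_on_product_coordinates[of j] unfolding continuous_on_def by auto
    have "((\<lambda>y. L * (\<Sum>j\<in>J. \<bar>y j - x j\<bar>)) \<longlongrightarrow> L * (\<Sum>j\<in>J. \<bar>x j - x j\<bar>)) (at x)"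
      by (intro tendsto_intros c)
    then have "((\<lambda>y. L * (\<Sum>j\<in>J. \<bar>y j - x j\<bar>)) \<longlongrightarrow> 0) (at x)" by simp
    then have "((\<lambda>y. g y - g x) \<longlongrightarrow> 0) (at x)"
      by (rule Lim_null_comparison[rotated]) (auto intro!: always_eventually lip)
    then show "(g \<longlongrightarrow> g x) (at x within UNIV)" by (simp add: LIM_zero_iff)
  qed
  then have "g \<in> borel_measurable borel" by (rule borel_measurable_continuous_onI)
  moreover have "(\<lambda>\<omega> j. if j \<in> J then V j \<omega> else 0) \<in> measurable M borel"
  proof (intro measurable_coordinatewise_then_product)
    show "(\<lambda>\<omega>. if j \<in> J then V j \<omega> else 0) \<in> borel_measurable M" for j
      using V by (cases "j \<in> J") auto
  qed
  ultimately have "(\<lambda>\<omega>. g (\<lambda>j. if j \<in> J then V j \<omega> else 0)) \<in> borel_measurable M"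
    by (rule measurable_compose[rotated])
  then show ?thesis by (simp flip: res)
qed

text \<open>Convergence holds for trigonometric polynomials by linearity. The common second moment
  bound \<open>c\<close> makes the replacement of \<open>g\<close> by such a polynomial uniform in
  \<open>n\<close>, so it plays the part of tightness.\<close>

lemma cramer_wold_lipschitz_nat:
  fixes g :: "(nat \<Rightarrow> real) \<Rightarrow> real" and c :: real
  assumes M: "\<And>n. prob_space (M n)" and N: "prob_space N" and J: "finite J"
    and V: "\<And>n j. j \<in> J \<Longrightarrow> V n j \<in> borel_measurable (M n)"
    and W: "\<And>j. j \<in> J \<Longrightarrow> W j \<in> borel_measurable N"
    and V2: "\<And>n j. j \<in> J \<Longrightarrow> integrable (M n) (\<lambda>\<omega>. (V n j \<omega>)\<^sup>2)"
      "\<And>n j. j \<in> J \<Longrightarrow> (\<integral>\<omega>. (V n j \<omega>)\<^sup>2 \<partial>M n) \<le> c"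
    and W2: "\<And>j. j \<in> J \<Longrightarrow> integrable N (\<lambda>\<omega>. (W j \<omega>)\<^sup>2)"
      "\<And>j. j \<in> J \<Longrightarrow> (\<integral>\<omega>. (W j \<omega>)\<^sup>2 \<partial>N) \<le> c"
    and lim: "\<And>a b. (\<lambda>n. \<integral>\<omega>. cos (b + (\<Sum>j\<in>J. a j * V n j \<omega>)) \<partial>M n) \<longlonglongrightarrow>
      (\<integral>\<omega>. cos (b + (\<Sum>j\<in>J. a j * W j \<omega>)) \<partial>N)"
    and bound: "\<And>x. \<bar>g x\<bar> \<le> B" and L: "0 \<le> L" and c: "0 \<le> c"
    and lip: "\<And>x y. \<bar>g x - g y\<bar> \<le> L * (\<Sum>j\<in>J. \<bar>x j - y j\<bar>)"
  shows "(\<lambda>n. \<integral>\<omega>. g (\<lambda>j. V n j \<omega>) \<partial>M n) \<longlonglongrightarrow> (\<integral>\<omega>. g (\<lambda>j. W j \<omega>) \<partial>N)"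
proof (rule LIMSEQ_I)
  fix r :: real assume r: "0 < r"
  define e where "e = min 1 (r / 8)"
  have e: "0 < e" "e \<le> 1" "e \<le> r / 8" using r by (auto simp: e_def)
  have B: "0 \<le> B" using bound[of undefined] by linarith
  have "((\<lambda>K. (2 * B + 1) * (card J * c / K\<^sup>2)) \<longlongrightarrow> 0) at_top" by real_asymp
  then have "\<forall>\<^sub>F K in at_top. (2 * B + 1) * (card J * c / K\<^sup>2) < r / 8"
    using r by (intro order_tendstoD(2)) auto
  then obtain K where K: "0 < K" "(2 * B + 1) * (card J * c / K\<^sup>2) < r / 8"
    using eventually_conj[OF eventually_gt_at_top[of 0]] eventually_happens'[OF trivial_limit_at_top_linorder]
    by (metis (mono_tags, lifting))
  obtain f where f: "f \<in> trig_polys J" "\<And>x. \<bar>f x\<bar> \<le> B + e"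
    "\<And>x. (\<And>j. j \<in> J \<Longrightarrow> \<bar>x j\<bar> \<le> K) \<Longrightarrow> \<bar>g x - f x\<bar> \<le> e"
    using trig_poly_approx[OF J K(1) e(1) bound L lip] by metis
  have "(2 * B + e) * (card J * c / K\<^sup>2) \<le> (2 * B + 1) * (card J * c / K\<^sup>2)"
    using e c by (intro mult_right_mono) auto
  then have small: "e + (2 * B + e) * (card J * c / K\<^sup>2) < r / 4" using K e by linarith
  have 1: "\<bar>(\<integral>\<omega>. g (\<lambda>j. V n j \<omega>) \<partial>M n) - (\<integral>\<omega>. f (\<lambda>j. V n j \<omega>) \<partial>M n)\<bar> < r / 4" for n
    using J V V2 K(1) e(1) c f bound
    by (intro le_less_trans[OF prob_space.trig_approx_expectation[OF M] small]
        lipschitz_measurable[OF J L lip]) auto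
  have 2: "\<bar>(\<integral>\<omega>. g (\<lambda>j. W j \<omega>) \<partial>N) - (\<integral>\<omega>. f (\<lambda>j. W j \<omega>) \<partial>N)\<bar> < r / 4"
    using J W W2 K(1) e(1) c f bound
    by (intro le_less_trans[OF prob_space.trig_approx_expectation[OF N] small]
        lipschitz_measurable[OF J L lip]) auto
  have "(\<lambda>n. \<integral>\<omega>. f (\<lambda>j. V n j \<omega>) \<partial>M n) \<longlonglongrightarrow> (\<integral>\<omega>. f (\<lambda>j. W j \<omega>) \<partial>N)"
    by (rule trig_polys_expectation_tendsto[OF M N V W lim f(1)])
  from LIMSEQ_D[OF this, of "r / 4"] r obtain n0 where n0:
    "\<And>n. n \<ge> n0 \<Longrightarrow> \<bar>(\<integral>\<omega>. f (\<lambda>j. V n j \<omega>) \<partial>M n) - (\<integral>\<omega>. f (\<lambda>j. W j \<omega>) \<partial>N)\<bar> < r / 4"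
    by auto
  have "norm ((\<integral>\<omega>. g (\<lambda>j. V n j \<omega>) \<partial>M n) - (\<integral>\<omega>. g (\<lambda>j. W j \<omega>) \<partial>N)) < r" if "n \<ge> n0" for n
    using 1[of n] 2 n0[OF that] r unfolding real_norm_def by linarith
  then show "\<exists>n0. \<forall>n\<ge>n0. norm ((\<integral>\<omega>. g (\<lambda>j. V n j \<omega>) \<partial>M n) - (\<integral>\<omega>. g (\<lambda>j. W j \<omega>) \<partial>N)) < r"
    by blast
qed

text \<open>Transfer from \<open>nat\<close> to an arbitrary index type along an enumeration of
  \<open>J\<close>; later the indices are points of the square.\<close>

lemma cramer_wold_lipschitz:
  fixes g :: "('i \<Rightarrow> real) \<Rightarrow> real" and c :: real
  assumes M: "\<And>n. prob_space (M n)" and N: "prob_space N" and J: "finite J"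
    and V: "\<And>n j. j \<in> J \<Longrightarrow> V n j \<in> borel_measurable (M n)"
    and W: "\<And>j. j \<in> J \<Longrightarrow> W j \<in> borel_measurable N"
    and V2: "\<And>n j. j \<in> J \<Longrightarrow> integrable (M n) (\<lambda>\<omega>. (V n j \<omega>)\<^sup>2)"
      "\<And>n j. j \<in> J \<Longrightarrow> (\<integral>\<omega>. (V n j \<omega>)\<^sup>2 \<partial>M n) \<le> c"
    and W2: "\<And>j. j \<in> J \<Longrightarrow> integrable N (\<lambda>\<omega>. (W j \<omega>)\<^sup>2)"
      "\<And>j. j \<in> J \<Longrightarrow> (\<integral>\<omega>. (W j \<omega>)\<^sup>2 \<partial>N) \<le> c"
    and lim: "\<And>a b. (\<lambda>n. \<integral>\<omega>. cos (b + (\<Sum>j\<in>J. a j * V n j \<omega>)) \<partial>M n) \<longlonglongrightarrow>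
      (\<integral>\<omega>. cos (b + (\<Sum>j\<in>J. a j * W j \<omega>)) \<partial>N)"
    and bound: "\<And>x. \<bar>g x\<bar> \<le> B" and L: "0 \<le> L" and c: "0 \<le> c"
    and lip: "\<And>x y. \<bar>g x - g y\<bar> \<le> L * (\<Sum>j\<in>J. \<bar>x j - y j\<bar>)"
  shows "(\<lambda>n. \<integral>\<omega>. g (\<lambda>j. V n j \<omega>) \<partial>M n) \<longlonglongrightarrow> (\<integral>\<omega>. g (\<lambda>j. W j \<omega>) \<partial>N)"
proof -
  obtain \<iota> where \<iota>: "bij_betw \<iota> {0..<card J} J" using ex_bij_betw_nat_finite[OF J] by blast
  define \<kappa> where "\<kappa> = inv_into {0..<card J} \<iota>"
  have \<iota>J: "\<iota> i \<in> J" "\<kappa> (\<iota> i) = i" if "i \<in> {0..<card J}" for i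
    using \<iota> that by (auto simp: \<kappa>_def bij_betw_def)
  have \<kappa>J: "\<iota> (\<kappa> j) = j" if "j \<in> J" for j
    using \<iota> that by (metis \<kappa>_def bij_betw_inv_into_right)
  have sum: "(\<Sum>i\<in>{0..<card J}. f (\<iota> i)) = (\<Sum>j\<in>J. f j)" for f :: "'i \<Rightarrow> real"
    by (rule sum.reindex_bij_betw[OF \<iota>])
  define g' where "g' y = g (\<lambda>j. y (\<kappa> j))" for y
  have "(\<lambda>n. \<integral>\<omega>. g' (\<lambda>i. V n (\<iota> i) \<omega>) \<partial>M n) \<longlonglongrightarrow> (\<integral>\<omega>. g' (\<lambda>i. W (\<iota> i) \<omega>) \<partial>N)"
  proof (rule cramer_wold_lipschitz_nat[where V = "\<lambda>n i. V n (\<iota> i)" and W = "\<lambda>i. W (\<iota> i)" and g = g', OF M N finite_atLeastLessThan[of 0 "card J"] _ _ _ _ _ _ _ _ L c])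
    show "(\<lambda>n. \<integral>\<omega>. cos (b + (\<Sum>i\<in>{0..<card J}. a i * V n (\<iota> i) \<omega>)) \<partial>M n) \<longlonglongrightarrow>
      (\<integral>\<omega>. cos (b + (\<Sum>i\<in>{0..<card J}. a i * W (\<iota> i) \<omega>)) \<partial>N)" for a b
    proof -
      have eq: "(\<Sum>i\<in>{0..<card J}. a i * x (\<iota> i)) = (\<Sum>j\<in>J. a (\<kappa> j) * x j)" for x :: "'i \<Rightarrow> real"
        by (subst sum[symmetric]) (simp add: \<iota>J)
      have "(\<Sum>i\<in>{0..<card J}. a i * V n (\<iota> i) \<omega>) = (\<Sum>j\<in>J. a (\<kappa> j) * V n j \<omega>)"
        "(\<Sum>i\<in>{0..<card J}. a i * W (\<iota> i) \<omega>') = (\<Sum>j\<in>J. a (\<kappa> j) * W j \<omega>')" for n \<omega> \<omega>'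
        by (rule eq[of "\<lambda>j. V n j \<omega>"], rule eq[of "\<lambda>j. W j \<omega>'"])
      then show ?thesis using lim[of b "\<lambda>j. a (\<kappa> j)"] by simp
    qed
    show "\<bar>g' x - g' y\<bar> \<le> L * (\<Sum>i\<in>{0..<card J}. \<bar>x i - y i\<bar>)" for x y
    proof -
      have "(\<Sum>i\<in>{0..<card J}. \<bar>x i - y i\<bar>) = (\<Sum>j\<in>J. \<bar>x (\<kappa> j) - y (\<kappa> j)\<bar>)"
        by (subst sum[symmetric]) (simp add: \<iota>J)
      then show ?thesis unfolding g'_def using lip[of "\<lambda>j. x (\<kappa> j)" "\<lambda>j. y (\<kappa> j)"] by simp
    qed
  qed (use V W V2 W2 bound \<iota>J(1) in \<open>auto simp: g'_def\<close>)
  moreover have "g (\<lambda>j. x (\<iota> (\<kappa> j))) = g x" for x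
  proof -
    have "(\<Sum>j\<in>J. \<bar>x (\<iota> (\<kappa> j)) - x j\<bar>) = 0" using \<kappa>J by simp
    then show ?thesis using lip[of "\<lambda>j. x (\<iota> (\<kappa> j))" x] by simp
  qed
  then have "g (\<lambda>j. V n (\<iota> (\<kappa> j)) \<omega>) = g (\<lambda>j. V n j \<omega>)"
    "g (\<lambda>j. W (\<iota> (\<kappa> j)) \<omega>') = g (\<lambda>j. W j \<omega>')" for n \<omega> \<omega>'
    by (rule meta_spec[of _ "\<lambda>j. V n j \<omega>"], rule meta_spec[of _ "\<lambda>j. W j \<omega>'"])
  ultimately show ?thesis unfolding g'_def by simp
qed

section \<open>Lipschitz test functions\<close>

lemma topspace_skorokhod [simp]: "topspace skorokhod_topology = skorokhod_D"
  by (simp add: skorokhod_topology_def)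

lemma space_borel_of_topology [simp]: "space (borel_of_topology T) = topspace T"
  by (simp add: borel_of_topology_def space_measure_of_conv)

context Metric_space
begin

lemma lipschitz_continuous_map:
  assumes "\<And>x y. x \<in> M \<Longrightarrow> y \<in> M \<Longrightarrow> \<bar>h x - h y\<bar> \<le> L * d x y"
  shows "continuous_map mtopology euclideanreal h"
proof -
  have "Lipschitz_continuous_map (metric (M, d)) (metric (UNIV, dist)) h"
    unfolding Lipschitz_continuous_map_def
    using assms Metric_space_axioms
    by (auto simp: mspace_metric mdist_metric dist_real_def)
  then have "continuous_map (mtopology_of (metric (M, d))) (mtopology_of euclidean_metric) h"
    unfolding euclidean_metric_def by (rule Lipschitz_continuous_imp_continuous_map)
  then show ?thesis by (simp add: mtopology_of)
qed

text \<open>The inf-convolution of \<open>h\<close> with \<open>k * d\<close>, also known as the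
  Pasch-Hausdorff envelope.\<close>

definition lipschitz_minorant :: "('a \<Rightarrow> real) \<Rightarrow> nat \<Rightarrow> 'a \<Rightarrow> real" where
  "lipschitz_minorant h k x = (INF y\<in>M. h y + real k * d x y)"

lemma lipschitz_minorant:
  assumes b: "\<And>x. x \<in> M \<Longrightarrow> \<bar>h x\<bar> \<le> B" and x: "x \<in> M"
  shows "lipschitz_minorant h k x \<le> h x" "- B \<le> lipschitz_minorant h k x"
    and "y \<in> M \<Longrightarrow> \<bar>lipschitz_minorant h k x - lipschitz_minorant h k y\<bar> \<le> real k * d x y"
    and "continuous_map mtopology euclideanreal h \<Longrightarrow> (\<lambda>k. lipschitz_minorant h k x) \<longlonglongrightarrow> h x"
proof -
  have bdd: "bdd_below ((\<lambda>y. h y + real k * d z y) ` M)" for k z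
  proof (rule bdd_belowI2[of _ "- B"])
    fix y assume "y \<in> M"
    then show "- B \<le> h y + real k * d z y" using b[of y] by (simp add: abs_le_iff add_increasing2)
  qed
  have low: "lipschitz_minorant h k z \<le> h y + real k * d z y" if "y \<in> M" for k z y
    unfolding lipschitz_minorant_def by (rule cINF_lower[OF bdd that])
  show le: "lipschitz_minorant h k x \<le> h x" for k using low[OF x, of k x] x by simp
  show "- B \<le> lipschitz_minorant h k x"
    unfolding lipschitz_minorant_def
  proof (rule cINF_greatest)
    fix y assume "y \<in> M"
    then show "- B \<le> h y + real k * d x y" using b[of y] by (simp add: abs_le_iff add_increasing2)
  qed (use x in auto)
  have half: "lipschitz_minorant h k u - real k * d u v \<le> lipschitz_minorant h k v" if "u \<in> M" "v \<in> M" for u v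
    unfolding lipschitz_minorant_def[of h k v]
  proof (rule cINF_greatest)
    fix y assume y: "y \<in> M"
    have "real k * d u y \<le> real k * (d u v + d v y)" using triangle[OF that y] by (intro mult_left_mono) auto
    then show "lipschitz_minorant h k u - real k * d u v \<le> h y + real k * d v y"
      using low[OF y, of k u] by (simp add: distrib_left)
  qed (use x in auto)
  show "\<bar>lipschitz_minorant h k x - lipschitz_minorant h k y\<bar> \<le> real k * d x y" if "y \<in> M"
    using half[OF x that] half[OF that x] by (simp add: abs_le_iff commute)
  show "(\<lambda>k. lipschitz_minorant h k x) \<longlonglongrightarrow> h x" if c: "continuous_map mtopology euclideanreal h"
  proof (rule LIMSEQ_I)
    fix r :: real assume r: "0 < r"
    define U where "U = {z \<in> M. h z \<in> {h x - r / 2<..}}"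
    have "openin mtopology U"
      using openin_continuous_map_preimage[OF c, of "{h x - r / 2<..}"] by (simp add: U_def)
    moreover have "x \<in> U" using x r by (simp add: U_def)
    ultimately obtain e where e: "0 < e" "mball x e \<subseteq> U"
      unfolding openin_mtopology by blast
    \<comment> \<open>Outside the ball of radius \<open>e\<close> the penalty
      \<open>k * d x y\<close> then exceeds \<open>2 * B\<close>, the largest possible oscillation
      of \<open>h\<close>; inside the ball continuity is used.\<close>
    obtain K :: nat where K: "2 * B / e < real K" using reals_Archimedean2 by blast
    have "norm (lipschitz_minorant h k x - h x) < r" if k: "k \<ge> K" for k
    proof -
      have "h x - r / 2 \<le> lipschitz_minorant h k x"
        unfolding lipschitz_minorant_def
      proof (rule cINF_greatest)
        fix y assume y: "y \<in> M"
        show "h x - r / 2 \<le> h y + real k * d x y"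
        proof (cases "d x y < e")
          case True
          then have "h x - r / 2 < h y" using e x y by (auto simp: U_def)
          then show ?thesis by (simp add: add_increasing2 less_imp_le)
        next
          case False
          have "2 * B < real K * e" using K e by (simp add: field_simps)
          also have "\<dots> \<le> real k * d x y" using False k e by (intro mult_mono) auto
          finally show ?thesis using b[OF x] b[OF y] r by (simp add: abs_le_iff)
        qed
      qed (use x in auto)
      then show ?thesis using le[of k] r by (simp add: abs_less_iff)
    qed
    then show "\<exists>no. \<forall>n\<ge>no. norm (lipschitz_minorant h n x - h x) < r" by blast
  qed
qed

text \<open>Lipschitz minorants approximate \<open>h\<close> from below, which yields a lower bound
  for the expectations. The upper bound follows by applying this to \<open>- h\<close>.\<close>

lemma portmanteau_half:
  assumes P: "\<And>n. prob_space (P n)" and N: "prob_space N"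
    and X: "\<And>n. X n \<in> measurable (P n) (borel_of_topology mtopology)"
    and Y: "Y \<in> measurable N (borel_of_topology mtopology)"
    and lim: "\<And>h L B. 0 \<le> L \<Longrightarrow> (\<And>x y. x \<in> M \<Longrightarrow> y \<in> M \<Longrightarrow> \<bar>h x - h y\<bar> \<le> L * d x y) \<Longrightarrow>
      (\<And>x. x \<in> M \<Longrightarrow> \<bar>h x\<bar> \<le> B) \<Longrightarrow>
      (\<lambda>n. \<integral>\<omega>. h (X n \<omega>) \<partial>P n) \<longlonglongrightarrow> (\<integral>\<omega>. h (Y \<omega>) \<partial>N)"
    and h: "continuous_map mtopology euclideanreal h" and b: "\<And>x. x \<in> M \<Longrightarrow> \<bar>h x\<bar> \<le> B" and e: "0 < e"
  shows "\<forall>\<^sub>F n in sequentially. (\<integral>\<omega>. h (Y \<omega>) \<partial>N) - e < (\<integral>\<omega>. h (X n \<omega>) \<partial>P n)"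
proof -
  let ?h = "lipschitz_minorant h"
  have XM: "X n \<omega> \<in> M" if "\<omega> \<in> space (P n)" for n \<omega>
    using measurable_space[OF X that] by simp
  have YM: "Y \<omega> \<in> M" if "\<omega> \<in> space N" for \<omega>
    using measurable_space[OF Y that] by simp
  have bk: "\<bar>?h k x\<bar> \<le> B" if "x \<in> M" for k x
  proof -
    have "?h k x \<le> h x" using b that by (rule lipschitz_minorant(1))
    moreover have "- B \<le> ?h k x" using b that by (rule lipschitz_minorant(2))
    ultimately show ?thesis using b[OF that] by (simp add: abs_le_iff)
  qed
  have contk: "continuous_map mtopology euclideanreal (?h k)" for k
    using lipschitz_minorant(3)[OF b] by (intro lipschitz_continuous_map[of _ "real k"]) auto
  have measX: "(\<lambda>\<omega>. f (X n \<omega>)) \<in> borel_measurable (P n)" if "continuous_map mtopology euclideanreal f" for f n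
    by (rule borel_measurable_comp_continuous_map[OF X that])
  have measY: "(\<lambda>\<omega>. f (Y \<omega>)) \<in> borel_measurable N" if "continuous_map mtopology euclideanreal f" for f
    by (rule borel_measurable_comp_continuous_map[OF Y that])
  interpret N: prob_space N by fact
  have "(\<lambda>k. \<integral>\<omega>. ?h k (Y \<omega>) \<partial>N) \<longlonglongrightarrow> (\<integral>\<omega>. h (Y \<omega>) \<partial>N)"
  proof (rule integral_dominated_convergence[where w = "\<lambda>_. B"])
    show "AE \<omega> in N. (\<lambda>k. ?h k (Y \<omega>)) \<longlonglongrightarrow> h (Y \<omega>)"
      using lipschitz_minorant(4)[OF b _ h] YM by (intro AE_I2) auto
    show "AE \<omega> in N. norm (?h k (Y \<omega>)) \<le> B" for k using bk YM by (intro AE_I2) auto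
  qed (use measY h contk in auto)
  then obtain k where k: "(\<integral>\<omega>. h (Y \<omega>) \<partial>N) - e / 2 < (\<integral>\<omega>. ?h k (Y \<omega>) \<partial>N)"
    using order_tendstoD(1)[of _ "\<integral>\<omega>. h (Y \<omega>) \<partial>N" sequentially "(\<integral>\<omega>. h (Y \<omega>) \<partial>N) - e / 2"] e
    by (auto simp: eventually_sequentially)
  have "(\<lambda>n. \<integral>\<omega>. ?h k (X n \<omega>) \<partial>P n) \<longlonglongrightarrow> (\<integral>\<omega>. ?h k (Y \<omega>) \<partial>N)"
    using lipschitz_minorant(3)[OF b] bk by (intro lim[of "real k"]) auto
  then have "\<forall>\<^sub>F n in sequentially. (\<integral>\<omega>. ?h k (Y \<omega>) \<partial>N) - e / 2 < (\<integral>\<omega>. ?h k (X n \<omega>) \<partial>P n)"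
    using e by (intro order_tendstoD(1)) auto
  then show ?thesis
  proof eventually_elim
    case (elim n)
    interpret prob_space "P n" by (rule P)
    have "?h k x \<le> h x" if "x \<in> M" for x
      using b that by (rule lipschitz_minorant(1))
    then have "(\<integral>\<omega>. ?h k (X n \<omega>) \<partial>P n) \<le> (\<integral>\<omega>. h (X n \<omega>) \<partial>P n)"
      using measX contk h b bk XM
      by (intro integral_mono integrable_const_bound[where B = B] AE_I2) auto
    then show ?case using elim k by linarith
  qed
qed

lemma portmanteau_lipschitz:
  assumes P: "\<And>n. prob_space (P n)" and N: "prob_space N"
    and X: "\<And>n. X n \<in> measurable (P n) (borel_of_topology mtopology)"
    and Y: "Y \<in> measurable N (borel_of_topology mtopology)"
    and lim: "\<And>h L B. 0 \<le> L \<Longrightarrow> (\<And>x y. x \<in> M \<Longrightarrow> y \<in> M \<Longrightarrow> \<bar>h x - h y\<bar> \<le> L * d x y) \<Longrightarrow>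
      (\<And>x. x \<in> M \<Longrightarrow> \<bar>h x\<bar> \<le> B) \<Longrightarrow>
      (\<lambda>n. \<integral>\<omega>. h (X n \<omega>) \<partial>P n) \<longlonglongrightarrow> (\<integral>\<omega>. h (Y \<omega>) \<partial>N)"
  shows "converges_in_distribution mtopology P X N Y"
  unfolding converges_in_distribution_def
proof (intro conjI allI impI)
  fix h :: "'a \<Rightarrow> real"
  assume "continuous_map mtopology euclideanreal h \<and> bounded (h ` topspace mtopology)"
  then obtain B where h: "continuous_map mtopology euclideanreal h" and B: "\<And>x. x \<in> M \<Longrightarrow> \<bar>h x\<bar> \<le> B"
    unfolding bounded_iff by auto
  have h': "continuous_map mtopology euclideanreal (\<lambda>x. - h x)"
    using h by (rule continuous_map_minus)
  have B': "\<bar>- h x\<bar> \<le> B" if "x \<in> M" for x using B[OF that] by simp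
  have half: "\<forall>\<^sub>F n in sequentially. (\<integral>\<omega>. h (Y \<omega>) \<partial>N) - e < (\<integral>\<omega>. h (X n \<omega>) \<partial>P n)"
    if "continuous_map mtopology euclideanreal h" "\<And>x. x \<in> M \<Longrightarrow> \<bar>h x\<bar> \<le> B" "0 < e" for h B and e :: real
    by (rule portmanteau_half[OF P N X Y _ that]) (rule lim)
  show "(\<lambda>n. \<integral>\<omega>. h (X n \<omega>) \<partial>P n) \<longlonglongrightarrow> (\<integral>\<omega>. h (Y \<omega>) \<partial>N)"
  proof (rule tendstoI)
    fix e :: real assume e: "0 < e"
    have "\<forall>\<^sub>F n in sequentially. (\<integral>\<omega>. h (Y \<omega>) \<partial>N) - e < (\<integral>\<omega>. h (X n \<omega>) \<partial>P n)"
      using B by (rule half[OF h _ e])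
    moreover have "\<forall>\<^sub>F n in sequentially. (\<integral>\<omega>. - h (Y \<omega>) \<partial>N) - e < (\<integral>\<omega>. - h (X n \<omega>) \<partial>P n)"
      using B' by (rule half[OF h' _ e])
    ultimately show "\<forall>\<^sub>F n in sequentially. dist (\<integral>\<omega>. h (X n \<omega>) \<partial>P n) (\<integral>\<omega>. h (Y \<omega>) \<partial>N) < e"
      by eventually_elim (simp add: dist_real_def abs_less_iff)
  qed
qed (use X Y in auto)

end

section \<open>Moments of sums of independent variables\<close>

context prob_space
begin

lemma indep_expectation_mult_bounded:
  fixes X Y :: "'a \<Rightarrow> real"
  assumes "indep_var borel X borel Y"
    and "\<And>\<omega>. \<omega> \<in> space M \<Longrightarrow> \<bar>X \<omega>\<bar> \<le> B" "\<And>\<omega>. \<omega> \<in> space M \<Longrightarrow> \<bar>Y \<omega>\<bar> \<le> C"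
  shows "expectation (\<lambda>\<omega>. X \<omega> * Y \<omega>) = expectation X * expectation Y"
proof (rule indep_var_lebesgue_integral[OF assms(1)])
  have [measurable]: "X \<in> borel_measurable M" "Y \<in> borel_measurable M"
    using assms(1) indep_var_rv1 indep_var_rv2 by blast+
  show "integrable M X" using assms by (intro integrable_const_bound[where B = B]) auto
  show "integrable M Y" using assms by (intro integrable_const_bound[where B = C]) auto
qed

text \<open>The three claims are proved by one induction, as the fourth moment needs the other two
  for the smaller sum. With \<open>S\<close> independent of the new centered term, the mixed moments
  of type (3, 1), (1, 3) and (1, 1) vanish. The bound
  \<open>\<bar>X i \<omega>\<bar> \<le> 1\<close> replaces the fourth moment of a single term by its
  second.\<close>

lemma fourth_moment_sum:
  fixes X :: "'i \<Rightarrow> 'a \<Rightarrow> real" and h :: real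
  assumes I: "finite I" and ind: "indep_vars (\<lambda>_. borel) X I"
    and mean: "\<And>i. i \<in> I \<Longrightarrow> expectation (X i) = 0"
    and bound: "\<And>i \<omega>. i \<in> I \<Longrightarrow> \<omega> \<in> space M \<Longrightarrow> \<bar>X i \<omega>\<bar> \<le> 1"
    and var: "\<And>i. i \<in> I \<Longrightarrow> expectation (\<lambda>\<omega>. (X i \<omega>)\<^sup>2) \<le> h" and h: "0 \<le> h"
  shows "expectation (\<lambda>\<omega>. \<Sum>i\<in>I. X i \<omega>) = 0"
    and "expectation (\<lambda>\<omega>. (\<Sum>i\<in>I. X i \<omega>)\<^sup>2) \<le> card I * h"
    and "expectation (\<lambda>\<omega>. (\<Sum>i\<in>I. X i \<omega>) ^ 4) \<le> card I * h + 3 * (card I * h)\<^sup>2"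
  using I ind mean bound var
proof (induction I rule: finite_induct)
  case empty
  {
    case 1 then show ?case by simp
  next
    case 2 then show ?case by simp
  next
    case 3 then show ?case by simp
  }
next
  case (insert i I)
  define S where "S = (\<lambda>\<omega>. \<Sum>i\<in>I. X i \<omega>)"
  define n where "n = real (card I)"
  have main: "expectation (\<lambda>\<omega>. X i \<omega> + S \<omega>) = 0 \<and>
     expectation (\<lambda>\<omega>. (X i \<omega> + S \<omega>)\<^sup>2) \<le> (n + 1) * h \<and>
     expectation (\<lambda>\<omega>. (X i \<omega> + S \<omega>) ^ 4) \<le> (n + 1) * h + 3 * ((n + 1) * h)\<^sup>2"
    if ind: "indep_vars (\<lambda>_. borel) X (insert i I)"
      and mean: "\<And>j. j \<in> insert i I \<Longrightarrow> expectation (X j) = 0"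
      and bound: "\<And>j \<omega>. j \<in> insert i I \<Longrightarrow> \<omega> \<in> space M \<Longrightarrow> \<bar>X j \<omega>\<bar> \<le> 1"
      and var: "\<And>j. j \<in> insert i I \<Longrightarrow> expectation (\<lambda>\<omega>. (X j \<omega>)\<^sup>2) \<le> h"
  proof -
    have indI: "indep_vars (\<lambda>_. borel) X I" by (rule indep_vars_subset[OF ind]) auto
    have IH: "expectation S = 0" "expectation (\<lambda>\<omega>. (S \<omega>)\<^sup>2) \<le> n * h"
      "expectation (\<lambda>\<omega>. (S \<omega>) ^ 4) \<le> n * h + 3 * (n * h)\<^sup>2"
      unfolding S_def n_def using insert.IH[OF indI] mean bound var by auto
    have iv: "indep_var borel (X i) borel S"
      unfolding S_def by (rule indep_vars_sum[OF insert.hyps ind])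
    have [measurable]: "X i \<in> borel_measurable M" "S \<in> borel_measurable M"
      using iv indep_var_rv1 indep_var_rv2 by blast+
    have Xb: "\<bar>X i \<omega>\<bar> \<le> 1" if "\<omega> \<in> space M" for \<omega> using bound that by simp
    have Sb: "\<bar>S \<omega>\<bar> \<le> n" if "\<omega> \<in> space M" for \<omega>
    proof -
      have "\<bar>S \<omega>\<bar> \<le> (\<Sum>i\<in>I. 1)"
        unfolding S_def using bound that by (intro order_trans[OF sum_abs] sum_mono) auto
      then show ?thesis by (simp add: n_def)
    qed
    have pw: "\<bar>X i \<omega> ^ a\<bar> \<le> 1" "\<bar>S \<omega> ^ b\<bar> \<le> n ^ b" if "\<omega> \<in> space M" for \<omega> a b
      using Xb[OF that] Sb[OF that] by (auto simp: power_abs power_le_one power_mono)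
    have n0: "0 \<le> n" by (simp add: n_def)
    have int: "integrable M (\<lambda>\<omega>. X i \<omega> ^ a * S \<omega> ^ b)" for a b
    proof (rule integrable_const_bound[where B = "1 * n ^ b"])
      show "AE \<omega> in M. norm (X i \<omega> ^ a * S \<omega> ^ b) \<le> 1 * n ^ b"
        unfolding real_norm_def abs_mult using pw by (intro AE_I2 mult_mono) auto
    qed simp
    have prod: "expectation (\<lambda>\<omega>. X i \<omega> ^ a * S \<omega> ^ b) = expectation (\<lambda>\<omega>. X i \<omega> ^ a) * expectation (\<lambda>\<omega>. S \<omega> ^ b)" for a b
    proof (rule indep_expectation_mult_bounded[where B = 1 and C = "n ^ b"])
      have "indep_var borel ((\<lambda>x. x ^ a) \<circ> X i) borel ((\<lambda>x. x ^ b) \<circ> S)"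
        by (rule indep_var_compose[OF iv]) auto
      then show "indep_var borel (\<lambda>\<omega>. X i \<omega> ^ a) borel (\<lambda>\<omega>. S \<omega> ^ b)" by (simp add: comp_def)
    qed (use pw in auto)
    have EX: "expectation (\<lambda>\<omega>. X i \<omega>) = 0" using mean by simp
    have EX2: "expectation (\<lambda>\<omega>. (X i \<omega>)\<^sup>2) \<le> h" using var by simp
    have EX2': "0 \<le> expectation (\<lambda>\<omega>. (X i \<omega>)\<^sup>2)" "0 \<le> expectation (\<lambda>\<omega>. (S \<omega>)\<^sup>2)" by auto
    have EX4: "expectation (\<lambda>\<omega>. X i \<omega> ^ 4) \<le> h"
    proof -
      have "expectation (\<lambda>\<omega>. X i \<omega> ^ 4) \<le> expectation (\<lambda>\<omega>. (X i \<omega>)\<^sup>2)"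
      proof (rule integral_mono)
        show "integrable M (\<lambda>\<omega>. X i \<omega> ^ 4)" using int[of 4 0] by simp
        show "integrable M (\<lambda>\<omega>. (X i \<omega>)\<^sup>2)" using int[of 2 0] by simp
        fix \<omega> assume "\<omega> \<in> space M"
        then have "(X i \<omega>)\<^sup>2 \<le> 1" using Xb by (simp add: abs_square_le_1)
        then have "(X i \<omega>)\<^sup>2 * (X i \<omega>)\<^sup>2 \<le> (X i \<omega>)\<^sup>2 * 1" by (intro mult_left_mono) auto
        then show "X i \<omega> ^ 4 \<le> (X i \<omega>)\<^sup>2" by (simp flip: power_add)
      qed
      then show ?thesis using EX2 by simp
    qed
    have 1: "expectation (\<lambda>\<omega>. X i \<omega> + S \<omega>) = 0"
      using int[of 1 0] int[of 0 1] EX IH(1) by simp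
    have "expectation (\<lambda>\<omega>. (X i \<omega> + S \<omega>)\<^sup>2) =
        expectation (\<lambda>\<omega>. X i \<omega> ^ 2 * S \<omega> ^ 0 + 2 * (X i \<omega> ^ 1 * S \<omega> ^ 1) + X i \<omega> ^ 0 * S \<omega> ^ 2)"
      by (intro Bochner_Integration.integral_cong) (auto simp: power2_eq_square algebra_simps)
    also have "\<dots> = expectation (\<lambda>\<omega>. X i \<omega> ^ 2) + 2 * expectation (\<lambda>\<omega>. X i \<omega> ^ 1 * S \<omega> ^ 1) + expectation (\<lambda>\<omega>. S \<omega> ^ 2)"
      using int[of 2 0] int[of 1 1] int[of 0 2] by simp
    also have "\<dots> = expectation (\<lambda>\<omega>. X i \<omega> ^ 2) + expectation (\<lambda>\<omega>. S \<omega> ^ 2)"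
      unfolding prod using EX by simp
    finally have 2: "expectation (\<lambda>\<omega>. (X i \<omega> + S \<omega>)\<^sup>2) \<le> (n + 1) * h"
      using EX2 IH(2) by (simp add: algebra_simps)
    have "expectation (\<lambda>\<omega>. (X i \<omega> + S \<omega>) ^ 4) =
        expectation (\<lambda>\<omega>. X i \<omega> ^ 4 * S \<omega> ^ 0 + 4 * (X i \<omega> ^ 3 * S \<omega> ^ 1) + 6 * (X i \<omega> ^ 2 * S \<omega> ^ 2)
          + 4 * (X i \<omega> ^ 1 * S \<omega> ^ 3) + X i \<omega> ^ 0 * S \<omega> ^ 4)"
    proof (intro Bochner_Integration.integral_cong refl)
      show "(X i \<omega> + S \<omega>) ^ 4 = X i \<omega> ^ 4 * S \<omega> ^ 0 + 4 * (X i \<omega> ^ 3 * S \<omega> ^ 1) + 6 * (X i \<omega> ^ 2 * S \<omega> ^ 2)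
          + 4 * (X i \<omega> ^ 1 * S \<omega> ^ 3) + X i \<omega> ^ 0 * S \<omega> ^ 4" for \<omega>
        by (simp add: power4_eq_xxxx power3_eq_cube power2_eq_square algebra_simps)
    qed
    also have "\<dots> = expectation (\<lambda>\<omega>. X i \<omega> ^ 4) + 4 * expectation (\<lambda>\<omega>. X i \<omega> ^ 3 * S \<omega> ^ 1)
        + 6 * expectation (\<lambda>\<omega>. X i \<omega> ^ 2 * S \<omega> ^ 2) + 4 * expectation (\<lambda>\<omega>. X i \<omega> ^ 1 * S \<omega> ^ 3) + expectation (\<lambda>\<omega>. S \<omega> ^ 4)"
      using int[of 4 0] int[of 3 1] int[of 2 2] int[of 1 3] int[of 0 4] by simp
    also have "\<dots> = expectation (\<lambda>\<omega>. X i \<omega> ^ 4) + 6 * (expectation (\<lambda>\<omega>. X i \<omega> ^ 2) * expectation (\<lambda>\<omega>. S \<omega> ^ 2))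
        + expectation (\<lambda>\<omega>. S \<omega> ^ 4)"
      unfolding prod using EX IH(1) by simp
    also have "\<dots> \<le> h + 6 * (h * (n * h)) + (n * h + 3 * (n * h)\<^sup>2)"
      using EX2 EX2' IH EX4 h n0 by (intro add_mono mult_left_mono mult_mono) auto
    \<comment> \<open>The mixed term \<open>6 * n * h^2\<close> fits into
      \<open>3 * ((n + 1)^2 - n^2) * h^2\<close>.\<close>
    also have "\<dots> \<le> (n + 1) * h + 3 * ((n + 1) * h)\<^sup>2"
      using h n0 by (simp add: power2_eq_square algebra_simps)
    finally show ?thesis using 1 2 by blast
  qed
  have eq: "(\<Sum>j\<in>insert i I. X j \<omega>) = X i \<omega> + S \<omega>" "real (card (insert i I)) = n + 1" for \<omega>
    using insert.hyps by (auto simp: S_def n_def)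
  {
    case 1 show ?case unfolding eq using main[OF 1] by blast
  next
    case 2 show ?case unfolding eq using main[OF 2] by blast
  next
    case 3 show ?case unfolding eq using main[OF 3] by blast
  }
qed

end

section \<open>Chaining\<close>

text \<open>
  Chaining along the binary expansion: a grid point of level \<open>l\<close> is reached from its ancestor of
  level \<open>q\<close> by at most one increment on each of the levels in between.
\<close>

lemma dyadic_chain:
  fixes x :: "real \<Rightarrow> real"
  assumes ql: "q \<le> l" and i: "i \<le> 2 ^ l"
  shows "\<bar>x (real i / 2 ^ l) - x (real (i div 2 ^ (l - q)) / 2 ^ q)\<bar> \<le>
    (\<Sum>a\<in>{q<..l}. Max ((\<lambda>j. \<bar>x (real (Suc j) / 2 ^ a) - x (real j / 2 ^ a)\<bar>) ` {..<2 ^ a}))"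
  using assms
proof (induction l arbitrary: i rule: dec_induct)
  case base
  then show ?case by simp
next
  case (step l)
  let ?m = "\<lambda>a. Max ((\<lambda>j. \<bar>x (real (Suc j) / 2 ^ a) - x (real j / 2 ^ a)\<bar>) ` {..<2 ^ a})"
  have i2: "i div 2 \<le> 2 ^ l" using step.prems by auto
  have par: "real (i div 2) / 2 ^ l = real (2 * (i div 2)) / 2 ^ Suc l" by simp
  have d: "i div 2 ^ (Suc l - q) = (i div 2) div 2 ^ (l - q)"
    using step.hyps by (simp add: Suc_diff_le div_mult2_eq)
  have "\<bar>x (real i / 2 ^ Suc l) - x (real (i div 2) / 2 ^ l)\<bar> \<le> ?m (Suc l)"
  proof (cases "even i")
    case True
    then have "\<bar>x (real i / 2 ^ Suc l) - x (real (i div 2) / 2 ^ l)\<bar> = 0" unfolding par by simp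
    also have "0 \<le> \<bar>x (real (Suc 0) / 2 ^ Suc l) - x (real 0 / 2 ^ Suc l)\<bar>" by simp
    also have "\<dots> \<le> ?m (Suc l)" by (rule Max_ge[OF _ imageI]) auto
    finally show ?thesis .
  next
    case False
    then obtain j where j: "i = Suc (2 * j)" by (elim oddE) simp
    have "\<bar>x (real i / 2 ^ Suc l) - x (real (i div 2) / 2 ^ l)\<bar> = \<bar>x (real (Suc (2 * j)) / 2 ^ Suc l) - x (real (2 * j) / 2 ^ Suc l)\<bar>"
      unfolding par using j by simp
    also have "\<dots> \<le> ?m (Suc l)" using step.prems j by (intro Max_ge[OF _ imageI]) auto
    finally show ?thesis .
  qed
  moreover have "\<bar>x (real (i div 2) / 2 ^ l) - x (real (i div 2 div 2 ^ (l - q)) / 2 ^ q)\<bar> \<le> (\<Sum>a\<in>{q<..l}. ?m a)"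
    using step.IH[OF i2] .
  moreover have "(\<Sum>a\<in>{q<..Suc l}. ?m a) = ?m (Suc l) + (\<Sum>a\<in>{q<..l}. ?m a)"
  proof -
    have "{q<..Suc l} = insert (Suc l) {q<..l}" using step.hyps by auto
    then show ?thesis by simp
  qed
  ultimately show ?case unfolding d by linarith
qed

section \<open>Characteristic functions\<close>

definition uniform01 :: "real measure" where
  "uniform01 = uniform_measure lborel {0..1}"

interpretation uniform01: prob_space uniform01
  unfolding uniform01_def by (rule prob_space_uniform_measure) auto

lemma sets_uniform01 [simp, measurable_cong]: "sets uniform01 = sets borel"
  by (simp add: uniform01_def)

lemma space_uniform01 [simp]: "space uniform01 = UNIV"
  by (simp add: uniform01_def)

lemma measure_uniform01_atMost:
  assumes "s \<in> {0..1}"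
  shows "measure uniform01 {..s} = s"
proof -
  have "{0..1} \<inter> {..s} = {0..s}" using assms by auto
  then show ?thesis
    unfolding uniform01_def using assms by (subst measure_uniform_measure) auto
qed

lemma integrable_uniform01_bounded:
  fixes f :: "real \<Rightarrow> real"
  assumes "f \<in> borel_measurable borel" "\<And>x. \<bar>f x\<bar> \<le> B"
  shows "integrable uniform01 f"
proof -
  show ?thesis using assms by (intro uniform01.integrable_const_bound[where B = B]) auto
qed

definition centered_ind :: "real \<Rightarrow> real \<Rightarrow> real" where
  "centered_ind s r = indicator {..s} r - s"

lemma centered_ind_measurable [measurable]: "centered_ind s \<in> borel_measurable borel"
  unfolding centered_ind_def by measurable

lemma centered_ind_abs_le: "s \<in> {0..1} \<Longrightarrow> \<bar>centered_ind s r\<bar> \<le> 1"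
  by (auto simp: centered_ind_def indicator_def)

lemma integral_indicator_uniform01:
  "s \<in> {0..1} \<Longrightarrow> (\<integral>r. indicator {..s} r \<partial>uniform01) = s"
  by (simp add: measure_uniform01_atMost)

lemma integral_centered_ind:
  assumes "s \<in> {0..1}"
  shows "(\<integral>r. centered_ind s r \<partial>uniform01) = 0"
proof -
  have "integrable uniform01 (indicator {..s} :: real \<Rightarrow> real)"
    by (auto simp: uniform01.emeasure_eq_measure)
  then show ?thesis
    unfolding centered_ind_def using assms uniform01.prob_space
    by (simp add: measure_uniform01_atMost)
qed

text \<open>This is the covariance of the Brownian bridge; \<open>W_cov\<close> is assembled from
  two copies of it.\<close>

lemma integral_centered_ind_mult:
  assumes s: "s \<in> {0..1}" and s': "s' \<in> {0..1}"
  shows "(\<integral>r. centered_ind s r * centered_ind s' r \<partial>uniform01) = min s s' - s * s'"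
proof -
  have "centered_ind s r * centered_ind s' r =
      indicator {..min s s'} r - s' * indicator {..s} r - s * indicator {..s'} r + s * s'" for r
    by (auto simp: centered_ind_def indicator_def algebra_simps)
  moreover have "integrable uniform01 (indicator {..t} :: real \<Rightarrow> real)" for t
    by (auto simp: uniform01.emeasure_eq_measure)
  moreover have "min s s' \<in> {0..1}" using s s' by auto
  ultimately show ?thesis
    using s s' uniform01.prob_space by (simp add: measure_uniform01_atMost)
qed

text \<open>The central limit theorem for bounded centered summands at the level of characteristic
  functions. It is stated for powers of a single integral because the samples live on a probability
  space that changes with \<open>n\<close>. The third order Taylor error is at most
  \<open>B ^ 3 / (6 * n * sqrt n)\<close>, and passing to the \<open>n\<close>-th power multiplies
  it by at most \<open>n\<close>.\<close>

lemma char_power_tendsto: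
  fixes f :: "'a \<Rightarrow> real"
  assumes M: "prob_space M" and f: "f \<in> borel_measurable M" "\<And>x. x \<in> space M \<Longrightarrow> \<bar>f x\<bar> \<le> B"
    and mean: "(\<integral>x. f x \<partial>M) = 0"
  shows "(\<lambda>n. (CLINT x|M. iexp (f x / sqrt (real n))) ^ n) \<longlonglongrightarrow>
    complex_of_real (exp (- (\<integral>x. (f x)\<^sup>2 \<partial>M) / 2))"
proof -
  interpret prob_space M by fact
  note f(1)[measurable]
  define v where "v = (\<integral>x. (f x)\<^sup>2 \<partial>M)"
  have v0: "0 \<le> v" unfolding v_def by simp
  obtain x0 where "x0 \<in> space M" using not_empty by blast
  then have B0: "0 \<le> B" using f(2)[of x0] by linarith
  have pw: "\<bar>f x\<bar> ^ k \<le> B ^ k" if "x \<in> space M" for x k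
    using f(2)[OF that] by (intro power_mono) auto
  have int: "integrable M f" "integrable M (\<lambda>x. (f x)\<^sup>2)" "integrable M (\<lambda>x. \<bar>f x\<bar> ^ 3)"
  proof -
    show "integrable M f" using f(2) by (intro integrable_const_bound[where B = B]) auto
    show "integrable M (\<lambda>x. (f x)\<^sup>2)"
      using pw[of _ 2] by (intro integrable_const_bound[where B = "B\<^sup>2"]) auto
    show "integrable M (\<lambda>x. \<bar>f x\<bar> ^ 3)"
      using pw[of _ 3] by (intro integrable_const_bound[where B = "B ^ 3"]) auto
  qed
  define z where "z n = (CLINT x|M. iexp (f x / sqrt (real n)))" for n
  have main: "\<forall>\<^sub>F n in sequentially. cmod (z n ^ n - (1 + (- v / 2) / n) ^ n) \<le> B ^ 3 / (6 * sqrt n)"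
  proof (rule eventually_sequentiallyI)
    \<comment> \<open>The condition \<open>v \<le> n\<close> keeps \<open>1 - v / (2 * n)\<close> in
      the unit disc, as the comparison of \<open>n\<close>-th powers requires.\<close>
    fix n :: nat assume "n \<ge> max 1 (nat \<lceil>v\<rceil>)"
    then have n: "1 \<le> n" "v \<le> n" by linarith+
    have char: "char (distr M borel f) (1 / sqrt n) = z n"
      unfolding char_def z_def by (subst integral_distr) (auto simp: mult.commute)
    have "cmod (z n - (1 - (1 / sqrt n)\<^sup>2 * v / 2)) \<le>
        (1 / sqrt n)\<^sup>2 / 6 * expectation (\<lambda>x. min (6 * (f x)\<^sup>2) (\<bar>1 / sqrt n\<bar> * \<bar>f x\<bar> ^ 3))"
      unfolding char[symmetric] using int mean
      by (intro char_approx3') (auto simp: v_def)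
    also have "\<dots> \<le> (1 / sqrt n)\<^sup>2 / 6 * expectation (\<lambda>x. 1 / sqrt n * B ^ 3)"
      using pw[of _ 3] by (intro mult_left_mono integral_mono integrable_min) (auto simp: int intro!: min.coboundedI2 divide_right_mono)
    also have "\<dots> = B ^ 3 / (6 * n * sqrt n)" using n by (simp add: prob_space power_divide)
    also have "(1 - (1 / sqrt n)\<^sup>2 * v / 2 :: complex) = complex_of_real (1 + (- v / 2) / n)"
      using n by (simp add: power_divide field_simps flip: of_real_power)
    finally have d: "cmod (z n - complex_of_real (1 + (- v / 2) / n)) \<le> B ^ 3 / (6 * n * sqrt n)" .
    have "cmod (z n) \<le> 1"
    proof -
      interpret D: real_distribution "distr M borel f" by (rule real_distribution_distr) simp
      show ?thesis unfolding char[symmetric] by (rule D.cmod_char_le_1)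
    qed
    moreover have "cmod (complex_of_real (1 + (- v / 2) / n)) \<le> 1"
      using n v0 by (simp only: norm_of_real) (simp add: abs_le_iff field_simps)
    ultimately have "cmod (z n ^ n - complex_of_real (1 + (- v / 2) / n) ^ n) \<le>
        n * cmod (z n - complex_of_real (1 + (- v / 2) / n))"
      by (rule norm_power_diff)
    also have "\<dots> \<le> n * (B ^ 3 / (6 * n * sqrt n))" by (intro mult_left_mono d) auto
    also have "\<dots> = B ^ 3 / (6 * sqrt n)" using n by simp
    finally show "cmod (z n ^ n - (1 + (- v / 2) / n) ^ n) \<le> B ^ 3 / (6 * sqrt n)" by simp
  qed
  have "(\<lambda>n::nat. B ^ 3 / (6 * sqrt n)) \<longlonglongrightarrow> 0" by real_asymp
  with main have d0: "(\<lambda>n. z n ^ n - complex_of_real ((1 + (- v / 2) / n) ^ n)) \<longlonglongrightarrow> 0"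
    by (rule Lim_null_comparison)
  have "(\<lambda>n. complex_of_real ((1 + (- v / 2) / n) ^ n)) \<longlonglongrightarrow> complex_of_real (exp (- v / 2))"
    by (intro tendsto_of_real tendsto_exp_limit_sequentially)
  then have "(\<lambda>n. z n ^ n) \<longlonglongrightarrow> complex_of_real (exp (- v / 2))"
    by (rule Lim_transform) (rule d0)
  then show ?thesis by (simp add: z_def v_def)
qed

text \<open>\<open>gaussian_rv\<close> gives the law only up to its two parameters. The vanishing
  mean removes one of them and the second moment identifies the other; the point mass is a separate
  case.\<close>

lemma char_centered_gaussian:
  assumes N: "prob_space N" and X: "gaussian_rv N X" and mean: "(\<integral>\<omega>. X \<omega> \<partial>N) = 0"
  shows "integrable N (\<lambda>\<omega>. (X \<omega>)\<^sup>2)"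
    and "(CLINT \<omega>|N. iexp (X \<omega>)) = complex_of_real (exp (- (\<integral>\<omega>. (X \<omega>)\<^sup>2 \<partial>N) / 2))"
proof -
  interpret prob_space N by fact
  obtain m \<sigma> where [measurable]: "X \<in> borel_measurable N" and \<sigma>: "0 \<le> \<sigma>" and
    D: "distr N borel X = (if \<sigma> = 0 then return borel m else density lborel (normal_density m \<sigma>))"
    using X unfolding gaussian_rv_def by blast
  have "integrable N (\<lambda>\<omega>. (X \<omega>)\<^sup>2) \<and>
    (CLINT \<omega>|N. iexp (X \<omega>)) = complex_of_real (exp (- (\<integral>\<omega>. (X \<omega>)\<^sup>2 \<partial>N) / 2))"
  proof (cases "\<sigma> = 0")
    case True
    then have D: "distr N borel X = return borel m" using D by simp
    have "AE x in distr N borel X. x = m" unfolding D by (subst AE_return) auto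
    then have ae: "AE \<omega> in N. X \<omega> = m" by (subst (asm) AE_distr_iff) auto
    have "(\<integral>\<omega>. X \<omega> \<partial>N) = (\<integral>\<omega>. m \<partial>N)" by (rule integral_cong_AE) (use ae in auto)
    then have "m = 0" using mean by (simp add: prob_space)
    then have ae: "AE \<omega> in N. X \<omega> = 0" using ae by simp
    have "integrable N (\<lambda>\<omega>. (X \<omega>)\<^sup>2) \<longleftrightarrow> integrable N (\<lambda>\<omega>. 0 :: real)"
      by (rule integrable_cong_AE) (use ae in auto)
    moreover have "(\<integral>\<omega>. (X \<omega>)\<^sup>2 \<partial>N) = (\<integral>\<omega>. 0 \<partial>N)"
      by (rule integral_cong_AE) (use ae in auto)
    moreover have "(CLINT \<omega>|N. iexp (X \<omega>)) = (CLINT \<omega>|N. 1)"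
      by (rule integral_cong_AE) (use ae in auto)
    ultimately show ?thesis by (simp add: prob_space)
  next
    case False
    then have \<sigma>: "0 < \<sigma>" using \<sigma> by simp
    have dist: "distributed N lborel X (normal_density m \<sigma>)"
      unfolding distributed_def using D False by (auto cong: distr_cong)
    have "m = 0" using normal_distributed_expectation[OF \<sigma> dist] mean by simp
    with dist have dist: "distributed N lborel X (normal_density 0 \<sigma>)" by simp
    have var: "(\<integral>\<omega>. (X \<omega>)\<^sup>2 \<partial>N) = \<sigma>\<^sup>2"
      using normal_distributed_variance[OF \<sigma> dist] mean by simp
    \<comment> \<open>A non-integrable function would have integral 0, whereas the value here is
      \<open>\<sigma>^2 > 0\<close>.\<close>
    then have int: "integrable N (\<lambda>\<omega>. (X \<omega>)\<^sup>2)"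
      using \<sigma> not_integrable_integral_eq by fastforce
    have "distributed N lborel (\<lambda>\<omega>. X \<omega> / \<sigma>) std_normal_density"
      using dist \<sigma> normal_standard_normal_convert[OF \<sigma>, of X 0] by simp
    then have std: "distr N borel (\<lambda>\<omega>. X \<omega> / \<sigma>) = std_normal_distribution"
      unfolding distributed_def by (auto cong: distr_cong)
    have "(CLINT \<omega>|N. iexp (X \<omega>)) = (CLINT \<omega>|N. iexp (\<sigma> * (X \<omega> / \<sigma>)))" using \<sigma> by simp
    also have "\<dots> = char (distr N borel (\<lambda>\<omega>. X \<omega> / \<sigma>)) \<sigma>"
      unfolding char_def by (subst integral_distr) auto
    also have "\<dots> = complex_of_real (exp (- \<sigma>\<^sup>2 / 2))"
      unfolding std char_std_normal_distribution by simp
    finally show ?thesis using int var by simp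
  qed
  then show "integrable N (\<lambda>\<omega>. (X \<omega>)\<^sup>2)"
    "(CLINT \<omega>|N. iexp (X \<omega>)) = complex_of_real (exp (- (\<integral>\<omega>. (X \<omega>)\<^sup>2 \<partial>N) / 2))" by auto
qed

lemma integral_cos_shift:
  fixes X :: "'a \<Rightarrow> real"
  assumes M: "prob_space M" and [measurable]: "X \<in> borel_measurable M"
  shows "(\<integral>\<omega>. cos (b + X \<omega>) \<partial>M) = Re (iexp b * (CLINT \<omega>|M. iexp (X \<omega>)))"
proof -
  interpret prob_space M by fact
  have "Re (iexp b * (CLINT \<omega>|M. iexp (X \<omega>))) = Re (CLINT \<omega>|M. iexp (b + X \<omega>))"
    by (simp add: distrib_left exp_add)
  also have "\<dots> = (\<integral>\<omega>. Re (iexp (b + X \<omega>)) \<partial>M)"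
    by (subst integral_Re) (auto intro!: integrable_iexp)
  finally show ?thesis by (simp add: Re_exp)
qed

section \<open>Dyadic chaining and the comparison of a path with its coarse step path\<close>

lemma dyadic_chain_le:
  fixes x :: "real \<Rightarrow> real"
  assumes ql: "q \<le> l" and i: "i \<le> 2 ^ l"
    and c: "\<And>a j. q < a \<Longrightarrow> a \<le> l \<Longrightarrow> j < 2 ^ a \<Longrightarrow> \<bar>x (real (Suc j) / 2 ^ a) - x (real j / 2 ^ a)\<bar> \<le> c a"
  shows "\<bar>x (real i / 2 ^ l) - x (dyadic_floor q (real i / 2 ^ l))\<bar> \<le> (\<Sum>a\<in>{q<..l}. c a)"
proof -
  \<comment> \<open>The ancestor of level \<open>q\<close> in \<open>dyadic_chain\<close> is the
    rounding down of the grid point to that level.\<close>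
  have "2 ^ q * (real i / 2 ^ l) = real i / real (2 ^ (l - q))"
    using power_add[of "2::real" q "l - q"] ql by simp
  then have "dyadic_floor q (real i / 2 ^ l) = real (i div 2 ^ (l - q)) / 2 ^ q"
    unfolding dyadic_floor_def by (simp only: floor_divide_of_nat_eq of_int_of_nat_eq)
  then have "\<bar>x (real i / 2 ^ l) - x (dyadic_floor q (real i / 2 ^ l))\<bar> \<le>
    (\<Sum>a\<in>{q<..l}. Max ((\<lambda>j. \<bar>x (real (Suc j) / 2 ^ a) - x (real j / 2 ^ a)\<bar>) ` {..<2 ^ a}))"
    using dyadic_chain[OF ql i, of x] by simp
  also have "\<dots> \<le> (\<Sum>a\<in>{q<..l}. c a)"
  proof (intro sum_mono Max.boundedI)
    show "(\<lambda>j. \<bar>x (real (Suc j) / 2 ^ a) - x (real j / 2 ^ a)\<bar>) ` {..<2 ^ a} \<noteq> {}" for a :: nat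
      by (auto simp: lessThan_empty_iff)
  qed (use c in auto)
  finally show ?thesis .
qed

lemma dyadic_floor_nested:
  assumes "q \<le> l"
  shows "dyadic_floor q (dyadic_floor l s) = dyadic_floor q s"
proof -
  have p: "(2::real) ^ l = 2 ^ q * 2 ^ (l - q)" using assms by (simp flip: power_add)
  have "\<lfloor>2 ^ q * (of_int \<lfloor>2 ^ l * s\<rfloor> / 2 ^ l) :: real\<rfloor> = \<lfloor>of_int \<lfloor>2 ^ l * s\<rfloor> / of_int (2 ^ (l - q)) :: real\<rfloor>"
    by (simp add: p)
  also have "\<dots> = \<lfloor>2 ^ l * s\<rfloor> div 2 ^ (l - q)" by (rule floor_divide_of_int_eq)
  also have "\<dots> = \<lfloor>2 ^ l * s / of_int (2 ^ (l - q))\<rfloor>" by (rule floor_divide_real_eq_div[symmetric]) simp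
  also have "2 ^ l * s / of_int (2 ^ (l - q)) = 2 ^ q * s" by (simp add: p)
  finally show ?thesis by (simp add: dyadic_floor_def)
qed

lemma dyadic_ceil_cases:
  assumes s: "s \<in> {0..1}"
  obtains "dyadic_ceil l s = dyadic_floor l s"
  | j where "j < 2 ^ l" "dyadic_floor l s = real j / 2 ^ l" "dyadic_ceil l s = real (Suc j) / 2 ^ l"
proof (cases "2 ^ l * s \<in> \<int>")
  case True
  then have "dyadic_ceil l s = dyadic_floor l s"
    unfolding dyadic_ceil_def dyadic_floor_def by (elim Ints_cases) simp
  then show thesis by (rule that(1))
next
  case False
  then have c: "\<lceil>2 ^ l * s\<rceil> = \<lfloor>2 ^ l * s\<rfloor> + 1" by (metis Ints_of_int ceiling_altdef)
  obtain j where j: "j \<le> 2 ^ l" "dyadic_floor l s = real j / 2 ^ l" by (rule dyadic_floor_eq[OF s])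
  have ceil: "dyadic_ceil l s = real (Suc j) / 2 ^ l"
  proof -
    have "of_int \<lfloor>2 ^ l * s\<rfloor> = real j" using j(2) by (simp add: dyadic_floor_def)
    then show ?thesis by (simp add: dyadic_ceil_def c)
  qed
  have "j \<noteq> 2 ^ l"
  proof
    assume "j = 2 ^ l"
    then have "1 \<le> s" using dyadic_floor_bounds(1)[of l s] j(2) by simp
    then have "s = 1" using s by simp
    then show False using False by simp
  qed
  then show thesis using that(2) j ceil by simp
qed

lemma dyadic_points_eq:
  assumes s: "s \<in> {0..1}" and u: "u \<in> {dyadic_floor l s, dyadic_ceil l s}"
  obtains i where "i \<le> 2 ^ l" "u = real i / 2 ^ l"
proof -
  obtain j where j: "j \<le> 2 ^ l" "dyadic_floor l s = real j / 2 ^ l" by (rule dyadic_floor_eq[OF s])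
  show thesis
  proof (cases "u = dyadic_floor l s")
    case True
    then show ?thesis using that[OF j(1)] j(2) by simp
  next
    case False
    then have u: "u = dyadic_ceil l s" using u by simp
    show ?thesis
    proof (rule dyadic_ceil_cases[OF s, of l])
      assume "dyadic_ceil l s = dyadic_floor l s"
      then show thesis using u False by simp
    next
      fix i assume "i < 2 ^ l" "dyadic_ceil l s = real (Suc i) / 2 ^ l"
      then show thesis using that[of "Suc i"] u by simp
    qed
  qed
qed

text \<open>The lower fine neighbour of \<open>s\<close> has the same coarse ancestor as
  \<open>s\<close>, so the chain applies to it; the upper neighbour costs one more increment of
  level \<open>l\<close>. Hence the factor 2.\<close>

lemma dyadic_modulus:
  fixes x :: "real \<Rightarrow> real"
  assumes ql: "q \<le> l" and e: "0 \<le> e"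
    and chain: "\<And>i. i \<le> 2 ^ l \<Longrightarrow> \<bar>x (real i / 2 ^ l) - x (dyadic_floor q (real i / 2 ^ l))\<bar> \<le> e"
    and inc: "\<And>j. j < 2 ^ l \<Longrightarrow> \<bar>x (real (Suc j) / 2 ^ l) - x (real j / 2 ^ l)\<bar> \<le> e"
    and s: "s \<in> {0..1}" and u: "u \<in> {dyadic_floor l s, dyadic_ceil l s}"
  shows "\<bar>x u - x (dyadic_floor q s)\<bar> \<le> 2 * e"
proof -
  obtain i where i: "i \<le> 2 ^ l" "dyadic_floor l s = real i / 2 ^ l" by (rule dyadic_floor_eq[OF s])
  have fl: "\<bar>x (dyadic_floor l s) - x (dyadic_floor q s)\<bar> \<le> e"
    using chain[OF i(1)] dyadic_floor_nested[OF ql, of s] i(2) by simp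
  have "\<bar>x (dyadic_ceil l s) - x (dyadic_floor l s)\<bar> \<le> e"
    using inc e by (cases rule: dyadic_ceil_cases[OF s, of l]) auto
  then show ?thesis using u fl e by auto
qed

lemma additive_part_close:
  fixes r :: "real \<Rightarrow> real"
  assumes v: "0 \<le> v" "v \<le> 1" and tv: "\<bar>v - t\<bar> \<le> 2 * (1/2) ^ q"
    and near: "\<bar>r u - r s\<bar> \<le> 2 * e" and K: "\<bar>r s\<bar> \<le> K"
  shows "\<bar>v * r u - t * r s\<bar> \<le> 2 * e + 2 * K * (1/2) ^ q"
proof -
  have "\<bar>v * r u - t * r s\<bar> = \<bar>v * (r u - r s) + (v - t) * r s\<bar>" by (simp add: algebra_simps)
  also have "\<dots> \<le> \<bar>v\<bar> * \<bar>r u - r s\<bar> + \<bar>v - t\<bar> * \<bar>r s\<bar>" by (metis abs_mult abs_triangle_ineq)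
  also have "\<dots> \<le> 1 * (2 * e) + (2 * (1/2) ^ q) * K"
    using assms by (intro add_mono mult_mono) auto
  finally show ?thesis by (simp add: mult_ac)
qed

text \<open>
  \<open>X + w s t\<close> is monotone, so \<open>X\<close> is controlled by its values at the corners of the fine grid cell
  (level \<open>l\<close>) around the point; these are compared with the additive part on the coarse grid
  (level \<open>q\<close>).
\<close>

lemma decomposition_close:
  fixes X z :: "real \<Rightarrow> real \<Rightarrow> real" and r c :: "real \<Rightarrow> real"
  assumes ql: "q \<le> l" and w: "0 \<le> w"
    and dec: "\<And>s t. s \<in> {0..1} \<Longrightarrow> t \<in> {0..1} \<Longrightarrow> X s t = t * r s + s * c t + z s t"
    and mono: "\<And>s t s' t'. s \<in> {0..1} \<Longrightarrow> t \<in> {0..1} \<Longrightarrow> s' \<in> {0..1} \<Longrightarrow> t' \<in> {0..1} \<Longrightarrow>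
      s \<le> s' \<Longrightarrow> t \<le> t' \<Longrightarrow> X s t + w * (s * t) \<le> X s' t' + w * (s' * t')"
    and r: "\<And>s u. s \<in> {0..1} \<Longrightarrow> u \<in> {dyadic_floor l s, dyadic_ceil l s} \<Longrightarrow> \<bar>r u - r (dyadic_floor q s)\<bar> \<le> 2 * e"
    and c: "\<And>s u. s \<in> {0..1} \<Longrightarrow> u \<in> {dyadic_floor l s, dyadic_ceil l s} \<Longrightarrow> \<bar>c u - c (dyadic_floor q s)\<bar> \<le> 2 * e"
    and Kr: "\<And>s. s \<in> {0..1} \<Longrightarrow> \<bar>r (dyadic_floor q s)\<bar> \<le> K"
    and Kc: "\<And>s. s \<in> {0..1} \<Longrightarrow> \<bar>c (dyadic_floor q s)\<bar> \<le> K"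
    and z: "\<And>i j. i \<le> 2 ^ l \<Longrightarrow> j \<le> 2 ^ l \<Longrightarrow> \<bar>z (real i / 2 ^ l) (real j / 2 ^ l)\<bar> \<le> \<delta>"
    and s: "s \<in> {0..1}" and t: "t \<in> {0..1}"
  shows "\<bar>X s t - (dyadic_floor q t * r (dyadic_floor q s) + dyadic_floor q s * c (dyadic_floor q t))\<bar>
    \<le> 4 * e + 4 * K * (1/2) ^ q + \<delta> + 2 * w * (1/2) ^ l"
proof -
  let ?L = "dyadic_floor q t * r (dyadic_floor q s) + dyadic_floor q s * c (dyadic_floor q t)"
  have pt: "u \<in> {0..1}" "\<bar>u - dyadic_floor q s\<bar> \<le> 2 * (1/2) ^ q" "\<bar>u - s\<bar> \<le> (1/2) ^ l"
    if u': "u \<in> {dyadic_floor l s, dyadic_ceil l s}" and s': "s \<in> {0..1}" for u s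
  proof -
    obtain i where i: "i \<le> 2 ^ l" "u = real i / 2 ^ l"
      by (rule dyadic_points_eq[OF s' u'])
    then show "u \<in> {0..1}" using dyadic_point_in_unit by simp
    show us: "\<bar>u - s\<bar> \<le> (1/2) ^ l"
      using u' dyadic_floor_bounds(1)[of l s] dyadic_floor_bounds(2)[of s l]
        dyadic_ceil_bounds(1)[where k = l and x = s] dyadic_ceil_bounds(2)[where k = l and x = s]
      by (auto simp: abs_le_iff)
    have "(1/2) ^ l \<le> ((1/2) ^ q :: real)" using ql by (intro power_decreasing) auto
    moreover have "0 \<le> ((1/2) ^ q :: real)" by simp
    ultimately show "\<bar>u - dyadic_floor q s\<bar> \<le> 2 * (1/2) ^ q"
      using us dyadic_floor_bounds(1)[of q s] dyadic_floor_bounds(2)[of s q]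
      unfolding abs_le_iff by linarith
  qed
  have corner: "\<bar>X u v - ?L\<bar> \<le> 4 * e + 4 * K * (1/2) ^ q + \<delta>"
    if u: "u \<in> {dyadic_floor l s, dyadic_ceil l s}" and v: "v \<in> {dyadic_floor l t, dyadic_ceil l t}" for u v
  proof -
    obtain i where i: "i \<le> 2 ^ l" "u = real i / 2 ^ l" by (rule dyadic_points_eq[OF s u])
    obtain j where j: "j \<le> 2 ^ l" "v = real j / 2 ^ l" by (rule dyadic_points_eq[OF t v])
    have "\<bar>z u v\<bar> \<le> \<delta>" using z i j by simp
    moreover have "\<bar>v * r u - dyadic_floor q t * r (dyadic_floor q s)\<bar> \<le> 2 * e + 2 * K * (1/2) ^ q"
      using pt[OF v t] r[OF s u] Kr[OF s] by (intro additive_part_close) auto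
    moreover have "\<bar>u * c v - dyadic_floor q s * c (dyadic_floor q t)\<bar> \<le> 2 * e + 2 * K * (1/2) ^ q"
      using pt[OF u s] c[OF t v] Kc[OF t] by (intro additive_part_close) auto
    moreover have "X u v = v * r u + u * c v + z u v" using pt[OF u s] pt[OF v t] by (intro dec)
    ultimately show ?thesis by linarith
  qed
  \<comment> \<open>The price of returning from the monotone function \<open>X + w * s * t\<close>
    to \<open>X\<close>: across a fine cell the added term changes by at most
    \<open>2 * w * (1/2) ^ l\<close>.\<close>
  have area: "\<bar>u * v - s * t\<bar> \<le> 2 * (1/2) ^ l"
    if u: "u \<in> {dyadic_floor l s, dyadic_ceil l s}" and v: "v \<in> {dyadic_floor l t, dyadic_ceil l t}" for u v
  proof -
    have "\<bar>u * v - s * t\<bar> = \<bar>(u - s) * v + s * (v - t)\<bar>" by (simp add: algebra_simps)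
    also have "\<dots> \<le> \<bar>u - s\<bar> * \<bar>v\<bar> + \<bar>s\<bar> * \<bar>v - t\<bar>" by (metis abs_mult abs_triangle_ineq)
    also have "\<dots> \<le> (1/2) ^ l * 1 + 1 * (1/2) ^ l"
      using pt[OF u s] pt[OF v t] s by (intro add_mono mult_mono) auto
    finally show ?thesis by simp
  qed
  have fs: "dyadic_floor l s \<in> {dyadic_floor l s, dyadic_ceil l s}" "dyadic_ceil l s \<in> {dyadic_floor l s, dyadic_ceil l s}"
    and ft: "dyadic_floor l t \<in> {dyadic_floor l t, dyadic_ceil l t}" "dyadic_ceil l t \<in> {dyadic_floor l t, dyadic_ceil l t}"
    by auto
  have "X s t + w * (s * t) \<le> X (dyadic_ceil l s) (dyadic_ceil l t) + w * (dyadic_ceil l s * dyadic_ceil l t)"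
    using s t pt(1)[OF fs(2) s] pt(1)[OF ft(2) t] dyadic_ceil_bounds(1) by (intro mono) auto
  moreover have "w * \<bar>dyadic_ceil l s * dyadic_ceil l t - s * t\<bar> \<le> w * (2 * (1/2) ^ l)"
    by (intro mult_left_mono area fs ft w)
  moreover have "w * (dyadic_ceil l s * dyadic_ceil l t) - w * (s * t) \<le> w * \<bar>dyadic_ceil l s * dyadic_ceil l t - s * t\<bar>"
    using w by (simp flip: right_diff_distrib add: mult_left_mono)
  moreover have "X (dyadic_floor l s) (dyadic_floor l t) + w * (dyadic_floor l s * dyadic_floor l t) \<le> X s t + w * (s * t)"
    using s t pt(1)[OF fs(1) s] pt(1)[OF ft(1) t] dyadic_floor_bounds(1) by (intro mono) auto
  moreover have "w * \<bar>dyadic_floor l s * dyadic_floor l t - s * t\<bar> \<le> w * (2 * (1/2) ^ l)"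
    by (intro mult_left_mono area fs ft w)
  moreover have "w * (s * t) - w * (dyadic_floor l s * dyadic_floor l t) \<le> w * \<bar>dyadic_floor l s * dyadic_floor l t - s * t\<bar>"
    using w by (simp flip: right_diff_distrib add: mult_left_mono abs_minus_commute)
  ultimately show ?thesis
    using corner[OF fs(1) ft(1)] corner[OF fs(2) ft(2)] by (simp add: abs_le_iff mult_ac)
qed

text \<open>Telescoping of \<open>1 / a^2 \<le> 1 / (a - 1) - 1 / a\<close>. It shows that
  thresholds \<open>e / a^2\<close> on the levels \<open>a > q\<close> add up to at most
  \<open>e\<close>.\<close>

lemma sum_inverse_squares_le:
  assumes "1 \<le> q" "q \<le> l"
  shows "(\<Sum>a\<in>{q<..l}. 1 / (real a)\<^sup>2) \<le> 1 / real q - 1 / real l"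
  using assms(2)
proof (induction l rule: dec_induct)
  case base
  then show ?case by simp
next
  case (step l)
  have l: "0 < real l" using step assms by simp
  have "{q<..Suc l} = insert (Suc l) {q<..l}" using step.hyps by auto
  then have "(\<Sum>a\<in>{q<..Suc l}. 1 / (real a)\<^sup>2) = 1 / (real (Suc l))\<^sup>2 + (\<Sum>a\<in>{q<..l}. 1 / (real a)\<^sup>2)"
    by simp
  also have "1 / (real (Suc l))\<^sup>2 \<le> 1 / (real l * real (Suc l))"
    using l by (intro divide_left_mono) (auto simp: power2_eq_square)
  also have "\<dots> = 1 / real l - 1 / real (Suc l)" using l by (simp add: field_simps)
  finally show ?case using step.IH by simp
qed

text \<open>Markov's inequality for the even power \<open>k\<close> and a union bound, with
  thresholds that may vary with the index. The bound \<open>D\<close> enters through integrability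
  only and does not affect the estimate.\<close>

lemma (in prob_space) union_markov:
  fixes X :: "'i \<Rightarrow> 'a \<Rightarrow> real"
  assumes I: "finite I" and X: "\<And>i. i \<in> I \<Longrightarrow> X i \<in> borel_measurable M"
    and bound: "\<And>i \<omega>. i \<in> I \<Longrightarrow> \<omega> \<in> space M \<Longrightarrow> \<bar>X i \<omega>\<bar> \<le> D"
    and c: "\<And>i. i \<in> I \<Longrightarrow> 0 < c i" and k: "even k"
    and m: "\<And>i. i \<in> I \<Longrightarrow> expectation (\<lambda>\<omega>. X i \<omega> ^ k) \<le> m i"
  shows "{\<omega> \<in> space M. \<exists>i\<in>I. c i < \<bar>X i \<omega>\<bar>} \<in> events"
    and "prob {\<omega> \<in> space M. \<exists>i\<in>I. c i < \<bar>X i \<omega>\<bar>} \<le> (\<Sum>i\<in>I. m i / c i ^ k)"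
proof -
  note X[measurable]
  show "{\<omega> \<in> space M. \<exists>i\<in>I. c i < \<bar>X i \<omega>\<bar>} \<in> events" using I by measurable
  have "prob {\<omega> \<in> space M. \<exists>i\<in>I. c i < \<bar>X i \<omega>\<bar>} = prob (\<Union>i\<in>I. {\<omega> \<in> space M. c i < \<bar>X i \<omega>\<bar>})"
    by (rule arg_cong[where f = prob]) auto
  also have "\<dots> \<le> (\<Sum>i\<in>I. prob {\<omega> \<in> space M. c i < \<bar>X i \<omega>\<bar>})"
    using I by (intro finite_measure_subadditive_finite) auto
  also have "\<dots> \<le> (\<Sum>i\<in>I. m i / c i ^ k)"
  proof (rule sum_mono)
    fix i assume i: "i \<in> I"
    have int: "integrable M (\<lambda>\<omega>. X i \<omega> ^ k)"
      using i bound by (intro integrable_const_bound[where B = "D ^ k"])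
        (auto simp: power_abs intro!: AE_I2 power_mono)
    have "prob {\<omega> \<in> space M. c i < \<bar>X i \<omega>\<bar>} \<le> prob {\<omega> \<in> space M. c i ^ k \<le> X i \<omega> ^ k}"
    proof (rule finite_measure_mono)
      show "{\<omega> \<in> space M. c i < \<bar>X i \<omega>\<bar>} \<subseteq> {\<omega> \<in> space M. c i ^ k \<le> X i \<omega> ^ k}"
      proof safe
        fix \<omega> assume "c i < \<bar>X i \<omega>\<bar>"
        then have "c i ^ k \<le> \<bar>X i \<omega>\<bar> ^ k" using c[OF i] by (intro power_mono) auto
        then show "c i ^ k \<le> X i \<omega> ^ k" using k by (simp add: power_even_abs)
      qed
    qed (use i in measurable)
    also have "\<dots> \<le> expectation (\<lambda>\<omega>. X i \<omega> ^ k) / c i ^ k"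
      using int c[OF i] k
      by (intro integral_Markov_inequality_measure[where A = "space M" and u = "\<lambda>\<omega>. X i \<omega> ^ k"]) auto
    also have "\<dots> \<le> m i / c i ^ k" using m[OF i] c[OF i] by (intro divide_right_mono) auto
    finally show "prob {\<omega> \<in> space M. c i < \<bar>X i \<omega>\<bar>} \<le> m i / c i ^ k" .
  qed
  finally show "prob {\<omega> \<in> space M. \<exists>i\<in>I. c i < \<bar>X i \<omega>\<bar>} \<le> (\<Sum>i\<in>I. m i / c i ^ k)" .
qed

section \<open>The empirical process\<close>

lemma centered_ind_increment:
  assumes s: "s \<in> {0..1}" and s': "s' \<in> {0..1}" and le: "s \<le> s'"
  shows "\<bar>centered_ind s' r - centered_ind s r\<bar> \<le> 1"
    and "(\<integral>r. centered_ind s' r - centered_ind s r \<partial>uniform01) = 0"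
    and "(\<integral>r. (centered_ind s' r - centered_ind s r)\<^sup>2 \<partial>uniform01) \<le> s' - s"
proof -
  show "\<bar>centered_ind s' r - centered_ind s r\<bar> \<le> 1"
    using s s' le by (auto simp: centered_ind_def indicator_def)
  have int: "integrable uniform01 (centered_ind s)" "integrable uniform01 (centered_ind s')"
    by (auto intro!: integrable_uniform01_bounded[where B = 1] centered_ind_abs_le s s')
  show "(\<integral>r. centered_ind s' r - centered_ind s r \<partial>uniform01) = 0"
    using int integral_centered_ind s s' by simp
  have "(centered_ind s' r - centered_ind s r)\<^sup>2 = centered_ind s' r * centered_ind s' r
      - 2 * (centered_ind s r * centered_ind s' r) + centered_ind s r * centered_ind s r" for r
    by (simp add: power2_eq_square algebra_simps)
  moreover have "integrable uniform01 (\<lambda>r. centered_ind a r * centered_ind b r)" if "a \<in> {0..1}" "b \<in> {0..1}" for a b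
  proof (rule integrable_uniform01_bounded[where B = "1 * 1"])
    show "\<bar>centered_ind a x * centered_ind b x\<bar> \<le> 1 * 1" for x
      unfolding abs_mult using that by (intro mult_mono centered_ind_abs_le) auto
  qed measurable
  ultimately have "(\<integral>r. (centered_ind s' r - centered_ind s r)\<^sup>2 \<partial>uniform01) = (s' - s' * s') - 2 * (s - s * s') + (s - s * s)"
    using s s' le by (simp add: integral_centered_ind_mult)
  also have "\<dots> = (s' - s) - (s' - s)\<^sup>2" by (simp add: power2_eq_square algebra_simps)
  finally show "(\<integral>r. (centered_ind s' r - centered_ind s r)\<^sup>2 \<partial>uniform01) \<le> s' - s" by simp
qed

definition empirical :: "nat \<Rightarrow> (nat \<Rightarrow> 'w \<Rightarrow> real) \<Rightarrow> real \<Rightarrow> 'w \<Rightarrow> real" where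
  "empirical n Y s \<omega> = (\<Sum>i<n. centered_ind s (Y i \<omega>)) / sqrt (real n)"

locale uniform_sample = prob_space M for M :: "'w measure" +
  fixes n :: nat and Y :: "nat \<Rightarrow> 'w \<Rightarrow> real"
  assumes n: "1 \<le> n"
    and indep: "indep_vars (\<lambda>_. borel) Y {..<n}"
    and distr: "\<And>i. i < n \<Longrightarrow> distr M borel (Y i) = uniform01"
begin

lemma Y_measurable [measurable]: "i < n \<Longrightarrow> Y i \<in> borel_measurable M"
  using indep by (auto simp: indep_vars_def)

lemma expectation_Y:
  fixes f :: "real \<Rightarrow> real"
  assumes "i < n" "f \<in> borel_measurable borel"
  shows "expectation (\<lambda>\<omega>. f (Y i \<omega>)) = (\<integral>r. f r \<partial>uniform01)"
  using assms by (simp flip: distr add: integral_distr)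

lemma empirical_measurable [measurable]: "empirical n Y s \<in> borel_measurable M"
  unfolding empirical_def by measurable

lemma empirical_abs_le:
  assumes "s \<in> {0..1}"
  shows "\<bar>empirical n Y s \<omega>\<bar> \<le> sqrt (real n)"
proof -
  have "\<bar>\<Sum>i<n. centered_ind s (Y i \<omega>)\<bar> \<le> (\<Sum>i<n. 1)"
    using assms by (intro order_trans[OF sum_abs] sum_mono centered_ind_abs_le)
  then have "\<bar>empirical n Y s \<omega>\<bar> \<le> real n / sqrt (real n)"
    unfolding empirical_def by (simp add: abs_divide divide_right_mono)
  then show ?thesis using n by (simp add: real_div_sqrt)
qed

text \<open>The term \<open>3 * (s' - s)^2\<close> is the Gaussian one, good enough for chaining.
  The term \<open>(s' - s) / n\<close> comes from the fourth moments of single summands and is only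
  linear in the length of the increment.\<close>

lemma empirical_increment_moments:
  assumes s: "s \<in> {0..1}" and s': "s' \<in> {0..1}" and le: "s \<le> s'"
  shows "expectation (\<lambda>\<omega>. (empirical n Y s' \<omega> - empirical n Y s \<omega>)\<^sup>2) \<le> s' - s"
    and "expectation (\<lambda>\<omega>. (empirical n Y s' \<omega> - empirical n Y s \<omega>) ^ 4) \<le> 3 * (s' - s)\<^sup>2 + (s' - s) / n"
proof -
  define \<rho> where "\<rho> r = centered_ind s' r - centered_ind s r" for r
  have \<rho>_meas [measurable]: "\<rho> \<in> borel_measurable borel" unfolding \<rho>_def by measurable
  have \<rho>_abs: "\<bar>\<rho> r\<bar> \<le> 1" for r
    unfolding \<rho>_def using s s' le by (rule centered_ind_increment)
  have \<rho>0: "(\<integral>r. \<rho> r \<partial>uniform01) = 0" and \<rho>2: "(\<integral>r. (\<rho> r)\<^sup>2 \<partial>uniform01) \<le> s' - s"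
    unfolding \<rho>_def using centered_ind_increment[OF s s' le] by simp_all
  have eq: "empirical n Y s' \<omega> - empirical n Y s \<omega> = (\<Sum>i<n. \<rho> (Y i \<omega>)) / sqrt n" for \<omega>
    by (simp add: empirical_def \<rho>_def sum_subtractf diff_divide_distrib)
  have ind: "indep_vars (\<lambda>_. borel) (\<lambda>i \<omega>. \<rho> (Y i \<omega>)) {..<n}"
    by (rule indep_vars_compose2[OF indep]) auto
  have "expectation (\<lambda>\<omega>. (\<rho> (Y i \<omega>))\<^sup>2) \<le> s' - s" if "i < n" for i
    using \<rho>2 expectation_Y[OF that, of "\<lambda>r. (\<rho> r)\<^sup>2"] by simp
  then have mom: "expectation (\<lambda>\<omega>. (\<Sum>i<n. \<rho> (Y i \<omega>))\<^sup>2) \<le> n * (s' - s)"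
    "expectation (\<lambda>\<omega>. (\<Sum>i<n. \<rho> (Y i \<omega>)) ^ 4) \<le> n * (s' - s) + 3 * (n * (s' - s))\<^sup>2"
    using fourth_moment_sum(2,3)[OF _ ind, where h = "s' - s"] \<rho>0 \<rho>2 \<rho>_abs le
    by (auto simp: expectation_Y)
  have w4: "sqrt (real n) ^ 4 = (real n)\<^sup>2"
    using power_mult[of "sqrt (real n)" 2 2] by simp
  have "expectation (\<lambda>\<omega>. (empirical n Y s' \<omega> - empirical n Y s \<omega>)\<^sup>2) = expectation (\<lambda>\<omega>. (\<Sum>i<n. \<rho> (Y i \<omega>))\<^sup>2) / n"
    unfolding eq by (simp add: power_divide)
  also have "\<dots> \<le> n * (s' - s) / n" using mom(1) by (intro divide_right_mono) auto
  finally show "expectation (\<lambda>\<omega>. (empirical n Y s' \<omega> - empirical n Y s \<omega>)\<^sup>2) \<le> s' - s" using n by simp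
  have "expectation (\<lambda>\<omega>. (empirical n Y s' \<omega> - empirical n Y s \<omega>) ^ 4) = expectation (\<lambda>\<omega>. (\<Sum>i<n. \<rho> (Y i \<omega>)) ^ 4) / (real n)\<^sup>2"
    unfolding eq by (simp add: power_divide w4)
  also have "\<dots> \<le> (n * (s' - s) + 3 * (n * (s' - s))\<^sup>2) / (real n)\<^sup>2" using mom(2) by (intro divide_right_mono) auto
  also have "\<dots> = 3 * (s' - s)\<^sup>2 + (s' - s) / n" using n by (simp add: field_simps power2_eq_square)
  finally show "expectation (\<lambda>\<omega>. (empirical n Y s' \<omega> - empirical n Y s \<omega>) ^ 4) \<le> 3 * (s' - s)\<^sup>2 + (s' - s) / n" .
qed

lemma empirical_1_AE: "AE \<omega> in M. empirical n Y 1 \<omega> = 0"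
proof -
  have "AE \<omega> in M. Y i \<omega> \<in> {..1}" if "i < n" for i
  proof -
    have "AE r in uniform01. r \<in> {..1}"
      by (rule uniform01.prob_eq_1[THEN iffD1]) (auto simp: measure_uniform01_atMost)
    then show ?thesis using that unfolding distr[OF that, symmetric] by (subst (asm) AE_distr_iff) auto
  qed
  then have "AE \<omega> in M. \<forall>i\<in>{..<n}. Y i \<omega> \<in> {..1}" by (intro AE_finite_allI) auto
  then show ?thesis by eventually_elim (simp add: empirical_def centered_ind_def)
qed

text \<open>The process vanishes almost surely at 1, so its even moments at \<open>s\<close> are
  those of the increment from \<open>s\<close> to 1. The constant 4 is
  \<open>3 * 1 + 1 / 1\<close>.\<close>

lemma empirical_moments:
  assumes s: "s \<in> {0..1}"
  shows "expectation (\<lambda>\<omega>. (empirical n Y s \<omega>)\<^sup>2) \<le> 1"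
    and "expectation (\<lambda>\<omega>. (empirical n Y s \<omega>) ^ 4) \<le> 4"
proof -
  have eq: "expectation (\<lambda>\<omega>. (empirical n Y s \<omega>) ^ k) = expectation (\<lambda>\<omega>. (empirical n Y 1 \<omega> - empirical n Y s \<omega>) ^ k)"
    if "even k" for k
    using empirical_1_AE that by (intro integral_cong_AE) auto
  show "expectation (\<lambda>\<omega>. (empirical n Y s \<omega>)\<^sup>2) \<le> 1"
    using empirical_increment_moments(1)[of s 1] s by (simp add: eq)
  have "3 * (1 - s)\<^sup>2 + (1 - s) / n \<le> 3 * 1 + 1 / 1"
    using s n by (intro add_mono mult_left_mono frac_le) (auto simp: power_le_one)
  then show "expectation (\<lambda>\<omega>. (empirical n Y s \<omega>) ^ 4) \<le> 4"
    using empirical_increment_moments(2)[of s 1] s by (simp add: eq)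
qed

text \<open>Level \<open>a\<close> has \<open>2 ^ a\<close> increments with fourth moments
  \<open>3 * (1/4) ^ a + (1/2) ^ a / n\<close>. The threshold \<open>e / a^2\<close> costs a factor
  \<open>a ^ 8 / e ^ 4\<close> in Markov's inequality, so level \<open>a\<close> contributes
  \<open>(3 * a ^ 8 * (1/2) ^ a + a ^ 8 / n) / e ^ 4\<close>. The first part has small tails in
  \<open>q\<close>; the second is bounded crudely by \<open>l ^ 9 / n\<close> in total.\<close>

lemma empirical_modulus:
  assumes q: "1 \<le> q" "q < l" and e: "0 < e"
  obtains B where "B \<in> events"
    "prob B \<le> (3 * (\<Sum>a\<in>{q<..l}. real a ^ 8 * (1/2) ^ a) + real l ^ 9 / n) / e ^ 4 + 8 * (1/2) ^ q"
    "\<And>\<omega> s u. \<omega> \<in> space M - B \<Longrightarrow> s \<in> {0..1} \<Longrightarrow> u \<in> {dyadic_floor l s, dyadic_ceil l s} \<Longrightarrow>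
      \<bar>empirical n Y u \<omega> - empirical n Y (dyadic_floor q s) \<omega>\<bar> \<le> 2 * e"
    "\<And>\<omega> s. \<omega> \<in> space M - B \<Longrightarrow> s \<in> {0..1} \<Longrightarrow> \<bar>empirical n Y (dyadic_floor q s) \<omega>\<bar> \<le> sqrt (2 ^ q)"
proof -
  define I where "I = (SIGMA a:{q<..l}. {..<2 ^ a :: nat})"
  define D where "D = (\<lambda>(a :: nat, j :: nat) \<omega>. empirical n Y (real (Suc j) / 2 ^ a) \<omega> - empirical n Y (real j / 2 ^ a) \<omega>)"
  define B1 where "B1 = {\<omega> \<in> space M. \<exists>i\<in>I. e / (real (fst i))\<^sup>2 < \<bar>D i \<omega>\<bar>}"
  \<comment> \<open>The threshold \<open>sqrt (2 ^ q)\<close> is large enough for a union bound with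
    fourth moments over the \<open>2 ^ q + 1\<close> points, and small enough for its product with
    the mesh \<open>(1/2) ^ q\<close> to vanish as \<open>q\<close> grows.\<close>
  define B2 where "B2 = {\<omega> \<in> space M. \<exists>i\<in>{..2 ^ q :: nat}. sqrt (2 ^ q) < \<bar>empirical n Y (real i / 2 ^ q) \<omega>\<bar>}"
  note grid = dyadic_point_in_unit
  have I: "finite I" by (simp add: I_def)
  have "B1 \<in> events \<and> prob B1 \<le> (\<Sum>i\<in>I. (3 * ((1/2) ^ fst i)\<^sup>2 + (1/2) ^ fst i / n) / (e / (real (fst i))\<^sup>2) ^ 4)"
  proof -
    have b: "\<bar>D i \<omega>\<bar> \<le> 2 * sqrt n" if iI: "i \<in> I" for i \<omega>
    proof -
      obtain a j where i: "i = (a, j)" "j < 2 ^ a" using iI by (cases i) (auto simp: I_def)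
      have "\<bar>empirical n Y (real (Suc j) / 2 ^ a) \<omega>\<bar> \<le> sqrt n" "\<bar>empirical n Y (real j / 2 ^ a) \<omega>\<bar> \<le> sqrt n"
        using i(2) by (intro empirical_abs_le grid; simp)+
      then show ?thesis unfolding i(1) D_def by simp
    qed
    have m: "expectation (\<lambda>\<omega>. D i \<omega> ^ 4) \<le> 3 * ((1/2) ^ fst i)\<^sup>2 + (1/2) ^ fst i / n" if iI: "i \<in> I" for i
    proof -
      obtain a j where i: "i = (a, j)" "j < 2 ^ a" using iI by (cases i) (auto simp: I_def)
      have "real (Suc j) / 2 ^ a - real j / 2 ^ a = (1/2) ^ a" by (simp add: field_simps)
      moreover have "expectation (\<lambda>\<omega>. D (a, j) \<omega> ^ 4) \<le> 3 * (real (Suc j) / 2 ^ a - real j / 2 ^ a)\<^sup>2 + (real (Suc j) / 2 ^ a - real j / 2 ^ a) / n"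
        unfolding D_def prod.case using i(2)
        by (intro empirical_increment_moments grid divide_right_mono) auto
      ultimately show ?thesis unfolding i(1) by simp
    qed
    have D_meas: "D i \<in> borel_measurable M" for i unfolding D_def by (cases i) simp
    have pos: "0 < e / (real (fst i))\<^sup>2" if "i \<in> I" for i using that e by (auto simp: I_def)
    show ?thesis
      unfolding B1_def
      using union_markov[OF I D_meas b pos _ m] by simp
  qed
  moreover have "(\<Sum>i\<in>I. (3 * ((1/2) ^ fst i)\<^sup>2 + (1/2) ^ fst i / n) / (e / (real (fst i))\<^sup>2) ^ 4)
      \<le> (3 * (\<Sum>a\<in>{q<..l}. real a ^ 8 * (1/2) ^ a) + real l ^ 9 / n) / e ^ 4"
  proof -
    have "(\<Sum>i\<in>I. (3 * ((1/2) ^ fst i)\<^sup>2 + (1/2) ^ fst i / n) / (e / (real (fst i))\<^sup>2) ^ 4) =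
        (\<Sum>a\<in>{q<..l}. \<Sum>j<(2::nat) ^ a. (3 * ((1/2) ^ a)\<^sup>2 + (1/2) ^ a / n) / (e / (real a)\<^sup>2) ^ 4)"
      unfolding I_def by (subst sum.Sigma) (auto intro!: sum.cong)
    also have "\<dots> = (\<Sum>a\<in>{q<..l}. (3 * (real a ^ 8 * (1/2) ^ a) + real a ^ 8 / n) / e ^ 4)"
    proof (rule sum.cong[OF refl])
      fix a assume "a \<in> {q<..l}"
      have "(\<Sum>j<(2::nat) ^ a. (3 * ((1/2) ^ a)\<^sup>2 + (1/2) ^ a / n) / (e / (real a)\<^sup>2) ^ 4) =
          (2 ^ a * (1/2) ^ a) * (3 * (1/2) ^ a + 1 / n) * real a ^ 8 / e ^ 4"
      proof -
        define x where "x = (1/2 :: real) ^ a"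
        have "(e / (real a)\<^sup>2) ^ 4 = e ^ 4 / real a ^ 8"
          by (simp add: power_divide flip: power_mult)
        then show ?thesis unfolding x_def[symmetric]
          using e by (simp add: power2_eq_square field_simps)
      qed
      also have "(2::real) ^ a * (1/2) ^ a = 1" by (simp flip: power_mult_distrib)
      finally show "(\<Sum>j<(2::nat) ^ a. (3 * ((1/2) ^ a)\<^sup>2 + (1/2) ^ a / n) / (e / (real a)\<^sup>2) ^ 4) =
          (3 * (real a ^ 8 * (1/2) ^ a) + real a ^ 8 / n) / e ^ 4" by (simp add: algebra_simps)
    qed
    also have "\<dots> = (3 * (\<Sum>a\<in>{q<..l}. real a ^ 8 * (1/2) ^ a) + (\<Sum>a\<in>{q<..l}. real a ^ 8) / n) / e ^ 4"
      by (simp add: sum_divide_distrib[symmetric] sum.distrib sum_distrib_left)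
    also have "\<dots> \<le> (3 * (\<Sum>a\<in>{q<..l}. real a ^ 8 * (1/2) ^ a) + real l ^ 9 / n) / e ^ 4"
    proof -
      have "(\<Sum>a\<in>{q<..l}. real a ^ 8) \<le> (\<Sum>a\<in>{q<..l}. real l ^ 8)"
        by (intro sum_mono power_mono) auto
      also have "\<dots> \<le> real l * real l ^ 8" by (simp add: mult_right_mono)
      also have "\<dots> = real l ^ 9" by (simp flip: power_Suc)
      finally show ?thesis using e by (intro divide_right_mono add_left_mono) auto
    qed
    finally show ?thesis .
  qed
  moreover have "B2 \<in> events \<and> prob B2 \<le> (\<Sum>i\<in>{..2 ^ q :: nat}. 4 / sqrt (2 ^ q) ^ 4)"
    unfolding B2_def
    using union_markov[of "{..2 ^ q :: nat}" "\<lambda>i. empirical n Y (real i / 2 ^ q)" "sqrt n" "\<lambda>_. sqrt (2 ^ q)" 4 "\<lambda>_. 4"]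
    by (simp add: empirical_abs_le grid empirical_moments)
  moreover have "(\<Sum>i\<in>{..2 ^ q :: nat}. 4 / sqrt (2 ^ q) ^ 4) \<le> 8 * (1/2) ^ q"
  proof -
    have "sqrt (2 ^ q) ^ 4 = (2 ^ q)\<^sup>2" using power_mult[of "sqrt (2 ^ q)" 2 2] by simp
    then have "(\<Sum>i\<in>{..2 ^ q :: nat}. 4 / sqrt (2 ^ q) ^ 4) = (2 ^ q + 1) * (4 / (2 ^ q)\<^sup>2)" by simp
    also have "\<dots> \<le> (2 ^ q + 2 ^ q) * (4 / (2 ^ q)\<^sup>2)" by (intro mult_right_mono) auto
    also have "\<dots> = 8 * (1/2) ^ q" by (simp add: power2_eq_square power_divide)
    finally show ?thesis .
  qed
  moreover have "prob (B1 \<union> B2) \<le> prob B1 + prob B2" if "B1 \<in> events" "B2 \<in> events"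
    using that by (rule measure_Un_le)
  ultimately have B: "B1 \<union> B2 \<in> events"
    "prob (B1 \<union> B2) \<le> (3 * (\<Sum>a\<in>{q<..l}. real a ^ 8 * (1/2) ^ a) + real l ^ 9 / n) / e ^ 4 + 8 * (1/2) ^ q"
    by auto
  show thesis
  proof (rule that[OF B])
    fix \<omega> and s :: real assume \<omega>: "\<omega> \<in> space M - (B1 \<union> B2)" and s: "s \<in> {0..1}"
    obtain i where i: "i \<le> 2 ^ q" "dyadic_floor q s = real i / 2 ^ q" by (rule dyadic_floor_eq[OF s])
    show "\<bar>empirical n Y (dyadic_floor q s) \<omega>\<bar> \<le> sqrt (2 ^ q)"
      using \<omega> i by (force simp: B2_def)
    have inc: "\<bar>empirical n Y (real (Suc j) / 2 ^ a) \<omega> - empirical n Y (real j / 2 ^ a) \<omega>\<bar> \<le> e / (real a)\<^sup>2"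
      if "q < a" "a \<le> l" "j < 2 ^ a" for a j
    proof -
      have "(a, j) \<in> I" using that by (simp add: I_def)
      then have "\<not> e / (real (fst (a, j)))\<^sup>2 < \<bar>D (a, j) \<omega>\<bar>" using \<omega> unfolding B1_def by blast
      then show ?thesis by (simp add: D_def)
    qed
    have "(\<Sum>a\<in>{q<..l}. e / (real a)\<^sup>2) = e * (\<Sum>a\<in>{q<..l}. 1 / (real a)\<^sup>2)"
      by (simp add: sum_distrib_left)
    also have "\<dots> \<le> e * (1 / real q - 1 / real l)"
      using q e by (intro mult_left_mono sum_inverse_squares_le) auto
    also have "\<dots> \<le> e * 1"
    proof (intro mult_left_mono)
      have "1 / real q \<le> 1" "0 \<le> 1 / real l" using q by simp_all
      then show "1 / real q - 1 / real l \<le> 1" by linarith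
    qed (use e in simp)
    finally have sum: "(\<Sum>a\<in>{q<..l}. e / (real a)\<^sup>2) \<le> e" by simp
    have "1 \<le> (real l)\<^sup>2" using q by (simp add: one_le_power)
    then have l1: "e / (real l)\<^sup>2 \<le> e"
      using divide_left_mono[of 1 "(real l)\<^sup>2" e] e q by simp
    fix u :: real assume u: "u \<in> {dyadic_floor l s, dyadic_ceil l s}"
    show "\<bar>empirical n Y u \<omega> - empirical n Y (dyadic_floor q s) \<omega>\<bar> \<le> 2 * e"
    proof (rule dyadic_modulus[of q l e "\<lambda>s. empirical n Y s \<omega>", OF _ _ _ _ s u])
      show "\<bar>empirical n Y (real i / 2 ^ l) \<omega> - empirical n Y (dyadic_floor q (real i / 2 ^ l)) \<omega>\<bar> \<le> e"
        if "i \<le> 2 ^ l" for i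
        using q inc that by (intro order_trans[OF dyadic_chain_le[of q l i "\<lambda>s. empirical n Y s \<omega>"] sum]) auto
      show "\<bar>empirical n Y (real (Suc j) / 2 ^ l) \<omega> - empirical n Y (real j / 2 ^ l) \<omega>\<bar> \<le> e"
        if "j < 2 ^ l" for j
        using inc[of l j] that q l1 by linarith
    qed (use q e in auto)
  qed
qed

end

section \<open>The truncated process for a fixed matrix size\<close>

text \<open>Used with \<open>Inl\<close> and \<open>Inr\<close> to extract the row and the column
  sample from the joint family.\<close>

lemma (in prob_space) indep_vars_reindex_inj:
  assumes f: "inj_on f I" and ind: "indep_vars M' X (f ` I)"
  shows "indep_vars (\<lambda>i. M' (f i)) (\<lambda>i. X (f i)) I"
proof -
  let ?F = "\<lambda>i. {X i -` A \<inter> space M |A. A \<in> sets (M' i)}"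
  have ind: "\<And>i. i \<in> I \<Longrightarrow> X (f i) \<in> measurable M (M' (f i))" "indep_sets ?F (f ` I)"
    using ind unfolding indep_vars_def2 by auto
  have "indep_sets (\<lambda>i. ?F (f i)) I"
  proof (rule indep_setsI)
    show "?F (f i) \<subseteq> events" if "i \<in> I" for i
      using ind(2) that unfolding indep_sets_def by blast
    fix A J assume J: "J \<noteq> {}" "J \<subseteq> I" "finite J" and A: "\<forall>j\<in>J. A j \<in> ?F (f j)"
    have inj: "inj_on f J" using f J(2) by (rule inj_on_subset)
    define B where "B k = A (inv_into J f k)" for k
    have BA: "B (f j) = A j" if "j \<in> J" for j using inj that by (simp add: B_def)
    have "prob (\<Inter>k\<in>f ` J. B k) = (\<Prod>k\<in>f ` J. prob (B k))"
      using J A BA by (intro indep_setsD[OF ind(2)]) auto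
    then show "prob (\<Inter>j\<in>J. A j) = (\<Prod>j\<in>J. prob (A j))"
      using inj BA by (simp add: prod.reindex image_image cong: INF_cong prod.cong)
  qed
  then show ?thesis using ind(1) unfolding indep_vars_def2 by blast
qed

lemma entry_measurable:
  assumes "i < n" "j < n"
  shows "(\<lambda>B. B $$ (i, j)) \<in> borel_measurable (mat_borel n G)"
proof -
  let ?f = "\<lambda>A :: complex mat. \<lambda>(i, j)\<in>{..<n} \<times> {..<n}. A $$ (i, j)"
  have "?f \<in> measurable (mat_borel n G) (\<Pi>\<^sub>M ij\<in>{..<n} \<times> {..<n}. borel)"
    unfolding mat_borel_def by (rule measurable_vimage_algebra1) (auto simp: space_PiM PiE_def)
  then have "(\<lambda>A. ?f A (i, j)) \<in> borel_measurable (mat_borel n G)"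
    by (rule measurable_compose[OF _ measurable_component_singleton]) (use assms in auto)
  then show ?thesis using assms by simp
qed

lemma space_mat_borel [simp]: "space (mat_borel n G) = G"
  by (simp add: mat_borel_def)

lemma mat_adjoint_index:
  assumes "A \<in> carrier_mat n n" "i < n" "j < n"
  shows "mat_adjoint A $$ (i, j) = cnj (A $$ (j, i))"
  using assms unfolding mat_adjoint_def by (auto simp: mat_of_rows_index)

text \<open>Column sums come from the diagonal of \<open>mat_adjoint A * A\<close>, row sums from
  that of \<open>A * mat_adjoint A\<close>; for square matrices a left inverse is also a right
  inverse.\<close>

lemma unitary_group_sums:
  assumes A: "A \<in> unitary_group n" and j: "j < n"
  shows "(\<Sum>i<n. (cmod (A $$ (i, j)))\<^sup>2) = 1" "(\<Sum>i<n. (cmod (A $$ (j, i)))\<^sup>2) = 1"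
proof -
  have c: "A \<in> carrier_mat n n" and u: "mat_adjoint A * A = 1\<^sub>m n"
    using A by (auto simp: unitary_group_def)
  have c': "mat_adjoint A \<in> carrier_mat n n"
    using c unfolding mat_adjoint_def by auto
  have u': "A * mat_adjoint A = 1\<^sub>m n"
    by (rule mat_mult_left_right_inverse[OF c' c u])
  have "(mat_adjoint A * A) $$ (j, j) = 1" "(A * mat_adjoint A) $$ (j, j) = 1"
    using u u' j by auto
  moreover have "(mat_adjoint A * A) $$ (j, j) = (\<Sum>i<n. cnj (A $$ (i, j)) * A $$ (i, j))"
    using c c' j by (subst index_mult_mat) (auto simp: scalar_prod_def lessThan_atLeast0 mat_adjoint_index intro!: sum.cong)
  moreover have "(A * mat_adjoint A) $$ (j, j) = (\<Sum>i<n. A $$ (j, i) * cnj (A $$ (j, i)))"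
    using c c' j by (subst index_mult_mat) (auto simp: scalar_prod_def lessThan_atLeast0 mat_adjoint_index intro!: sum.cong)
  ultimately have "complex_of_real (\<Sum>i<n. (cmod (A $$ (i, j)))\<^sup>2) = 1" "complex_of_real (\<Sum>i<n. (cmod (A $$ (j, i)))\<^sup>2) = 1"
    by (simp_all add: complex_norm_square mult.commute flip: of_real_power)
  then show "(\<Sum>i<n. (cmod (A $$ (i, j)))\<^sup>2) = 1" "(\<Sum>i<n. (cmod (A $$ (j, i)))\<^sup>2) = 1"
    by (simp_all only: of_real_eq_1_iff)
qed

locale truncation = prob_space M for M :: "'w measure" +
  fixes n :: nat and U :: "'w \<Rightarrow> complex mat" and R C :: "nat \<Rightarrow> 'w \<Rightarrow> real"
  assumes n: "1 \<le> n" and setting: "truncation_setting n M U R C"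
begin

abbreviation I where "I \<equiv> {..<n} <+> {..<n}"
abbreviation \<xi> where "\<xi> \<equiv> case_sum R C"

lemma U_measurable: "U \<in> measurable M (mat_borel n (unitary_group n))"
  and distr_R: "i < n \<Longrightarrow> distr M borel (R i) = uniform01"
  and distr_C: "i < n \<Longrightarrow> distr M borel (C i) = uniform01"
  and indep_\<xi>: "indep_vars (\<lambda>_. borel) \<xi> I"
  and indep_U: "indep_set (sets (vimage_algebra (space M) (\<lambda>\<omega>. \<lambda>k\<in>I. \<xi> k \<omega>) (\<Pi>\<^sub>M k\<in>I. borel)))
       (sets (vimage_algebra (space M) U (mat_borel n (unitary_group n))))"
  using setting by (auto simp: truncation_setting_def uniform01_def)

sublocale R: uniform_sample M n R
proof
  have "indep_vars (\<lambda>_. borel) \<xi> (Inl ` {..<n})"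
    by (rule indep_vars_subset[OF indep_\<xi>]) auto
  from indep_vars_reindex_inj[OF _ this]
  have "indep_vars (\<lambda>_. borel) (\<lambda>i. \<xi> (Inl i)) {..<n}" by simp
  then show "indep_vars (\<lambda>_. borel) R {..<n}" by simp
qed (use n distr_R in auto)

sublocale C: uniform_sample M n C
proof
  have "indep_vars (\<lambda>_. borel) \<xi> (Inr ` {..<n})"
    by (rule indep_vars_subset[OF indep_\<xi>]) auto
  from indep_vars_reindex_inj[OF _ this]
  have "indep_vars (\<lambda>_. borel) (\<lambda>i. \<xi> (Inr i)) {..<n}" by simp
  then show "indep_vars (\<lambda>_. borel) C {..<n}" by simp
qed (use n distr_C in auto)

lemma \<xi>_measurable [measurable]: "k \<in> I \<Longrightarrow> \<xi> k \<in> borel_measurable M"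
  using indep_\<xi> by (auto simp: indep_vars_def)

lemma expectation_\<xi>:
  fixes f :: "real \<Rightarrow> 'b::{banach, second_countable_topology}"
  assumes "k \<in> I" "f \<in> borel_measurable borel"
  shows "expectation (\<lambda>\<omega>. f (\<xi> k \<omega>)) = (\<integral>r. f r \<partial>uniform01)"
proof -
  have "distr M borel (\<xi> k) = uniform01" using assms(1) distr_R distr_C by auto
  then show ?thesis using assms by (simp add: integral_distr flip: \<open>distr M borel (\<xi> k) = uniform01\<close>)
qed

lemma expectation_prod_\<xi>:
  fixes f :: "nat + nat \<Rightarrow> real \<Rightarrow> 'b::{real_normed_field, banach, second_countable_topology}"
  assumes f: "\<And>k. k \<in> I \<Longrightarrow> f k \<in> borel_measurable borel" "\<And>k x. k \<in> I \<Longrightarrow> norm (f k x) \<le> B"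
  shows "expectation (\<lambda>\<omega>. \<Prod>k\<in>I. f k (\<xi> k \<omega>)) = (\<Prod>k\<in>I. \<integral>r. f k r \<partial>uniform01)"
proof -
  have "indep_vars (\<lambda>_. borel) (\<lambda>k \<omega>. f k (\<xi> k \<omega>)) I"
    using f by (intro indep_vars_compose2[OF indep_\<xi>]) auto
  moreover have "integrable M (\<lambda>\<omega>. f k (\<xi> k \<omega>))" if "k \<in> I" for k
    using f that by (intro integrable_const_bound[where B = B]) (auto intro: measurable_compose[OF \<xi>_measurable])
  ultimately have "expectation (\<lambda>\<omega>. \<Prod>k\<in>I. f k (\<xi> k \<omega>)) = (\<Prod>k\<in>I. expectation (\<lambda>\<omega>. f k (\<xi> k \<omega>)))"
    by (intro indep_vars_lebesgue_integral) auto
  also have "\<dots> = (\<Prod>k\<in>I. \<integral>r. f k r \<partial>uniform01)"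
    by (intro prod.cong refl expectation_\<xi> f)
  finally show ?thesis .
qed

text \<open>The setting gives independence of the sigma-algebras generated by \<open>U\<close> and
  by the coordinate vector. Real functions of the two generate smaller ones, to which the product
  rule for real variables applies.\<close>

lemma expectation_U_\<xi>:
  fixes \<psi> :: "complex mat \<Rightarrow> real" and \<phi> :: "(nat + nat \<Rightarrow> real) \<Rightarrow> real"
  assumes \<psi>: "\<psi> \<in> borel_measurable (mat_borel n (unitary_group n))" "\<And>B. B \<in> unitary_group n \<Longrightarrow> \<bar>\<psi> B\<bar> \<le> a"
    and \<phi>: "\<phi> \<in> borel_measurable (\<Pi>\<^sub>M k\<in>I. borel)" "\<And>x. \<bar>\<phi> x\<bar> \<le> b"
  shows "expectation (\<lambda>\<omega>. \<psi> (U \<omega>) * \<phi> (\<lambda>k\<in>I. \<xi> k \<omega>)) = expectation (\<lambda>\<omega>. \<psi> (U \<omega>)) * expectation (\<lambda>\<omega>. \<phi> (\<lambda>k\<in>I. \<xi> k \<omega>))"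
proof -
  let ?\<Xi> = "\<lambda>\<omega>. \<lambda>k\<in>I. \<xi> k \<omega>"
  let ?F = "vimage_algebra (space M) ?\<Xi> (\<Pi>\<^sub>M k\<in>I. borel)"
  let ?G = "vimage_algebra (space M) U (mat_borel n (unitary_group n))"
  have \<Xi>: "?\<Xi> \<in> measurable M (\<Pi>\<^sub>M k\<in>I. borel)" by (intro measurable_restrict \<xi>_measurable)
  have \<Xi>': "(\<lambda>\<omega>. \<phi> (?\<Xi> \<omega>)) \<in> borel_measurable ?F"
    by (rule measurable_compose[OF measurable_vimage_algebra1 \<phi>(1)]) (auto simp: space_PiM)
  have U': "(\<lambda>\<omega>. \<psi> (U \<omega>)) \<in> borel_measurable ?G"
    using measurable_space[OF U_measurable]
    by (intro measurable_compose[OF measurable_vimage_algebra1 \<psi>(1)]) auto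
  have sub1: "sigma_sets (space M) {(\<lambda>\<omega>. \<phi> (?\<Xi> \<omega>)) -` A \<inter> space M |A. A \<in> sets borel} \<subseteq> sets ?F"
    using measurable_sets[OF \<Xi>'] sets.sigma_sets_subset[of _ ?F] by (auto intro!: sets.sigma_sets_subset[of _ ?F, simplified])
  have sub2: "sigma_sets (space M) {(\<lambda>\<omega>. \<psi> (U \<omega>)) -` A \<inter> space M |A. A \<in> sets borel} \<subseteq> sets ?G"
    using measurable_sets[OF U'] by (auto intro!: sets.sigma_sets_subset[of _ ?G, simplified])
  have "indep_var borel (\<lambda>\<omega>. \<phi> (?\<Xi> \<omega>)) borel (\<lambda>\<omega>. \<psi> (U \<omega>))"
    unfolding indep_var_eq
  proof (intro conjI)
    show "indep_set (sigma_sets (space M) {(\<lambda>\<omega>. \<phi> (?\<Xi> \<omega>)) -` A \<inter> space M |A. A \<in> sets borel})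
        (sigma_sets (space M) {(\<lambda>\<omega>. \<psi> (U \<omega>)) -` A \<inter> space M |A. A \<in> sets borel})"
      using indep_U unfolding indep_set_def
      by (rule indep_sets_mono_sets) (use sub1 sub2 in \<open>auto split: bool.splits\<close>)
  qed (rule measurable_compose[OF \<Xi> \<phi>(1)] measurable_compose[OF U_measurable \<psi>(1)])+
  then have "expectation (\<lambda>\<omega>. \<phi> (?\<Xi> \<omega>) * \<psi> (U \<omega>)) = expectation (\<lambda>\<omega>. \<phi> (?\<Xi> \<omega>)) * expectation (\<lambda>\<omega>. \<psi> (U \<omega>))"
    using \<phi>(2) \<psi>(2) measurable_space[OF U_measurable]
    by (intro indep_expectation_mult_bounded[where B = b and C = a]) auto
  then show ?thesis by (simp add: mult.commute)
qed

section \<open>Mixed moments of the squared entries and the row and column variables\<close>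

definition A :: "nat \<Rightarrow> nat \<Rightarrow> 'w \<Rightarrow> real" where
  "A i j \<omega> = (cmod (U \<omega> $$ (i, j)))\<^sup>2"

lemma U_space: "\<omega> \<in> space M \<Longrightarrow> U \<omega> \<in> unitary_group n"
  using measurable_space[OF U_measurable] by simp

lemma A_sums:
  assumes "\<omega> \<in> space M" "j < n"
  shows "(\<Sum>i<n. A i j \<omega>) = 1" "(\<Sum>i<n. A j i \<omega>) = 1"
  unfolding A_def using unitary_group_sums[OF U_space[OF assms(1)] assms(2)] by auto

lemma A_nonneg: "0 \<le> A i j \<omega>"
  by (simp add: A_def)

lemma cmod_unitary_le:
  assumes "B \<in> unitary_group n" "i < n" "j < n"
  shows "(cmod (B $$ (i, j)))\<^sup>2 \<le> 1"
proof -
  have "(cmod (B $$ (i, j)))\<^sup>2 \<le> (\<Sum>i<n. (cmod (B $$ (i, j)))\<^sup>2)"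
    using assms by (intro member_le_sum) auto
  then show ?thesis using unitary_group_sums(1)[OF assms(1,3)] by simp
qed

lemma A_le_1: "\<omega> \<in> space M \<Longrightarrow> i < n \<Longrightarrow> j < n \<Longrightarrow> A i j \<omega> \<le> 1"
  unfolding A_def by (intro cmod_unitary_le U_space)

lemma A_measurable [measurable]:
  assumes "i < n" "j < n"
  shows "A i j \<in> borel_measurable M"
  unfolding A_def using measurable_compose[OF U_measurable entry_measurable[OF assms]] by measurable

lemma A_integrable: "i < n \<Longrightarrow> j < n \<Longrightarrow> integrable M (A i j)"
  using A_nonneg A_le_1 by (intro integrable_const_bound[where B = 1]) auto

text \<open>Each of the four factors is written as a product over the whole index set
  \<open>I\<close> that is 1 off its own index. Independence then acts index by index, and rows
  never meet columns because they lie in different summands.\<close>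

lemma expectation_RC:
  assumes f: "f \<in> borel_measurable borel" "\<And>x. \<bar>f x\<bar> \<le> (1::real)"
    and g: "g \<in> borel_measurable borel" "\<And>x. \<bar>g x\<bar> \<le> (1::real)"
    and f': "f' \<in> borel_measurable borel" "\<And>x. \<bar>f' x\<bar> \<le> (1::real)"
    and g': "g' \<in> borel_measurable borel" "\<And>x. \<bar>g' x\<bar> \<le> (1::real)"
    and ij: "i < n" "j < n" "k < n" "l < n"
  shows "expectation (\<lambda>\<omega>. f (R i \<omega>) * g (C j \<omega>) * (f' (R k \<omega>) * g' (C l \<omega>))) =
    (if i = k then \<integral>r. f r * f' r \<partial>uniform01 else (\<integral>r. f r \<partial>uniform01) * (\<integral>r. f' r \<partial>uniform01)) *
    (if j = l then \<integral>r. g r * g' r \<partial>uniform01 else (\<integral>r. g r \<partial>uniform01) * (\<integral>r. g' r \<partial>uniform01))"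
proof -
  define h where "h m r = (if m = Inl i then f r else 1) * (if m = Inr j then g r else 1) *
    ((if m = Inl k then f' r else 1) * (if m = Inr l then g' r else 1))" for m :: "nat + nat" and r :: real
  have prod_if: "(\<Prod>m\<in>I. if m = a then c m else 1) = c a" if "a \<in> I" for a and c :: "nat + nat \<Rightarrow> real"
    using that by (simp add: prod.delta)
  have "f (R i \<omega>) * g (C j \<omega>) * (f' (R k \<omega>) * g' (C l \<omega>)) = (\<Prod>m\<in>I. h m (\<xi> m \<omega>))" for \<omega>
  proof -
    have "(\<Prod>m\<in>I. h m (\<xi> m \<omega>)) = (\<Prod>m\<in>I. (if m = Inl i then f (\<xi> m \<omega>) else 1)) * (\<Prod>m\<in>I. (if m = Inr j then g (\<xi> m \<omega>) else 1)) *
      ((\<Prod>m\<in>I. (if m = Inl k then f' (\<xi> m \<omega>) else 1)) * (\<Prod>m\<in>I. (if m = Inr l then g' (\<xi> m \<omega>) else 1)))"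
      unfolding h_def prod.distrib ..
    then show ?thesis using ij by (simp add: prod_if InlI InrI del: prod.delta)
  qed
  then have "expectation (\<lambda>\<omega>. f (R i \<omega>) * g (C j \<omega>) * (f' (R k \<omega>) * g' (C l \<omega>))) = expectation (\<lambda>\<omega>. \<Prod>m\<in>I. h m (\<xi> m \<omega>))"
    by simp
  also have "\<dots> = (\<Prod>m\<in>I. \<integral>r. h m r \<partial>uniform01)"
  proof (rule expectation_prod_\<xi>[where B = 1])
    show "h m \<in> borel_measurable borel" for m
      unfolding h_def using f(1) g(1) f'(1) g'(1) by measurable
    show "norm (h m x) \<le> 1" for m x
      unfolding h_def real_norm_def abs_mult
      using f(2) g(2) f'(2) g'(2) by (intro mult_le_one) auto
  qed
  \<comment> \<open>When \<open>i = k\<close>, the integral of the product is charged to the first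
    row factor and the second one becomes 1; likewise for \<open>j = l\<close>.\<close>
  also have "\<dots> = (\<Prod>m\<in>I. (if m = Inl i then (if i = k then \<integral>r. f r * f' r \<partial>uniform01 else \<integral>r. f r \<partial>uniform01) else 1) *
     (if m = Inr j then (if j = l then \<integral>r. g r * g' r \<partial>uniform01 else \<integral>r. g r \<partial>uniform01) else 1) *
     ((if m = Inl k then (if i = k then 1 else \<integral>r. f' r \<partial>uniform01) else 1) *
      (if m = Inr l then (if j = l then 1 else \<integral>r. g' r \<partial>uniform01) else 1)))"
    using uniform01.prob_space by (intro prod.cong refl) (auto simp: h_def)
  also have "\<dots> = (if i = k then \<integral>r. f r * f' r \<partial>uniform01 else (\<integral>r. f r \<partial>uniform01) * (\<integral>r. f' r \<partial>uniform01)) *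
    (if j = l then \<integral>r. g r * g' r \<partial>uniform01 else (\<integral>r. g r \<partial>uniform01) * (\<integral>r. g' r \<partial>uniform01))"
    unfolding prod.distrib using ij by (simp add: prod_if InlI InrI del: prod.delta)
  finally show ?thesis .
qed

lemma expectation_A_RC:
  assumes f: "f \<in> borel_measurable borel" "\<And>x. \<bar>f x\<bar> \<le> (1::real)"
    and g: "g \<in> borel_measurable borel" "\<And>x. \<bar>g x\<bar> \<le> (1::real)"
    and f': "f' \<in> borel_measurable borel" "\<And>x. \<bar>f' x\<bar> \<le> (1::real)"
    and g': "g' \<in> borel_measurable borel" "\<And>x. \<bar>g' x\<bar> \<le> (1::real)"
    and \<psi>: "\<psi> \<in> borel_measurable (mat_borel n (unitary_group n))" "\<And>B. B \<in> unitary_group n \<Longrightarrow> \<bar>\<psi> B\<bar> \<le> 1"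
    and ij: "i < n" "j < n" "k < n" "l < n"
  shows "expectation (\<lambda>\<omega>. \<psi> (U \<omega>) * (f (R i \<omega>) * g (C j \<omega>) * (f' (R k \<omega>) * g' (C l \<omega>)))) =
    expectation (\<lambda>\<omega>. \<psi> (U \<omega>)) *
    ((if i = k then \<integral>r. f r * f' r \<partial>uniform01 else (\<integral>r. f r \<partial>uniform01) * (\<integral>r. f' r \<partial>uniform01)) *
    (if j = l then \<integral>r. g r * g' r \<partial>uniform01 else (\<integral>r. g r \<partial>uniform01) * (\<integral>r. g' r \<partial>uniform01)))"
proof -
  define \<phi> where "\<phi> x = f (x (Inl i)) * g (x (Inr j)) * (f' (x (Inl k)) * g' (x (Inr l)))" for x :: "nat + nat \<Rightarrow> real"
  have comp: "(\<lambda>x. x m) \<in> borel_measurable (\<Pi>\<^sub>M k\<in>I. borel)" if "m \<in> I" for m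
    using that by (rule measurable_component_singleton)
  have "expectation (\<lambda>\<omega>. \<psi> (U \<omega>) * \<phi> (\<lambda>k\<in>I. \<xi> k \<omega>)) = expectation (\<lambda>\<omega>. \<psi> (U \<omega>)) * expectation (\<lambda>\<omega>. \<phi> (\<lambda>k\<in>I. \<xi> k \<omega>))"
  proof (rule expectation_U_\<xi>[OF \<psi>])
    show "\<phi> \<in> borel_measurable (\<Pi>\<^sub>M k\<in>I. borel)"
      unfolding \<phi>_def using ij
      by (intro borel_measurable_times measurable_compose[OF comp f(1)] measurable_compose[OF comp g(1)]
          measurable_compose[OF comp f'(1)] measurable_compose[OF comp g'(1)]) auto
    show "\<bar>\<phi> x\<bar> \<le> 1" for x
      unfolding \<phi>_def abs_mult using f(2) g(2) f'(2) g'(2) by (intro mult_le_one) auto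
  qed
  moreover have "\<phi> (\<lambda>k\<in>I. \<xi> k \<omega>) = f (R i \<omega>) * g (C j \<omega>) * (f' (R k \<omega>) * g' (C l \<omega>))" for \<omega>
    using ij by (simp add: \<phi>_def InlI InrI)
  ultimately show ?thesis
    using expectation_RC[OF f g f' g' ij] by simp
qed

end

context truncation
begin

text \<open>The sum of the fourth absolute moments of the entries. Besides unitarity, this is the
  only information on the law of \<open>U\<close> that enters the estimates.\<close>

definition A2 :: real where
  "A2 = expectation (\<lambda>\<omega>. \<Sum>i<n. \<Sum>j<n. (A i j \<omega>)\<^sup>2)"

text \<open>The terms of the double sum are orthogonal because \<open>f\<close> and \<open>g\<close> are centered.\<close>

lemma second_moment_bilinear:
  assumes f: "f \<in> borel_measurable borel" "\<And>x. \<bar>f x\<bar> \<le> (1::real)" "(\<integral>r. f r \<partial>uniform01) = 0"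
    and g: "g \<in> borel_measurable borel" "\<And>x. \<bar>g x\<bar> \<le> (1::real)" "(\<integral>r. g r \<partial>uniform01) = 0"
  shows "expectation (\<lambda>\<omega>. (\<Sum>i<n. \<Sum>j<n. A i j \<omega> * (f (R i \<omega>) * g (C j \<omega>)))\<^sup>2) =
    A2 * ((\<integral>r. (f r)\<^sup>2 \<partial>uniform01) * (\<integral>r. (g r)\<^sup>2 \<partial>uniform01))"
proof -
  define F G where "F = (\<integral>r. f r * f r \<partial>uniform01)" and "G = (\<integral>r. g r * g r \<partial>uniform01)"
  define P where "P = {..<n} \<times> {..<n}"
  have P: "finite P" by (simp add: P_def)
  define a where "a p \<omega> = A (fst p) (snd p) \<omega>" for p \<omega>
  define x where "x p \<omega> = f (R (fst p) \<omega>) * g (C (snd p) \<omega>)" for p \<omega>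
  note f(1)[measurable] g(1)[measurable]
  have am: "a p \<in> borel_measurable M" and xm: "x p \<in> borel_measurable M" if "p \<in> P" for p
    using that unfolding a_def x_def P_def by auto
  have a1: "\<bar>a p \<omega>\<bar> \<le> 1" if "p \<in> P" "\<omega> \<in> space M" for p \<omega>
    using that A_le_1 A_nonneg unfolding a_def P_def by auto
  have x1: "\<bar>x p \<omega>\<bar> \<le> 1" for p \<omega>
    unfolding x_def abs_mult using f(2) g(2) by (intro mult_le_one) auto
  have E: "expectation (\<lambda>\<omega>. a p \<omega> * a p' \<omega> * (x p \<omega> * x p' \<omega>)) =
      (if p = p' then expectation (\<lambda>\<omega>. (a p \<omega>)\<^sup>2) * (F * G) else 0)"
    if "p \<in> P" "p' \<in> P" for p p'
  proof -
    obtain i j k l where p: "p = (i, j)" "p' = (k, l)" by (cases p, cases p')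
    have ij: "i < n" "j < n" "k < n" "l < n" using that unfolding p P_def by auto
    define \<psi> where "\<psi> B = (cmod (B $$ (i, j)))\<^sup>2 * (cmod (B $$ (k, l)))\<^sup>2" for B
    have \<psi>: "\<psi> \<in> borel_measurable (mat_borel n (unitary_group n))"
      unfolding \<psi>_def using entry_measurable[OF ij(1,2)] entry_measurable[OF ij(3,4)] by measurable
    have \<psi>1: "\<bar>\<psi> B\<bar> \<le> 1" if "B \<in> unitary_group n" for B
      unfolding \<psi>_def abs_mult using cmod_unitary_le[OF that] ij by (intro mult_le_one) auto
    have "expectation (\<lambda>\<omega>. a p \<omega> * a p' \<omega> * (x p \<omega> * x p' \<omega>)) =
        expectation (\<lambda>\<omega>. \<psi> (U \<omega>) * (f (R i \<omega>) * g (C j \<omega>) * (f (R k \<omega>) * g (C l \<omega>))))"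
      by (simp add: a_def x_def \<psi>_def p A_def)
    also have "\<dots> = expectation (\<lambda>\<omega>. \<psi> (U \<omega>)) * ((if i = k then F else 0) * (if j = l then G else 0))"
      using expectation_A_RC[where f = f and g = g and f' = f and g' = g and \<psi> = \<psi> and i = i and j = j and k = k and l = l]
        f g \<psi> \<psi>1 ij by (simp add: F_def G_def)
    finally show ?thesis by (auto simp: p \<psi>_def a_def A_def power2_eq_square)
  qed
  have int: "integrable M (\<lambda>\<omega>. a p \<omega> * a p' \<omega> * (x p \<omega> * x p' \<omega>))" if "p \<in> P" "p' \<in> P" for p p'
  proof (rule integrable_const_bound[where B = 1])
    show "AE \<omega> in M. norm (a p \<omega> * a p' \<omega> * (x p \<omega> * x p' \<omega>)) \<le> 1"
      unfolding real_norm_def abs_mult using a1 x1 that by (intro AE_I2 mult_le_one) auto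
  qed (use am xm that in auto)
  have "(\<Sum>i<n. \<Sum>j<n. A i j \<omega> * (f (R i \<omega>) * g (C j \<omega>)))\<^sup>2 = (\<Sum>p\<in>P. \<Sum>p'\<in>P. a p \<omega> * a p' \<omega> * (x p \<omega> * x p' \<omega>))" for \<omega>
  proof -
    have "(\<Sum>i<n. \<Sum>j<n. A i j \<omega> * (f (R i \<omega>) * g (C j \<omega>))) = (\<Sum>p\<in>P. a p \<omega> * x p \<omega>)"
      unfolding P_def a_def x_def by (simp add: sum.cartesian_product case_prod_beta)
    then show ?thesis by (simp add: power2_eq_square sum_product mult_ac)
  qed
  then have "expectation (\<lambda>\<omega>. (\<Sum>i<n. \<Sum>j<n. A i j \<omega> * (f (R i \<omega>) * g (C j \<omega>)))\<^sup>2) =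
      (\<Sum>p\<in>P. \<Sum>p'\<in>P. expectation (\<lambda>\<omega>. a p \<omega> * a p' \<omega> * (x p \<omega> * x p' \<omega>)))"
    using int by (simp add: Bochner_Integration.integral_sum Bochner_Integration.integrable_sum)
  also have "\<dots> = (\<Sum>p\<in>P. \<Sum>p'\<in>P. if p = p' then expectation (\<lambda>\<omega>. (a p \<omega>)\<^sup>2) * (F * G) else 0)"
    by (intro sum.cong refl E)
  also have "\<dots> = (\<Sum>p\<in>P. expectation (\<lambda>\<omega>. (a p \<omega>)\<^sup>2) * (F * G))" using P by simp
  also have "\<dots> = (\<Sum>p\<in>P. expectation (\<lambda>\<omega>. (a p \<omega>)\<^sup>2)) * (F * G)" by (simp add: sum_distrib_right)
  also have "(\<Sum>p\<in>P. expectation (\<lambda>\<omega>. (a p \<omega>)\<^sup>2)) = expectation (\<lambda>\<omega>. \<Sum>p\<in>P. (a p \<omega>)\<^sup>2)"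
  proof (rule Bochner_Integration.integral_sum[symmetric])
    fix p assume p: "p \<in> P"
    show "integrable M (\<lambda>\<omega>. (a p \<omega>)\<^sup>2)"
      using am[OF p] a1[OF p] by (intro integrable_const_bound[where B = 1]) (auto simp: abs_square_le_1)
  qed
  also have "\<dots> = A2"
    unfolding A2_def P_def a_def by (simp add: sum.cartesian_product case_prod_beta)
  finally show ?thesis by (simp add: F_def G_def power2_eq_square)
qed

section \<open>Mean, decomposition and measurability of the process\<close>

lemma expectation_double_sum:
  fixes F :: "nat \<Rightarrow> nat \<Rightarrow> 'w \<Rightarrow> real"
  assumes "\<And>i j. i < n \<Longrightarrow> j < n \<Longrightarrow> integrable M (F i j)"
  shows "expectation (\<lambda>\<omega>. \<Sum>i<n. \<Sum>j<n. F i j \<omega>) = (\<Sum>i<n. \<Sum>j<n. expectation (F i j))"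
proof -
  have "expectation (\<lambda>\<omega>. \<Sum>i<n. \<Sum>j<n. F i j \<omega>) = (\<Sum>i<n. expectation (\<lambda>\<omega>. \<Sum>j<n. F i j \<omega>))"
    by (intro Bochner_Integration.integral_sum Bochner_Integration.integrable_sum assms) auto
  also have "\<dots> = (\<Sum>i<n. \<Sum>j<n. expectation (F i j))"
    by (intro sum.cong refl Bochner_Integration.integral_sum assms) auto
  finally show ?thesis .
qed

text \<open>By independence each entry contributes its expectation times \<open>s * t\<close>, and
  the squared entries of a unitary matrix add up to \<open>n\<close>. The mean is thus the same for
  every law of \<open>U\<close>.\<close>

lemma expectation_T:
  assumes s: "s \<in> {0..1}" and t: "t \<in> {0..1}"
  shows "expectation (T_process n U R C (s, t)) = real n * s * t"
proof -
  define f g :: "real \<Rightarrow> real" where "f = indicator {..s}" and "g = indicator {..t}"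
  have fg: "f \<in> borel_measurable borel" "g \<in> borel_measurable borel" "\<bar>f x\<bar> \<le> 1" "\<bar>g x\<bar> \<le> 1" for x
    by (auto simp: f_def g_def indicator_def)
  note fg(1,2)[measurable]
  have E: "expectation (\<lambda>\<omega>. A i j \<omega> * (f (R i \<omega>) * g (C j \<omega>))) = expectation (A i j) * (s * t)"
    if ij: "i < n" "j < n" for i j
  proof -
    define \<psi> where "\<psi> B = (cmod (B $$ (i, j)))\<^sup>2" for B
    have \<psi>: "\<psi> \<in> borel_measurable (mat_borel n (unitary_group n))"
      unfolding \<psi>_def using entry_measurable[OF ij] by measurable
    have \<psi>1: "\<bar>\<psi> B\<bar> \<le> 1" if "B \<in> unitary_group n" for B
      unfolding \<psi>_def using cmod_unitary_le[OF that ij] by simp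
    have "(\<integral>r. f r \<partial>uniform01) = s" "(\<integral>r. g r \<partial>uniform01) = t"
      unfolding f_def g_def using s t by (simp_all only: integral_indicator_uniform01)
    then have "expectation (\<lambda>\<omega>. \<psi> (U \<omega>) * (f (R i \<omega>) * g (C j \<omega>))) = expectation (\<lambda>\<omega>. \<psi> (U \<omega>)) * (s * t)"
      using expectation_A_RC[where f = f and g = g and f' = "\<lambda>_. 1" and g' = "\<lambda>_. 1" and \<psi> = \<psi> and i = i and j = j and k = i and l = j]
        fg \<psi> \<psi>1 ij by simp
    moreover have "A i j = (\<lambda>\<omega>. \<psi> (U \<omega>))" by (auto simp: \<psi>_def A_def)
    ultimately show ?thesis by simp
  qed
  have int: "integrable M (\<lambda>\<omega>. A i j \<omega> * (f (R i \<omega>) * g (C j \<omega>)))" if ij: "i < n" "j < n" for i j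
  proof (rule integrable_const_bound[where B = 1])
    show "AE \<omega> in M. norm (A i j \<omega> * (f (R i \<omega>) * g (C j \<omega>))) \<le> 1"
      unfolding real_norm_def abs_mult using A_le_1 A_nonneg ij fg(3,4) by (intro AE_I2 mult_le_one) auto
  qed (use ij in measurable)
  have "expectation (T_process n U R C (s, t)) = expectation (\<lambda>\<omega>. \<Sum>i<n. \<Sum>j<n. A i j \<omega> * (f (R i \<omega>) * g (C j \<omega>)))"
    by (simp add: T_process_def A_def f_def g_def mult.assoc)
  also have "\<dots> = (\<Sum>i<n. \<Sum>j<n. expectation (A i j) * (s * t))"
    by (subst expectation_double_sum) (use int E in \<open>auto intro!: sum.cong\<close>)
  also have "\<dots> = (\<Sum>i<n. \<Sum>j<n. expectation (A i j)) * (s * t)" by (simp add: sum_distrib_right)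
  also have "(\<Sum>i<n. \<Sum>j<n. expectation (A i j)) = expectation (\<lambda>\<omega>. \<Sum>i<n. \<Sum>j<n. A i j \<omega>)"
    by (rule expectation_double_sum[symmetric]) (rule A_integrable)
  also have "\<dots> = expectation (\<lambda>\<omega>. real n)"
    by (intro Bochner_Integration.integral_cong refl) (simp add: A_sums)
  finally show ?thesis by (simp add: prob_space)
qed

text \<open>The degenerate part of the Hoeffding decomposition given \<open>U\<close>. The linear
  part is \<open>L\<close> below; it does not involve \<open>U\<close> any more, which is why the
  limit is the same in all cases.\<close>

definition Z :: "real \<Rightarrow> real \<Rightarrow> 'w \<Rightarrow> real" where
  "Z s t \<omega> = (\<Sum>i<n. \<Sum>j<n. A i j \<omega> * (centered_ind s (R i \<omega>) * centered_ind t (C j \<omega>))) / sqrt n"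

abbreviation X :: "'w \<Rightarrow> real \<times> real \<Rightarrow> real" where
  "X \<equiv> normalized_T n M U R C"

definition L :: "real \<times> real \<Rightarrow> 'w \<Rightarrow> real" where
  "L p \<omega> = snd p * empirical n R (fst p) \<omega> + fst p * empirical n C (snd p) \<omega>"

lemma X_eq_T:
  assumes "s \<in> {0..1}" "t \<in> {0..1}"
  shows "X \<omega> (s, t) = (T_process n U R C (s, t) \<omega> - real n * s * t) / sqrt n"
  using assms by (simp add: normalized_T_def expectation_T unit_square_def)

lemma X_decomposition:
  assumes \<omega>: "\<omega> \<in> space M" and s: "s \<in> {0..1}" and t: "t \<in> {0..1}"
  shows "X \<omega> (s, t) = t * empirical n R s \<omega> + s * empirical n C t \<omega> + Z s t \<omega>"
proof -
  define r c where "r i = centered_ind s (R i \<omega>)" and "c j = centered_ind t (C j \<omega>)" for i j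
  have "T_process n U R C (s, t) \<omega> = (\<Sum>i<n. \<Sum>j<n. A i j \<omega> * (r i * c j) + A i j \<omega> * (t * r i) + A i j \<omega> * (s * c j) + A i j \<omega> * (s * t))"
    by (simp add: T_process_def A_def r_def c_def centered_ind_def algebra_simps)
  also have "\<dots> = (\<Sum>i<n. \<Sum>j<n. A i j \<omega> * (r i * c j)) + (\<Sum>i<n. \<Sum>j<n. A i j \<omega> * (t * r i)) +
      (\<Sum>i<n. \<Sum>j<n. A i j \<omega> * (s * c j)) + (\<Sum>i<n. \<Sum>j<n. A i j \<omega> * (s * t))"
    by (simp add: sum.distrib)
  also have "(\<Sum>i<n. \<Sum>j<n. A i j \<omega> * (t * r i)) = t * (\<Sum>i<n. r i)"
    by (simp add: A_sums[OF \<omega>] flip: sum_distrib_right sum_distrib_left)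
  also have "(\<Sum>i<n. \<Sum>j<n. A i j \<omega> * (s * c j)) = s * (\<Sum>j<n. c j)"
    by (subst sum.swap) (simp add: A_sums[OF \<omega>] flip: sum_distrib_right sum_distrib_left)
  also have "(\<Sum>i<n. \<Sum>j<n. A i j \<omega> * (s * t)) = real n * s * t"
    by (simp add: A_sums[OF \<omega>] flip: sum_distrib_right)
  finally show ?thesis
    unfolding X_eq_T[OF s t] by (simp add: Z_def empirical_def r_def c_def add_divide_distrib)
qed

text \<open>Adding back the mean leaves \<open>T_process / sqrt n\<close>, a sum of indicators with
  non-negative weights.\<close>

lemma X_mono:
  assumes "s \<in> {0..1}" "t \<in> {0..1}" "s' \<in> {0..1}" "t' \<in> {0..1}" "s \<le> s'" "t \<le> t'"
  shows "X \<omega> (s, t) + sqrt n * (s * t) \<le> X \<omega> (s', t') + sqrt n * (s' * t')"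
proof -
  have eq: "X \<omega> (s, t) + sqrt n * (s * t) = T_process n U R C (s, t) \<omega> / sqrt n"
    if "s \<in> {0..1}" "t \<in> {0..1}" for s t
  proof -
    have "sqrt n * (s * t) = real n * s * t / sqrt n" using n by (simp add: field_simps)
    then show ?thesis using X_eq_T[OF that] by (simp add: diff_divide_distrib)
  qed
  have "T_process n U R C (s, t) \<omega> \<le> T_process n U R C (s', t') \<omega>"
    using assms(5,6) unfolding T_process_def prod.case
    by (intro sum_mono mult_mono) (auto simp: indicator_def)
  then show ?thesis using assms by (simp add: eq divide_right_mono)
qed

lemma X_measurable: "X \<in> measurable M (borel_of_topology skorokhod_topology)"
proof -
  define v where "v k = (case k of Inl p \<Rightarrow> A (fst p) (snd p) | Inr (Inl i) \<Rightarrow> R i | Inr (Inr j) \<Rightarrow> C j)" for k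
  have "(\<lambda>\<omega>. trunc_path n (\<lambda>k\<in>trunc_coords n. v k \<omega>)) \<in> measurable M (borel_of_topology skorokhod_topology)"
    by (intro measurable_trunc_path) (auto simp: trunc_coords_def v_def)
  moreover have "X \<omega> = trunc_path n (\<lambda>k\<in>trunc_coords n. v k \<omega>)" for \<omega>
  proof (rule ext)
    fix p :: "real \<times> real"
    show "X \<omega> p = trunc_path n (\<lambda>k\<in>trunc_coords n. v k \<omega>) p"
    proof (cases "p \<in> unit_square")
      case True
      then have "X \<omega> (fst p, snd p) = (T_process n U R C (fst p, snd p) \<omega> - real n * fst p * snd p) / sqrt n"
        by (intro X_eq_T) (auto simp: unit_square_def)
      also have "T_process n U R C (fst p, snd p) \<omega> = (\<Sum>i<n. \<Sum>j<n. (\<lambda>k\<in>trunc_coords n. v k \<omega>) (Inl (i, j)) *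
          indicator {..fst p} ((\<lambda>k\<in>trunc_coords n. v k \<omega>) (Inr (Inl i))) * indicator {..snd p} ((\<lambda>k\<in>trunc_coords n. v k \<omega>) (Inr (Inr j))))"
        unfolding T_process_def prod.case
        by (intro sum.cong refl) (auto simp: v_def trunc_coords_def A_def)
      finally show ?thesis using True by (simp add: trunc_path_def)
    next
      case False
      then show ?thesis by (simp add: trunc_path_def normalized_T_def)
    qed
  qed
  ultimately show ?thesis by (simp add: fun_eq_iff[of X] cong: measurable_cong)
qed

section \<open>Uniform smallness of the degenerate part\<close>

lemma Z_measurable [measurable]: "Z s t \<in> borel_measurable M"
  unfolding Z_def by measurable

lemma Z_abs_le:
  assumes "s \<in> {0..1}" "t \<in> {0..1}" "\<omega> \<in> space M"
  shows "\<bar>Z s t \<omega>\<bar> \<le> sqrt n"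
proof -
  have "\<bar>\<Sum>i<n. \<Sum>j<n. A i j \<omega> * (centered_ind s (R i \<omega>) * centered_ind t (C j \<omega>))\<bar> \<le> (\<Sum>i<n. \<Sum>j<n. A i j \<omega> * 1)"
  proof (intro order_trans[OF sum_abs] sum_mono)
    fix i j
    have "\<bar>centered_ind s (R i \<omega>) * centered_ind t (C j \<omega>)\<bar> \<le> 1"
      unfolding abs_mult using assms by (intro mult_le_one centered_ind_abs_le) auto
    then show "\<bar>A i j \<omega> * (centered_ind s (R i \<omega>) * centered_ind t (C j \<omega>))\<bar> \<le> A i j \<omega> * 1"
      using A_nonneg[of i j \<omega>] unfolding abs_mult[of "A i j \<omega>"] by (simp add: mult_left_le)
  qed
  also have "\<dots> = real n" using assms by (simp add: A_sums)
  finally show ?thesis using n unfolding Z_def by (simp add: abs_divide divide_le_eq)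
qed

lemma integral_centered_ind_sq_le_1:
  assumes t: "t \<in> {0..1}"
  shows "(\<integral>r. (centered_ind t r)\<^sup>2 \<partial>uniform01) \<le> 1"
proof -
  have "(\<integral>r. (centered_ind t r)\<^sup>2 \<partial>uniform01) = t - t * t"
    using integral_centered_ind_mult[OF t t] by (simp add: power2_eq_square)
  moreover have "0 \<le> t * t" "t \<le> 1" using t by simp_all
  ultimately show ?thesis by linarith
qed

lemma A2_nonneg: "0 \<le> A2"
  unfolding A2_def by (intro integral_nonneg_AE) (auto intro!: sum_nonneg)

text \<open>\<open>second_moment_bilinear\<close> is applied with the increment of the row
  indicator, whose variance is at most \<open>s' - s\<close>, and the column indicator, whose
  variance is at most 1.\<close>

lemma Z_increment:
  assumes s: "s \<in> {0..1}" and s': "s' \<in> {0..1}" and le: "s \<le> s'" and t: "t \<in> {0..1}" and v: "A2 \<le> v"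
  shows "expectation (\<lambda>\<omega>. (Z s' t \<omega> - Z s t \<omega>)\<^sup>2) \<le> v / n * (s' - s)"
proof -
  define \<rho> where "\<rho> r = centered_ind s' r - centered_ind s r" for r
  note \<rho> = centered_ind_increment[OF s s' le, folded \<rho>_def]
  have [measurable]: "\<rho> \<in> borel_measurable borel" unfolding \<rho>_def by measurable
  have "Z s' t \<omega> - Z s t \<omega> = (\<Sum>i<n. \<Sum>j<n. A i j \<omega> * (\<rho> (R i \<omega>) * centered_ind t (C j \<omega>))) / sqrt n" for \<omega>
    unfolding Z_def \<rho>_def by (simp add: algebra_simps sum_subtractf diff_divide_distrib)
  then have "expectation (\<lambda>\<omega>. (Z s' t \<omega> - Z s t \<omega>)\<^sup>2) =
      A2 * ((\<integral>r. (\<rho> r)\<^sup>2 \<partial>uniform01) * (\<integral>r. (centered_ind t r)\<^sup>2 \<partial>uniform01)) / n"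
    using \<rho>(1,2) centered_ind_abs_le[OF t] integral_centered_ind[OF t]
    by (simp add: power_divide second_moment_bilinear)
  also have "\<dots> \<le> v * ((s' - s) * 1) / n"
    using \<rho>(3) integral_centered_ind_sq_le_1[OF t] v A2_nonneg le
    by (intro divide_right_mono mult_mono) auto
  finally show ?thesis by simp
qed

text \<open>At 0 and 1 the centered indicator has variance 0. This anchors the chaining for
  \<open>Z\<close>, which starts from these two edges.\<close>

lemma Z_boundary:
  assumes s: "s \<in> {0, 1}" and t: "t \<in> {0..1}"
  shows "expectation (\<lambda>\<omega>. (Z s t \<omega>)\<^sup>2) = 0"
proof -
  have s01: "s \<in> {0..1}" using s by auto
  have "(\<integral>r. (centered_ind s r)\<^sup>2 \<partial>uniform01) = 0"
    using integral_centered_ind_mult[OF s01 s01] s by (auto simp: power2_eq_square)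
  then show ?thesis
    using centered_ind_abs_le[OF t] integral_centered_ind[OF t] centered_ind_abs_le[OF s01] integral_centered_ind[OF s01]
    unfolding Z_def by (simp add: power_divide second_moment_bilinear)
qed

text \<open>For each of the \<open>2 ^ l + 1\<close> values of the second coordinate, the first one
  is chained from level 0. The \<open>2 ^ a\<close> increments of level \<open>a\<close> have second
  moments \<open>v / n * (1/2) ^ a\<close>, so all levels cost the same and equal thresholds
  \<open>\<delta> / l\<close> are used: \<open>l\<close> levels, each with a factor
  \<open>l^2 / \<delta>^2\<close>, which makes \<open>l ^ 3\<close>. One more
  \<open>\<delta>\<close> is spent at the edges.\<close>

lemma Z_uniform:
  fixes \<delta> v :: real
  assumes l: "1 \<le> l" and \<delta>: "0 < \<delta>" and v: "A2 \<le> v"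
  obtains B where "B \<in> events" "prob B \<le> v * (2 ^ l + 1) * real l ^ 3 / (n * \<delta>\<^sup>2)"
    "\<And>\<omega> i k. \<omega> \<in> space M - B \<Longrightarrow> i \<le> 2 ^ l \<Longrightarrow> k \<le> 2 ^ l \<Longrightarrow> \<bar>Z (real i / 2 ^ l) (real k / 2 ^ l) \<omega>\<bar> \<le> 2 * \<delta>"
proof -
  define J where "J = (SIGMA a:{0<..l}. {..<2 ^ a :: nat}) \<times> {..2 ^ l :: nat}"
  define J' where "J' = {0, 1::real} \<times> {..2 ^ l :: nat}"
  define D where "D = (\<lambda>((a :: nat, j :: nat), k :: nat) \<omega>. Z (real (Suc j) / 2 ^ a) (real k / 2 ^ l) \<omega> - Z (real j / 2 ^ a) (real k / 2 ^ l) \<omega>)"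
  define D' where "D' = (\<lambda>(s, k :: nat) \<omega>. Z s (real k / 2 ^ l) \<omega>)"
  define B1 where "B1 = {\<omega> \<in> space M. \<exists>i\<in>J. \<delta> / l < \<bar>D i \<omega>\<bar>}"
  define B2 where "B2 = {\<omega> \<in> space M. \<exists>i\<in>J'. \<delta> < \<bar>D' i \<omega>\<bar>}"
  note grid = dyadic_point_in_unit
  have J: "finite J" "finite J'" by (simp_all add: J_def J'_def)
  have "B1 \<in> events \<and> prob B1 \<le> (\<Sum>i\<in>J. v / n * (1/2) ^ fst (fst i) / (\<delta> / l)\<^sup>2)"
  proof -
    have D_meas: "D i \<in> borel_measurable M" for i unfolding D_def by (cases i rule: prod.exhaust[case_product prod.exhaust]) (auto split: prod.splits)
    have b: "\<bar>D i \<omega>\<bar> \<le> 2 * sqrt n" if iJ: "i \<in> J" and \<omega>: "\<omega> \<in> space M" for i \<omega>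
    proof -
      obtain a j k where i: "i = ((a, j), k)" "j < 2 ^ a" "k \<le> 2 ^ l" using iJ by (auto simp: J_def)
      have "\<bar>Z (real (Suc j) / 2 ^ a) (real k / 2 ^ l) \<omega>\<bar> \<le> sqrt n" "\<bar>Z (real j / 2 ^ a) (real k / 2 ^ l) \<omega>\<bar> \<le> sqrt n"
        using i(2,3) \<omega> by (intro Z_abs_le grid; simp)+
      then show ?thesis unfolding i(1) D_def by simp
    qed
    have m: "expectation (\<lambda>\<omega>. (D i \<omega>)\<^sup>2) \<le> v / n * (1/2) ^ fst (fst i)" if iJ: "i \<in> J" for i
    proof -
      obtain a j k where i: "i = ((a, j), k)" "j < 2 ^ a" "k \<le> 2 ^ l" using iJ by (auto simp: J_def)
      have "real (Suc j) / 2 ^ a - real j / 2 ^ a = (1/2) ^ a" by (simp add: field_simps)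
      moreover have "expectation (\<lambda>\<omega>. (D ((a, j), k) \<omega>)\<^sup>2) \<le> v / n * (real (Suc j) / 2 ^ a - real j / 2 ^ a)"
        unfolding D_def prod.case using i(2,3) v
        by (intro Z_increment grid divide_right_mono) auto
      ultimately show ?thesis unfolding i(1) by simp
    qed
    have pos: "0 < \<delta> / l" if "i \<in> J" for i using l \<delta> by simp
    show ?thesis
      unfolding B1_def using union_markov[OF J(1) D_meas b pos _ m] by simp
  qed
  moreover have "(\<Sum>i\<in>J. v / n * (1/2) ^ fst (fst i) / (\<delta> / l)\<^sup>2) = v * (2 ^ l + 1) * real l ^ 3 / (n * \<delta>\<^sup>2)"
  proof -
    have "(\<Sum>i\<in>J. v / n * (1/2) ^ fst (fst i) / (\<delta> / l)\<^sup>2) =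
        (\<Sum>i\<in>(SIGMA a:{0<..l}. {..<(2::nat) ^ a}). \<Sum>k\<in>{..(2::nat) ^ l}. v / n * (1/2) ^ fst i / (\<delta> / l)\<^sup>2)"
      unfolding J_def by (subst sum.cartesian_product) (auto intro!: sum.cong)
    also have "\<dots> = (\<Sum>a\<in>{0<..l}. \<Sum>j<(2::nat) ^ a. \<Sum>k\<in>{..(2::nat) ^ l}. v / n * (1/2) ^ a / (\<delta> / l)\<^sup>2)"
      by (subst sum.Sigma) (auto intro!: sum.cong)
    also have "\<dots> = (\<Sum>a\<in>{0<..l}. (2 ^ l + 1) * (v / n) * real l ^ 2 / \<delta>\<^sup>2)"
    proof (rule sum.cong[OF refl])
      fix a
      have "(\<Sum>j<(2::nat) ^ a. \<Sum>k\<in>{..(2::nat) ^ l}. v / n * (1/2) ^ a / (\<delta> / l)\<^sup>2) =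
          (2 ^ a * (1/2) ^ a) * ((2 ^ l + 1) * (v / n) * real l ^ 2 / \<delta>\<^sup>2)"
        by (simp add: power_divide mult_ac)
      also have "(2::real) ^ a * (1/2) ^ a = 1" by (simp flip: power_mult_distrib)
      finally show "(\<Sum>j<(2::nat) ^ a. \<Sum>k\<in>{..(2::nat) ^ l}. v / n * (1/2) ^ a / (\<delta> / l)\<^sup>2) =
          (2 ^ l + 1) * (v / n) * real l ^ 2 / \<delta>\<^sup>2" by simp
    qed
    also have "\<dots> = v * (2 ^ l + 1) * real l ^ 3 / (n * \<delta>\<^sup>2)"
      by (simp add: power2_eq_square power3_eq_cube mult_ac)
    finally show ?thesis .
  qed
  moreover have "B2 \<in> events \<and> prob B2 \<le> (\<Sum>i\<in>J'. 0 / \<delta>\<^sup>2)"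
  proof -
    have D_meas: "D' i \<in> borel_measurable M" for i unfolding D'_def by (cases i) auto
    have b: "\<bar>D' i \<omega>\<bar> \<le> sqrt n" if "i \<in> J'" "\<omega> \<in> space M" for i \<omega>
      using that by (auto simp: J'_def D'_def intro!: Z_abs_le grid simp del: power_one_right)
    have m: "expectation (\<lambda>\<omega>. (D' i \<omega>)\<^sup>2) \<le> 0" if iJ: "i \<in> J'" for i
    proof -
      obtain s k where i: "i = (s, k)" "s \<in> {0, 1}" "k \<le> 2 ^ l" using iJ by (cases i) (auto simp: J'_def)
      show ?thesis using Z_boundary[OF i(2) grid[OF i(3)]] unfolding i(1) D'_def by simp
    qed
    show ?thesis
      unfolding B2_def using union_markov[OF J(2) D_meas b \<delta> _ m] by simp
  qed
  moreover have "prob (B1 \<union> B2) \<le> prob B1 + prob B2" if "B1 \<in> events" "B2 \<in> events"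
    using that by (rule measure_Un_le)
  ultimately have B: "B1 \<union> B2 \<in> events" "prob (B1 \<union> B2) \<le> v * (2 ^ l + 1) * real l ^ 3 / (n * \<delta>\<^sup>2)"
    by auto
  show thesis
  proof (rule that[OF B])
    fix \<omega> and i k :: nat assume \<omega>: "\<omega> \<in> space M - (B1 \<union> B2)" and i: "i \<le> 2 ^ l" and k: "k \<le> 2 ^ l"
    define x where "x s = Z s (real k / 2 ^ l) \<omega>" for s
    have inc: "\<bar>x (real (Suc j) / 2 ^ a) - x (real j / 2 ^ a)\<bar> \<le> \<delta> / l" if "0 < a" "a \<le> l" "j < 2 ^ a" for a j
    proof -
      have "((a, j), k) \<in> J" using that k by (simp add: J_def)
      then have "\<not> \<delta> / l < \<bar>D ((a, j), k) \<omega>\<bar>" using \<omega> unfolding B1_def by blast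
      then show ?thesis by (simp add: D_def x_def)
    qed
    have "\<bar>x (real i / 2 ^ l) - x (dyadic_floor 0 (real i / 2 ^ l))\<bar> \<le> (\<Sum>a\<in>{0<..l}. \<delta> / l)"
      using inc by (rule dyadic_chain_le[OF le0 i])
    also have "\<dots> = \<delta>" using l by simp
    finally have 1: "\<bar>x (real i / 2 ^ l) - x (dyadic_floor 0 (real i / 2 ^ l))\<bar> \<le> \<delta>" .
    \<comment> \<open>Level 0 consists of 0 and 1 only, so the chain ends on an edge, where the
      complement of \<open>B2\<close> controls \<open>Z\<close>.\<close>
    obtain m :: nat where m: "m \<le> 2 ^ 0" "dyadic_floor 0 (real i / 2 ^ l) = real m / 2 ^ 0"
      by (rule dyadic_floor_eq[OF grid[OF i]])
    then have "dyadic_floor 0 (real i / 2 ^ l) = 0 \<or> dyadic_floor 0 (real i / 2 ^ l) = 1" by (cases m) auto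
    then have "(dyadic_floor 0 (real i / 2 ^ l), k) \<in> J'" using k by (auto simp: J'_def)
    then have "\<not> \<delta> < \<bar>D' (dyadic_floor 0 (real i / 2 ^ l), k) \<omega>\<bar>" using \<omega> unfolding B2_def by blast
    then have "\<bar>x (dyadic_floor 0 (real i / 2 ^ l))\<bar> \<le> \<delta>" by (simp add: D'_def x_def)
    then show "\<bar>Z (real i / 2 ^ l) (real k / 2 ^ l) \<omega>\<bar> \<le> 2 * \<delta>" using 1 by (simp add: x_def)
  qed
qed

text \<open>\<open>decomposition_close\<close> outside the exceptional events of the two samples and
  of \<open>Z\<close>, with \<open>w = sqrt n\<close>, \<open>K = sqrt (2 ^ q)\<close> and
  \<open>\<delta> = 2 * e\<close>; the last choice turns \<open>4 * e\<close> into
  \<open>6 * e\<close>.\<close>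

lemma X_close_L:
  fixes e v :: real
  assumes q: "1 \<le> q" "q < l" and e: "0 < e" and v: "A2 \<le> v"
  obtains B where "B \<in> events"
    "prob B \<le> 2 * ((3 * (\<Sum>a\<in>{q<..l}. real a ^ 8 * (1/2) ^ a) + real l ^ 9 / n) / e ^ 4 + 8 * (1/2) ^ q)
      + v * (2 ^ l + 1) * real l ^ 3 / (n * e\<^sup>2)"
    "\<And>\<omega> p. \<omega> \<in> space M - B \<Longrightarrow> p \<in> unit_square \<Longrightarrow>
      \<bar>X \<omega> p - step_path q (\<lambda>p. L p \<omega>) p\<bar> \<le> 6 * e + 4 * sqrt (2 ^ q) * (1/2) ^ q + 2 * sqrt n * (1/2) ^ l"
proof -
  let ?b = "(3 * (\<Sum>a\<in>{q<..l}. real a ^ 8 * (1/2) ^ a) + real l ^ 9 / n) / e ^ 4 + 8 * (1/2) ^ q"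
  obtain B1 where B1: "B1 \<in> events" "prob B1 \<le> ?b"
    "\<And>\<omega> s u. \<omega> \<in> space M - B1 \<Longrightarrow> s \<in> {0..1} \<Longrightarrow> u \<in> {dyadic_floor l s, dyadic_ceil l s} \<Longrightarrow>
      \<bar>empirical n R u \<omega> - empirical n R (dyadic_floor q s) \<omega>\<bar> \<le> 2 * e"
    "\<And>\<omega> s. \<omega> \<in> space M - B1 \<Longrightarrow> s \<in> {0..1} \<Longrightarrow> \<bar>empirical n R (dyadic_floor q s) \<omega>\<bar> \<le> sqrt (2 ^ q)"
    using R.empirical_modulus[OF q e] by blast
  obtain B2 where B2: "B2 \<in> events" "prob B2 \<le> ?b"
    "\<And>\<omega> s u. \<omega> \<in> space M - B2 \<Longrightarrow> s \<in> {0..1} \<Longrightarrow> u \<in> {dyadic_floor l s, dyadic_ceil l s} \<Longrightarrow>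
      \<bar>empirical n C u \<omega> - empirical n C (dyadic_floor q s) \<omega>\<bar> \<le> 2 * e"
    "\<And>\<omega> s. \<omega> \<in> space M - B2 \<Longrightarrow> s \<in> {0..1} \<Longrightarrow> \<bar>empirical n C (dyadic_floor q s) \<omega>\<bar> \<le> sqrt (2 ^ q)"
    using C.empirical_modulus[OF q e] by blast
  obtain B3 where B3: "B3 \<in> events" "prob B3 \<le> v * (2 ^ l + 1) * real l ^ 3 / (n * e\<^sup>2)"
    "\<And>\<omega> i k. \<omega> \<in> space M - B3 \<Longrightarrow> i \<le> 2 ^ l \<Longrightarrow> k \<le> 2 ^ l \<Longrightarrow> \<bar>Z (real i / 2 ^ l) (real k / 2 ^ l) \<omega>\<bar> \<le> 2 * e"
    using Z_uniform[of l e v] q e v by auto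
  have B: "B1 \<union> B2 \<union> B3 \<in> events" using B1(1) B2(1) B3(1) by auto
  have "prob (B1 \<union> B2 \<union> B3) \<le> prob (B1 \<union> B2) + prob B3"
    using B1(1) B2(1) B3(1) by (intro measure_Un_le) auto
  moreover have "prob (B1 \<union> B2) \<le> prob B1 + prob B2" using B1(1) B2(1) by (rule measure_Un_le)
  ultimately have pB: "prob (B1 \<union> B2 \<union> B3) \<le> 2 * ?b + v * (2 ^ l + 1) * real l ^ 3 / (n * e\<^sup>2)"
    using B1(2) B2(2) B3(2) unfolding mult_2 by linarith
  show thesis
  proof (rule that[OF B pB])
    fix \<omega> p assume \<omega>: "\<omega> \<in> space M - (B1 \<union> B2 \<union> B3)" and p: "p \<in> unit_square"
    have st: "fst p \<in> {0..1}" "snd p \<in> {0..1}" using p by (auto simp: unit_square_def)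
    have "\<bar>X \<omega> (fst p, snd p) - (dyadic_floor q (snd p) * empirical n R (dyadic_floor q (fst p)) \<omega> +
        dyadic_floor q (fst p) * empirical n C (dyadic_floor q (snd p)) \<omega>)\<bar>
        \<le> 4 * e + 4 * sqrt (2 ^ q) * (1/2) ^ q + 2 * e + 2 * sqrt n * (1/2) ^ l"
    proof (rule decomposition_close[of q l "sqrt n" "\<lambda>s t. X \<omega> (s, t)" "\<lambda>s. empirical n R s \<omega>" "\<lambda>t. empirical n C t \<omega>" "\<lambda>s t. Z s t \<omega>"])
      show "X \<omega> (s, t) = t * empirical n R s \<omega> + s * empirical n C t \<omega> + Z s t \<omega>" if "s \<in> {0..1}" "t \<in> {0..1}" for s t
        using \<omega> that by (intro X_decomposition) auto
      show "X \<omega> (s, t) + sqrt n * (s * t) \<le> X \<omega> (s', t') + sqrt n * (s' * t')"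
        if "s \<in> {0..1}" "t \<in> {0..1}" "s' \<in> {0..1}" "t' \<in> {0..1}" "s \<le> s'" "t \<le> t'" for s t s' t'
        using that by (rule X_mono)
    qed (use \<omega> B1(3,4) B2(3,4) B3(3) st q in auto)
    then show "\<bar>X \<omega> p - step_path q (\<lambda>p. L p \<omega>) p\<bar> \<le> 6 * e + 4 * sqrt (2 ^ q) * (1/2) ^ q + 2 * sqrt n * (1/2) ^ l"
      using p by (simp add: step_path_def L_def)
  qed
qed

section \<open>Moments and characteristic function of the linear part\<close>

lemma L_measurable [measurable]: "L p \<in> borel_measurable M"
  unfolding L_def by measurable

lemma L_second_moment:
  assumes "p \<in> unit_square"
  shows "integrable M (\<lambda>\<omega>. (L p \<omega>)\<^sup>2)" "expectation (\<lambda>\<omega>. (L p \<omega>)\<^sup>2) \<le> 4"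
proof -
  have p: "fst p \<in> {0..1}" "snd p \<in> {0..1}" using assms by (auto simp: unit_square_def)
  have le: "(L p \<omega>)\<^sup>2 \<le> 2 * (empirical n R (fst p) \<omega>)\<^sup>2 + 2 * (empirical n C (snd p) \<omega>)\<^sup>2" for \<omega>
  proof -
    define a b where "a = snd p * empirical n R (fst p) \<omega>" and "b = fst p * empirical n C (snd p) \<omega>"
    have "(L p \<omega>)\<^sup>2 \<le> 2 * a\<^sup>2 + 2 * b\<^sup>2"
      using sum_squares_ge_zero[of "a - b" 0] unfolding L_def a_def[symmetric] b_def[symmetric]
      by (simp add: power2_eq_square algebra_simps)
    moreover have "a\<^sup>2 \<le> 1 * (empirical n R (fst p) \<omega>)\<^sup>2" "b\<^sup>2 \<le> 1 * (empirical n C (snd p) \<omega>)\<^sup>2"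
      unfolding a_def b_def power_mult_distrib using p by (intro mult_right_mono power_le_one; simp)+
    ultimately show ?thesis by linarith
  qed
  have sq: "(empirical n R (fst p) \<omega>)\<^sup>2 \<le> n" "(empirical n C (snd p) \<omega>)\<^sup>2 \<le> n" for \<omega>
    using power_mono[OF R.empirical_abs_le[OF p(1), of \<omega>] abs_ge_zero, of 2]
      power_mono[OF C.empirical_abs_le[OF p(2), of \<omega>] abs_ge_zero, of 2] by simp_all
  have int: "integrable M (\<lambda>\<omega>. (empirical n R (fst p) \<omega>)\<^sup>2)" "integrable M (\<lambda>\<omega>. (empirical n C (snd p) \<omega>)\<^sup>2)"
    using sq by (intro integrable_const_bound[where B = "real n"]; simp)+
  show L: "integrable M (\<lambda>\<omega>. (L p \<omega>)\<^sup>2)"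
  proof (rule integrable_const_bound[where B = "4 * real n"])
    have "(L p \<omega>)\<^sup>2 \<le> 4 * real n" for \<omega> using le[of \<omega>] sq[of \<omega>] by linarith
    then show "AE \<omega> in M. norm ((L p \<omega>)\<^sup>2) \<le> 4 * real n" by simp
  qed measurable
  have "expectation (\<lambda>\<omega>. (L p \<omega>)\<^sup>2) \<le> expectation (\<lambda>\<omega>. 2 * (empirical n R (fst p) \<omega>)\<^sup>2 + 2 * (empirical n C (snd p) \<omega>)\<^sup>2)"
    using L int le by (intro integral_mono) auto
  also have "\<dots> \<le> 4"
    using int R.empirical_moments(1)[OF p(1)] C.empirical_moments(1)[OF p(2)] by simp
  finally show "expectation (\<lambda>\<omega>. (L p \<omega>)\<^sup>2) \<le> 4" .
qed

text \<open>A linear combination of values of \<open>L\<close> is a sum of one function of the row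
  variables and one function of the column variables. Independence and equal laws reduce its
  characteristic function to two \<open>n\<close>-th powers.\<close>

lemma char_L:
  assumes J: "finite J"
  shows "(CLINT \<omega>|M. iexp (\<Sum>p\<in>J. a p * L p \<omega>)) =
    (CLINT r|uniform01. iexp ((\<Sum>p\<in>J. a p * snd p * centered_ind (fst p) r) / sqrt n)) ^ n *
    (CLINT r|uniform01. iexp ((\<Sum>p\<in>J. a p * fst p * centered_ind (snd p) r) / sqrt n)) ^ n"
proof -
  define f where "f r = (\<Sum>p\<in>J. a p * snd p * centered_ind (fst p) r)" for r
  define g where "g r = (\<Sum>p\<in>J. a p * fst p * centered_ind (snd p) r)" for r
  define h where "h k r = iexp ((case k of Inl _ \<Rightarrow> f r | Inr _ \<Rightarrow> g r) / sqrt n)" for k :: "nat + nat" and r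
  have [measurable]: "f \<in> borel_measurable borel" "g \<in> borel_measurable borel"
    unfolding f_def g_def by measurable
  have eq: "(\<Sum>p\<in>J. a p * L p \<omega>) = (\<Sum>i<n. f (R i \<omega>)) / sqrt n + (\<Sum>i<n. g (C i \<omega>)) / sqrt n" for \<omega>
  proof -
    have "(\<Sum>i<n. f (R i \<omega>)) = (\<Sum>p\<in>J. a p * snd p * (\<Sum>i<n. centered_ind (fst p) (R i \<omega>)))"
      unfolding f_def by (subst sum.swap) (simp add: sum_distrib_left)
    moreover have "(\<Sum>i<n. g (C i \<omega>)) = (\<Sum>p\<in>J. a p * fst p * (\<Sum>i<n. centered_ind (snd p) (C i \<omega>)))"
      unfolding g_def by (subst sum.swap) (simp add: sum_distrib_left)
    moreover have "a p * L p \<omega> = (a p * snd p * (\<Sum>i<n. centered_ind (fst p) (R i \<omega>))) / sqrt n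
        + (a p * fst p * (\<Sum>i<n. centered_ind (snd p) (C i \<omega>))) / sqrt n" for p
      by (simp add: L_def empirical_def distrib_left mult.assoc)
    ultimately show ?thesis by (simp add: sum.distrib sum_divide_distrib)
  qed
  have iexp_sum: "(\<Prod>i<n. iexp (h i / sqrt n)) = iexp ((\<Sum>i<n. h i) / sqrt n)" for h :: "nat \<Rightarrow> real"
    by (simp add: exp_sum sum_divide_distrib sum_distrib_left)
  have "iexp (\<Sum>p\<in>J. a p * L p \<omega>) = (\<Prod>k\<in>I. h k (\<xi> k \<omega>))" for \<omega>
  proof -
    have "(\<Prod>k\<in>I. h k (\<xi> k \<omega>)) = (\<Prod>i<n. iexp (f (R i \<omega>) / sqrt n)) * (\<Prod>i<n. iexp (g (C i \<omega>) / sqrt n))"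
      by (simp add: prod.Plus h_def)
    also have "\<dots> = iexp ((\<Sum>i<n. f (R i \<omega>)) / sqrt n + (\<Sum>i<n. g (C i \<omega>)) / sqrt n)"
      unfolding iexp_sum by (simp only: of_real_add distrib_left exp_add)
    finally show ?thesis unfolding eq by (rule sym)
  qed
  then have "(CLINT \<omega>|M. iexp (\<Sum>p\<in>J. a p * L p \<omega>)) = (CLINT \<omega>|M. (\<Prod>k\<in>I. h k (\<xi> k \<omega>)))" by simp
  also have "\<dots> = (\<Prod>k\<in>I. CLINT r|uniform01. h k r)"
  proof (rule expectation_prod_\<xi>[where B = 1])
    show "h k \<in> borel_measurable borel" for k unfolding h_def by (cases k) simp_all
  qed (simp add: h_def)
  also have "\<dots> = (CLINT r|uniform01. iexp (f r / sqrt n)) ^ n * (CLINT r|uniform01. iexp (g r / sqrt n)) ^ n"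
    by (simp add: prod.Plus h_def)
  finally show ?thesis by (simp add: f_def g_def)
qed

end

section \<open>The second moment of the squared entries\<close>

lemma mat_mult_index_sum:
  assumes "V \<in> carrier_mat n n" "A \<in> carrier_mat n n" "i < n" "j < n"
  shows "(V * A) $$ (i, j) = (\<Sum>m<n. V $$ (i, m) * A $$ (m, j))"
  using assms by (auto simp: scalar_prod_def lessThan_atLeast0 intro!: sum.cong)

lemma real_entries:
  assumes "elements_mat A \<subseteq> \<real>" "A \<in> carrier_mat n n" "i < n" "j < n"
  shows "A $$ (i, j) \<in> \<real>"
proof -
  have "A $$ (i, j) \<in> elements_mat A" unfolding elements_mat_def using assms by force
  then show ?thesis using assms(1) by blast
qed

lemma unitary_group_mult:
  assumes V: "V \<in> unitary_group n" and A: "A \<in> unitary_group n"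
  shows "V * A \<in> unitary_group n"
proof -
  have c: "V \<in> carrier_mat n n" "A \<in> carrier_mat n n" "V * A \<in> carrier_mat n n"
    and c': "mat_adjoint V \<in> carrier_mat n n" "mat_adjoint A \<in> carrier_mat n n"
    and u: "mat_adjoint V * V = 1\<^sub>m n" "mat_adjoint A * A = 1\<^sub>m n"
    using V A by (auto simp: unitary_group_def mat_adjoint_def)
  have "mat_adjoint (V * A) = mat_adjoint A * mat_adjoint V"
  proof (rule eq_matI)
    fix i j assume "i < dim_row (mat_adjoint A * mat_adjoint V)" "j < dim_col (mat_adjoint A * mat_adjoint V)"
    then have ij: "i < n" "j < n" using c' by auto
    show "mat_adjoint (V * A) $$ (i, j) = (mat_adjoint A * mat_adjoint V) $$ (i, j)"
      unfolding mat_adjoint_index[OF c(3) ij] mat_mult_index_sum[OF c(1,2) ij(2,1)] mat_mult_index_sum[OF c'(2,1) ij]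
      using c ij by (auto simp: mat_adjoint_index mult.commute intro!: sum.cong)
  qed (use c in \<open>auto simp: mat_adjoint_def\<close>)
  then have "mat_adjoint (V * A) * (V * A) = mat_adjoint A * mat_adjoint V * (V * A)" by simp
  also have "\<dots> = mat_adjoint A * (mat_adjoint V * (V * A))" using c c' by (intro assoc_mult_mat) auto
  also have "mat_adjoint V * (V * A) = mat_adjoint V * V * A" using c c' by (intro assoc_mult_mat[symmetric]) auto
  finally show ?thesis using u c by (simp add: unitary_group_def)
qed

lemma orthogonal_group_mult:
  assumes V: "V \<in> orthogonal_group n" and A: "A \<in> orthogonal_group n"
  shows "V * A \<in> orthogonal_group n"
proof -
  have c: "V \<in> carrier_mat n n" "A \<in> carrier_mat n n" "V * A \<in> carrier_mat n n"
    and r: "elements_mat V \<subseteq> \<real>" "elements_mat A \<subseteq> \<real>"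
    and u: "transpose_mat V * V = 1\<^sub>m n" "transpose_mat A * A = 1\<^sub>m n"
    using V A by (auto simp: orthogonal_group_def)
  have "(V * A) $$ (i, j) \<in> \<real>" if ij: "i < n" "j < n" for i j
    unfolding mat_mult_index_sum[OF c(1,2) ij] using r c ij
    by (intro sum_in_Reals Reals_mult real_entries) auto
  then have "elements_mat (V * A) \<subseteq> \<real>" using c by (auto simp: elements_mat_def)
  moreover have "transpose_mat (V * A) * (V * A) = transpose_mat A * transpose_mat V * (V * A)"
    using c by (simp add: transpose_mult)
  moreover have "\<dots> = transpose_mat A * (transpose_mat V * (V * A))" using c by (intro assoc_mult_mat) auto
  moreover have "transpose_mat V * (V * A) = transpose_mat V * V * A" using c by (intro assoc_mult_mat[symmetric]) auto
  ultimately show ?thesis using u c by (simp add: orthogonal_group_def)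
qed

lemma left_mult_measurable:
  assumes G: "G \<subseteq> carrier_mat n n" "\<And>A. A \<in> G \<Longrightarrow> V * A \<in> G" and V: "V \<in> carrier_mat n n"
  shows "(\<lambda>A. V * A) \<in> measurable (mat_borel n G) (mat_borel n G)"
proof -
  have space: "(\<lambda>A. V * A) \<in> space (mat_borel n G) \<rightarrow> G" using G(2) by simp
  have "(\<lambda>A. (V * A) $$ ij) \<in> borel_measurable (mat_borel n G)" if ij: "ij \<in> {..<n} \<times> {..<n}" for ij
  proof -
    obtain i j where ij: "ij = (i, j)" "i < n" "j < n" using ij by auto
    have "(\<lambda>A. \<Sum>m<n. V $$ (i, m) * A $$ (m, j)) \<in> borel_measurable (mat_borel n G)"
      using ij by (intro borel_measurable_sum borel_measurable_times entry_measurable) auto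
    then show ?thesis
      unfolding ij(1) using G(1)
      by (subst measurable_cong[where g = "\<lambda>A. \<Sum>m<n. V $$ (i, m) * A $$ (m, j)"])
        (auto intro!: mat_mult_index_sum V ij)
  qed
  then have m: "(\<lambda>A. \<lambda>ij\<in>{..<n} \<times> {..<n}. (V * A) $$ ij) \<in> measurable (mat_borel n G) (\<Pi>\<^sub>M ij\<in>{..<n} \<times> {..<n}. borel)"
    by (rule measurable_restrict)
  have "(\<lambda>A. \<lambda>(i, j)\<in>{..<n} \<times> {..<n}. (V * A) $$ (i, j)) = (\<lambda>A. \<lambda>ij\<in>{..<n} \<times> {..<n}. (V * A) $$ ij)"
    by (auto simp: fun_eq_iff restrict_def)
  with m have "(\<lambda>A. \<lambda>(i, j)\<in>{..<n} \<times> {..<n}. (V * A) $$ (i, j)) \<in> measurable (mat_borel n G) (\<Pi>\<^sub>M ij\<in>{..<n} \<times> {..<n}. borel)"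
    by (simp only:)
  from measurable_vimage_algebra2[OF space this]
  show ?thesis by (simp only: mat_borel_def)
qed

text \<open>
  Invariance under the reflection that mixes the rows \<open>k\<close> and \<open>l\<close> by a Hadamard matrix already
  yields a bound on the fourth moments of the entries.
\<close>

definition hadamard_mat :: "nat \<Rightarrow> nat \<Rightarrow> nat \<Rightarrow> complex mat" where
  "hadamard_mat n k l = mat n n (\<lambda>(i, j).
     if i = k \<and> j = k \<or> i = k \<and> j = l \<or> i = l \<and> j = k then complex_of_real (1 / sqrt 2)
     else if i = l \<and> j = l then - complex_of_real (1 / sqrt 2)
     else if i = j then 1 else 0)"

context
  fixes n k l :: nat
  assumes kl: "k < n" "l < n" "k \<noteq> l"
begin

lemma hadamard_mat_carrier: "hadamard_mat n k l \<in> carrier_mat n n"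
  by (simp add: hadamard_mat_def)

lemma hadamard_mult_index:
  assumes A: "A \<in> carrier_mat n m" and i: "i < n" and j: "j < m"
  shows "(hadamard_mat n k l * A) $$ (i, j) =
    (if i = k then complex_of_real (1 / sqrt 2) * (A $$ (k, j) + A $$ (l, j))
     else if i = l then complex_of_real (1 / sqrt 2) * (A $$ (k, j) - A $$ (l, j))
     else A $$ (i, j))"
proof -
  let ?c = "complex_of_real (1 / sqrt 2)"
  let ?H = "hadamard_mat n k l"
  have "(?H * A) $$ (i, j) = (\<Sum>m<n. ?H $$ (i, m) * A $$ (m, j))"
    using A i j hadamard_mat_carrier by (auto simp: scalar_prod_def lessThan_atLeast0 intro!: sum.cong)
  also have "\<dots> = (\<Sum>m<n. (if m = k then (if i = k \<or> i = l then ?c else 0) * A $$ (k, j) else 0)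
      + (if m = l then (if i = k then ?c else if i = l then - ?c else 0) * A $$ (l, j) else 0)
      + (if m = i then (if i = k \<or> i = l then 0 else A $$ (i, j)) else 0))"
    using i kl by (intro sum.cong refl) (auto simp: hadamard_mat_def)
  also have "\<dots> = (if i = k \<or> i = l then ?c else 0) * A $$ (k, j)
      + (if i = k then ?c else if i = l then - ?c else 0) * A $$ (l, j) + (if i = k \<or> i = l then 0 else A $$ (i, j))"
    using i kl by (simp add: sum.distrib)
  finally show ?thesis using kl by (simp add: algebra_simps)
qed

lemma hadamard_involution: "hadamard_mat n k l * hadamard_mat n k l = 1\<^sub>m n"
proof (rule eq_matI)
  fix i j assume "i < dim_row (1\<^sub>m n)" "j < dim_col (1\<^sub>m n)"
  then have ij: "i < n" "j < n" by auto
  have c2: "complex_of_real (1 / sqrt 2) * complex_of_real (1 / sqrt 2) = 1 / 2"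
    by (simp flip: of_real_mult)
  show "(hadamard_mat n k l * hadamard_mat n k l) $$ (i, j) = 1\<^sub>m n $$ (i, j)"
    unfolding hadamard_mult_index[OF hadamard_mat_carrier ij]
    using ij kl c2 by (auto simp: hadamard_mat_def distrib_left right_diff_distrib)
qed (simp_all add: hadamard_mat_def)

lemma hadamard_real: "hadamard_mat n k l $$ (i, j) \<in> \<real>" if "i < n" "j < n"
  using that by (auto simp: hadamard_mat_def)

lemma hadamard_orthogonal: "hadamard_mat n k l \<in> orthogonal_group n"
  and hadamard_unitary: "hadamard_mat n k l \<in> unitary_group n"
proof -
  let ?H = "hadamard_mat n k l"
  have t: "transpose_mat ?H = ?H"
    by (rule eq_matI) (auto simp: hadamard_mat_def)
  have a: "mat_adjoint ?H = ?H"
  proof (rule eq_matI)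
    fix i j assume "i < dim_row ?H" "j < dim_col ?H"
    then have ij: "i < n" "j < n" by (auto simp: hadamard_mat_def)
    then show "mat_adjoint ?H $$ (i, j) = ?H $$ (i, j)"
      unfolding mat_adjoint_index[OF hadamard_mat_carrier ij]
      by (auto simp: hadamard_mat_def)
  qed (simp_all add: hadamard_mat_def mat_adjoint_def)
  have "elements_mat ?H \<subseteq> \<real>"
    using hadamard_real by (auto simp: elements_mat_def hadamard_mat_def)
  then show "?H \<in> orthogonal_group n" "?H \<in> unitary_group n"
    using hadamard_involution hadamard_mat_carrier t a
    by (auto simp: orthogonal_group_def unitary_group_def)
qed

end

text \<open>With \<open>p = |a|^2\<close>, \<open>q = |b|^2\<close> and \<open>d\<close> the real
  part of \<open>a * cnj b\<close>, the left side equals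
  \<open>(p^2 + q^2) / 2 + p * q + 2 * d^2\<close>, and Lagrange's identity gives
  \<open>d^2 \<le> p * q\<close>. For real \<open>a\<close> and \<open>b\<close> this is an
  equality, so the factor 3 is sharp.\<close>

lemma hadamard_quartic:
  fixes a b :: complex
  defines "c \<equiv> complex_of_real (1 / sqrt 2)"
  shows "((cmod (c * (a + b)))\<^sup>2)\<^sup>2 + ((cmod (c * (a - b)))\<^sup>2)\<^sup>2 \<le>
    (((cmod a)\<^sup>2)\<^sup>2 + ((cmod b)\<^sup>2)\<^sup>2) / 2 + 3 * ((cmod a)\<^sup>2 * (cmod b)\<^sup>2)"
proof -
  define d where "d = Re a * Re b + Im a * Im b"
  define p q where "p = (cmod a)\<^sup>2" and "q = (cmod b)\<^sup>2"
  have "(cmod c)\<^sup>2 = 1 / 2" by (simp add: c_def norm_divide power_divide)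
  moreover have "(cmod (a + b))\<^sup>2 = p + q + 2 * d" "(cmod (a - b))\<^sup>2 = p + q - 2 * d"
    unfolding p_def q_def d_def cmod_power2 by (simp_all add: power2_eq_square algebra_simps)
  ultimately have e: "(cmod (c * (a + b)))\<^sup>2 = (p + q + 2 * d) / 2" "(cmod (c * (a - b)))\<^sup>2 = (p + q - 2 * d) / 2"
    by (simp_all add: norm_mult power_mult_distrib)
  then have "((cmod (c * (a + b)))\<^sup>2)\<^sup>2 + ((cmod (c * (a - b)))\<^sup>2)\<^sup>2 = (p\<^sup>2 + q\<^sup>2) / 2 + p * q + 2 * d\<^sup>2"
    unfolding e by (simp add: power2_eq_square field_simps)
  moreover have "d\<^sup>2 \<le> p * q"
  proof -
    have "p * q - d\<^sup>2 = (Re a * Im b - Im a * Re b)\<^sup>2"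
      unfolding p_def q_def d_def cmod_power2 by (simp add: power2_eq_square algebra_simps)
    then show ?thesis using zero_le_power2[of "Re a * Im b - Im a * Re b"] by linarith
  qed
  ultimately show ?thesis unfolding p_def q_def by linarith
qed

lemma orthogonal_subset_unitary: "orthogonal_group n \<subseteq> unitary_group n"
proof
  fix A assume A: "A \<in> orthogonal_group n"
  then have c: "A \<in> carrier_mat n n" and r: "elements_mat A \<subseteq> \<real>" and t: "transpose_mat A * A = 1\<^sub>m n"
    by (auto simp: orthogonal_group_def)
  have "mat_adjoint A = transpose_mat A"
  proof (rule eq_matI)
    fix i j assume "i < dim_row (transpose_mat A)" "j < dim_col (transpose_mat A)"
    then have ij: "i < n" "j < n" using c by auto
    have "A $$ (j, i) \<in> \<real>" using r c ij(2,1) by (rule real_entries)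
    then show "mat_adjoint A $$ (i, j) = transpose_mat A $$ (i, j)"
      using c ij by (simp add: mat_adjoint_index Reals_cnj_iff)
  qed (use c in \<open>simp_all add: mat_adjoint_def\<close>)
  then show "A \<in> unitary_group n" using c t by (simp add: unitary_group_def)
qed

text \<open>The expectations of all products \<open>x k * x l\<close> add up to 1, the expectation
  of the squared sum. Let \<open>S\<close> be the sum of the expected squares; adding the
  inequalities over all ordered pairs gives \<open>2 * n * S \<le> 6 + 2 * S\<close>.\<close>

lemma sum_squares_le_of_pairs:
  fixes x :: "nat \<Rightarrow> 'w \<Rightarrow> real"
  assumes n: "2 \<le> n" and M: "prob_space M"
    and x: "\<And>i. i < n \<Longrightarrow> x i \<in> borel_measurable M" "\<And>i \<omega>. i < n \<Longrightarrow> \<omega> \<in> space M \<Longrightarrow> 0 \<le> x i \<omega>"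
    and sum: "\<And>\<omega>. \<omega> \<in> space M \<Longrightarrow> (\<Sum>i<n. x i \<omega>) = 1"
    and pair: "\<And>k l. k < n \<Longrightarrow> l < n \<Longrightarrow> k \<noteq> l \<Longrightarrow>
      (\<integral>\<omega>. (x k \<omega>)\<^sup>2 \<partial>M) + (\<integral>\<omega>. (x l \<omega>)\<^sup>2 \<partial>M) \<le> 6 * (\<integral>\<omega>. x k \<omega> * x l \<omega> \<partial>M)"
  shows "(\<Sum>i<n. \<integral>\<omega>. (x i \<omega>)\<^sup>2 \<partial>M) \<le> 3 / (real n - 1)"
proof -
  interpret prob_space M by fact
  have x1: "x i \<omega> \<le> 1" if "i < n" "\<omega> \<in> space M" for i \<omega>
  proof -
    have "x i \<omega> \<le> (\<Sum>i<n. x i \<omega>)" using x(2) that by (intro member_le_sum) auto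
    then show ?thesis using sum that by simp
  qed
  have int: "integrable M (\<lambda>\<omega>. x k \<omega> * x l \<omega>)" if "k < n" "l < n" for k l
    using x x1 that by (intro integrable_const_bound[where B = 1]) (auto simp: abs_mult intro!: AE_I2 mult_le_one)
  define e where "e k l = expectation (\<lambda>\<omega>. x k \<omega> * x l \<omega>)" for k l
  define S where "S = (\<Sum>k<n. e k k)"
  have "(\<Sum>k<n. \<Sum>l<n. e k l) = expectation (\<lambda>\<omega>. \<Sum>k<n. \<Sum>l<n. x k \<omega> * x l \<omega>)"
    unfolding e_def using int by (subst Bochner_Integration.integral_sum) (auto intro!: sum.cong Bochner_Integration.integral_sum[symmetric] Bochner_Integration.integrable_sum)
  also have "\<dots> = expectation (\<lambda>\<omega>. 1)"
    by (intro Bochner_Integration.integral_cong refl) (simp add: sum sum_product[symmetric])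
  finally have tot: "(\<Sum>k<n. \<Sum>l<n. e k l) = 1" by (simp add: prob_space)
  have e0: "0 \<le> e k l" if "k < n" "l < n" for k l
    unfolding e_def using x(2) that by (intro integral_nonneg_AE AE_I2 mult_nonneg_nonneg) auto
  have ineq: "e k k + e l l \<le> 6 * e k l + (if k = l then 2 * e k k else 0)" if "k < n" "l < n" for k l
    using pair[OF that] e0[OF that] by (cases "k = l") (auto simp: e_def power2_eq_square)
  have "(\<Sum>k<n. \<Sum>l<n. e k k + e l l) \<le> (\<Sum>k<n. \<Sum>l<n. 6 * e k l + (if k = l then 2 * e k k else 0))"
    by (intro sum_mono ineq) auto
  moreover have "(\<Sum>k<n. \<Sum>l<n. e k k + e l l) = 2 * (real n * S)"
    by (simp add: S_def sum.distrib sum_distrib_left)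
  moreover have "(\<Sum>k<n. \<Sum>l<n. 6 * e k l + (if k = l then 2 * e k k else 0)) = 6 + 2 * S"
    by (simp add: S_def sum.distrib tot sum_distrib_left[symmetric])
  ultimately have "(real n - 1) * S \<le> 3" by (simp add: algebra_simps)
  then have "S \<le> 3 / (real n - 1)" using n by (simp add: field_simps)
  then show ?thesis by (simp add: S_def e_def power2_eq_square)
qed

text \<open>Let \<open>s\<close> be the expected sum of the squares of the squared moduli at two
  positions of one column. By left invariance \<open>U\<close> may be replaced by
  \<open>H * U\<close>, with \<open>H\<close> mixing the two rows, and
  \<open>hadamard_quartic\<close> yields \<open>s \<le> s / 2 + 3 * c\<close>, where
  \<open>c\<close> is the mixed moment. Solving for \<open>s\<close> gives the pair inequality with
  constant 6. The \<open>n\<close> columns then contribute at most \<open>3 * n / (n - 1)\<close>,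
  which is at most 6 for \<open>n \<ge> 2\<close>.\<close>

lemma haar_second_moment:
  assumes n: "2 \<le> n" and M: "prob_space M" and G: "G = unitary_group n \<or> G = orthogonal_group n"
    and haar: "haar_distributed n G M U"
  shows "(\<integral>\<omega>. (\<Sum>i<n. \<Sum>j<n. ((cmod (U \<omega> $$ (i, j)))\<^sup>2)\<^sup>2) \<partial>M) \<le> 6"
proof -
  interpret prob_space M by fact
  have GU: "G \<subseteq> unitary_group n" using G orthogonal_subset_unitary by auto
  have U: "U \<in> measurable M (mat_borel n G)"
    and inv: "\<And>V. V \<in> G \<Longrightarrow> distr (distr M (mat_borel n G) U) (mat_borel n G) (\<lambda>A. V * A) = distr M (mat_borel n G) U"
    using haar by (auto simp: haar_distributed_def Let_def)
  have UG: "U \<omega> \<in> G" if "\<omega> \<in> space M" for \<omega> using measurable_space[OF U that] by simp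
  have carrier: "U \<omega> \<in> carrier_mat n n" if "\<omega> \<in> space M" for \<omega>
    using UG[OF that] GU by (auto simp: unitary_group_def)
  \<comment> \<open>The column index comes first, so that \<open>x j\<close> is one family of
    weights with sum 1, as \<open>sum_squares_le_of_pairs\<close> expects.\<close>
  define x where "x j i \<omega> = (cmod (U \<omega> $$ (i, j)))\<^sup>2" for i j \<omega>
  have xm [measurable]: "x j i \<in> borel_measurable M" if "i < n" "j < n" for i j
    unfolding x_def using measurable_compose[OF U entry_measurable[OF that]] by measurable
  have x1: "x j i \<omega> \<le> 1" "0 \<le> x j i \<omega>" if "i < n" "j < n" "\<omega> \<in> space M" for i j \<omega>
  proof -
    have "x j i \<omega> \<le> (\<Sum>i<n. x j i \<omega>)" using that by (intro member_le_sum) (auto simp: x_def)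
    also have "\<dots> = 1" using unitary_group_sums(1)[of "U \<omega>" n j] UG GU that by (auto simp: x_def)
    finally show "x j i \<omega> \<le> 1" .
  qed (simp add: x_def)
  have int: "integrable M (\<lambda>\<omega>. x j k \<omega> * x j l \<omega>)" if "k < n" "l < n" "j < n" for j k l
    using x1 that by (intro integrable_const_bound[where B = 1]) (auto simp: abs_mult intro!: AE_I2 mult_le_one)
  have pair: "expectation (\<lambda>\<omega>. (x j k \<omega>)\<^sup>2) + expectation (\<lambda>\<omega>. (x j l \<omega>)\<^sup>2) \<le> 6 * expectation (\<lambda>\<omega>. x j k \<omega> * x j l \<omega>)"
    if j: "j < n" and kl: "k < n" "l < n" "k \<noteq> l" for j k l
  proof -
    let ?H = "hadamard_mat n k l"
    have HG: "?H \<in> G" using G hadamard_orthogonal[OF kl] hadamard_unitary[OF kl] by auto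
    define f where "f B = ((cmod (B $$ (k, j)))\<^sup>2)\<^sup>2 + ((cmod (B $$ (l, j)))\<^sup>2)\<^sup>2" for B :: "complex mat"
    have fm: "f \<in> borel_measurable (mat_borel n G)"
      unfolding f_def using entry_measurable[OF kl(1) j] entry_measurable[OF kl(2) j] by measurable
    have HA: "?H * A \<in> G" if "A \<in> G" for A
      using G that HG orthogonal_group_mult unitary_group_mult by blast
    have Hm: "(\<lambda>A. ?H * A) \<in> measurable (mat_borel n G) (mat_borel n G)"
      using GU HA hadamard_mat_carrier[OF kl]
      by (intro left_mult_measurable) (auto simp: unitary_group_def)
    have "(\<integral>\<omega>. f (U \<omega>) \<partial>M) = (\<integral>A. f A \<partial>distr M (mat_borel n G) U)"
      using fm U by (simp add: integral_distr)
    also have "\<dots> = (\<integral>A. f A \<partial>distr (distr M (mat_borel n G) U) (mat_borel n G) (\<lambda>A. ?H * A))"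
      unfolding inv[OF HG] ..
    also have "\<dots> = (\<integral>\<omega>. f (?H * U \<omega>) \<partial>M)"
      using fm U Hm by (simp add: integral_distr)
    also have "\<dots> \<le> (\<integral>\<omega>. ((x j k \<omega>)\<^sup>2 + (x j l \<omega>)\<^sup>2) / 2 + 3 * (x j k \<omega> * x j l \<omega>) \<partial>M)"
    proof (rule integral_mono)
      have b: "0 \<le> f B \<and> f B \<le> 2" if "B \<in> G" for B
      proof -
        have "(cmod (B $$ (m, j)))\<^sup>2 \<le> 1" if "m < n" for m
        proof -
          have "(cmod (B $$ (m, j)))\<^sup>2 \<le> (\<Sum>i<n. (cmod (B $$ (i, j)))\<^sup>2)"
            using that by (intro member_le_sum) auto
          then show ?thesis using unitary_group_sums(1)[of B n j] \<open>B \<in> G\<close> GU j by auto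
        qed
        from power_le_one[OF zero_le_power2 this[OF kl(1)], of 2] power_le_one[OF zero_le_power2 this[OF kl(2)], of 2]
        show ?thesis unfolding f_def by simp
      qed
      have "(\<lambda>\<omega>. f (?H * U \<omega>)) \<in> borel_measurable M"
        by (rule measurable_compose[OF measurable_compose[OF U Hm] fm])
      then show "integrable M (\<lambda>\<omega>. f (?H * U \<omega>))"
        using b HA UG by (intro integrable_const_bound[where B = 2]) (auto intro!: AE_I2 simp: abs_le_iff)
      show "integrable M (\<lambda>\<omega>. ((x j k \<omega>)\<^sup>2 + (x j l \<omega>)\<^sup>2) / 2 + 3 * (x j k \<omega> * x j l \<omega>))"
        using int[OF kl(1,1) j] int[OF kl(2,2) j] int[OF kl(1,2) j] by (simp add: power2_eq_square)
      fix \<omega> assume \<omega>: "\<omega> \<in> space M"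
      show "f (?H * U \<omega>) \<le> ((x j k \<omega>)\<^sup>2 + (x j l \<omega>)\<^sup>2) / 2 + 3 * (x j k \<omega> * x j l \<omega>)"
        unfolding f_def hadamard_mult_index[OF kl carrier[OF \<omega>] kl(1) j] hadamard_mult_index[OF kl carrier[OF \<omega>] kl(2) j]
        using hadamard_quartic[of "U \<omega> $$ (k, j)" "U \<omega> $$ (l, j)"] kl by (simp add: x_def)
    qed
    also have "\<dots> = (expectation (\<lambda>\<omega>. (x j k \<omega>)\<^sup>2) + expectation (\<lambda>\<omega>. (x j l \<omega>)\<^sup>2)) / 2 + 3 * expectation (\<lambda>\<omega>. x j k \<omega> * x j l \<omega>)"
      using int[OF kl(1,1) j] int[OF kl(2,2) j] int[OF kl(1,2) j] by (simp add: power2_eq_square)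
    finally have "(\<integral>\<omega>. f (U \<omega>) \<partial>M) \<le> (expectation (\<lambda>\<omega>. (x j k \<omega>)\<^sup>2) + expectation (\<lambda>\<omega>. (x j l \<omega>)\<^sup>2)) / 2 + 3 * expectation (\<lambda>\<omega>. x j k \<omega> * x j l \<omega>)" .
    moreover have "(\<integral>\<omega>. f (U \<omega>) \<partial>M) = expectation (\<lambda>\<omega>. (x j k \<omega>)\<^sup>2) + expectation (\<lambda>\<omega>. (x j l \<omega>)\<^sup>2)"
      unfolding f_def x_def[symmetric] using int[OF kl(1,1) j] int[OF kl(2,2) j] by (simp add: power2_eq_square)
    moreover have "a + b \<le> 6 * c" if "s \<le> (a + b) / 2 + 3 * c" "s = a + b" for a b c s :: real
      using that by (simp add: field_simps)
    ultimately show ?thesis by blast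
  qed
  have col: "(\<Sum>i<n. expectation (\<lambda>\<omega>. (x j i \<omega>)\<^sup>2)) \<le> 3 / (real n - 1)" if j: "j < n" for j
    using n M
  proof (rule sum_squares_le_of_pairs)
    show "(\<Sum>i<n. x j i \<omega>) = 1" if "\<omega> \<in> space M" for \<omega>
      using unitary_group_sums(1)[of "U \<omega>" n j] UG GU that j by (auto simp: x_def)
  qed (use j x1 pair in auto)
  have "(\<integral>\<omega>. (\<Sum>i<n. \<Sum>j<n. ((cmod (U \<omega> $$ (i, j)))\<^sup>2)\<^sup>2) \<partial>M) = expectation (\<lambda>\<omega>. \<Sum>j<n. \<Sum>i<n. (x j i \<omega>)\<^sup>2)"
    unfolding x_def by (subst sum.swap) simp
  also have "\<dots> = (\<Sum>j<n. expectation (\<lambda>\<omega>. \<Sum>i<n. (x j i \<omega>)\<^sup>2))"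
    using int by (intro Bochner_Integration.integral_sum Bochner_Integration.integrable_sum) (auto simp: power2_eq_square)
  also have "\<dots> = (\<Sum>j<n. \<Sum>i<n. expectation (\<lambda>\<omega>. (x j i \<omega>)\<^sup>2))"
    using int by (intro sum.cong refl Bochner_Integration.integral_sum) (auto simp: power2_eq_square)
  also have "\<dots> \<le> (\<Sum>j<n. 3 / (real n - 1))" using col by (intro sum_mono) auto
  also have "\<dots> = 3 * real n / (real n - 1)" by simp
  also have "\<dots> \<le> 6" using n by (simp add: field_simps)
  finally show ?thesis .
qed

section \<open>Convergence of the finite-dimensional distributions\<close>

text \<open>The moments in \<open>is_W_infinity\<close> are Bochner integrals, which are 0 for
  non-integrable functions. Square integrability is therefore derived from the Gaussian law of the
  one-point marginals.\<close>

lemma is_W_infinity_facts: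
  assumes W: "is_W_infinity N W"
  shows "prob_space N"
    and "p \<in> unit_square \<Longrightarrow> W p \<in> borel_measurable N"
    and "p \<in> unit_square \<Longrightarrow> integrable N (\<lambda>\<omega>. (W p \<omega>)\<^sup>2)"
    and "p \<in> unit_square \<Longrightarrow> (\<integral>\<omega>. W p \<omega> \<partial>N) = 0"
    and "p \<in> unit_square \<Longrightarrow> q \<in> unit_square \<Longrightarrow> (\<integral>\<omega>. W p \<omega> * W q \<omega> \<partial>N) = W_cov p q"
    and "\<omega> \<in> space N \<Longrightarrow> continuous_on unit_square (\<lambda>p. W p \<omega>)"
    and "finite J \<Longrightarrow> J \<subseteq> unit_square \<Longrightarrow> gaussian_rv N (\<lambda>\<omega>. \<Sum>p\<in>J. a p * W p \<omega>)"
proof -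
  show N: "prob_space N" and "\<omega> \<in> space N \<Longrightarrow> continuous_on unit_square (\<lambda>p. W p \<omega>)"
    and mean: "p \<in> unit_square \<Longrightarrow> (\<integral>\<omega>. W p \<omega> \<partial>N) = 0" for p \<omega>
    using W by (auto simp: is_W_infinity_def)
  show "p \<in> unit_square \<Longrightarrow> q \<in> unit_square \<Longrightarrow> (\<integral>\<omega>. W p \<omega> * W q \<omega> \<partial>N) = W_cov p q"
    using W by (simp add: is_W_infinity_def)
  show G: "gaussian_rv N (\<lambda>\<omega>. \<Sum>p\<in>J. a p * W p \<omega>)" if "finite J" "J \<subseteq> unit_square" for J a
    using W that by (simp add: is_W_infinity_def gaussian_process_def)
  have "gaussian_rv N (W p)" if "p \<in> unit_square" for p
    using G[of "{p}" "\<lambda>_. 1"] that by simp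
  then show "p \<in> unit_square \<Longrightarrow> W p \<in> borel_measurable N" "p \<in> unit_square \<Longrightarrow> integrable N (\<lambda>\<omega>. (W p \<omega>)\<^sup>2)"
    using char_centered_gaussian(1)[OF N _ mean] by (auto simp: gaussian_rv_def)
qed

lemma W_linear_combination:
  assumes W: "is_W_infinity N W" and J: "finite J" "J \<subseteq> unit_square"
  shows "(\<integral>\<omega>. (\<Sum>p\<in>J. a p * W p \<omega>) \<partial>N) = 0"
    and "(\<integral>\<omega>. (\<Sum>p\<in>J. a p * W p \<omega>)\<^sup>2 \<partial>N) = (\<Sum>p\<in>J. \<Sum>q\<in>J. a p * a q * W_cov p q)"
proof -
  note W' = is_W_infinity_facts[OF W]
  interpret prob_space N by (rule W'(1))
  have i: "integrable N (\<lambda>\<omega>. a p * W p \<omega>)" if "p \<in> J" for p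
  proof -
    have p: "p \<in> unit_square" using that J(2) by auto
    show ?thesis
      by (rule integrable_mult_right[OF square_integrable_imp_integrable[OF W'(2)[OF p] W'(3)[OF p]]])
  qed
  have "(\<integral>\<omega>. (\<Sum>p\<in>J. a p * W p \<omega>) \<partial>N) = (\<Sum>p\<in>J. \<integral>\<omega>. a p * W p \<omega> \<partial>N)"
    using i by (rule Bochner_Integration.integral_sum)
  also have "\<dots> = 0"
  proof (rule sum.neutral, rule ballI)
    fix p assume "p \<in> J"
    then have "(\<integral>\<omega>. W p \<omega> \<partial>N) = 0" using J(2) by (intro W'(4)) auto
    then show "(\<integral>\<omega>. a p * W p \<omega> \<partial>N) = 0" by simp
  qed
  finally show "(\<integral>\<omega>. (\<Sum>p\<in>J. a p * W p \<omega>) \<partial>N) = 0" .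
  have int: "integrable N (\<lambda>\<omega>. a p * W p \<omega> * (a q * W q \<omega>))" if "p \<in> J" "q \<in> J" for p q
  proof -
    have pq: "p \<in> unit_square" "q \<in> unit_square" using that J by auto
    have "integrable N (\<lambda>\<omega>. W p \<omega> * W q \<omega>)"
    proof (rule Bochner_Integration.integrable_bound)
      show "integrable N (\<lambda>\<omega>. (W p \<omega>)\<^sup>2 + (W q \<omega>)\<^sup>2)"
        by (intro Bochner_Integration.integrable_add W'(3) pq)
      have "\<bar>x * y\<bar> \<le> x\<^sup>2 + y\<^sup>2" for x y :: real
        using sum_squares_bound[of "\<bar>x\<bar>" "\<bar>y\<bar>"] sum_power2_ge_zero[of x y]
        unfolding abs_mult power2_abs by linarith
      then show "AE \<omega> in N. norm (W p \<omega> * W q \<omega>) \<le> norm ((W p \<omega>)\<^sup>2 + (W q \<omega>)\<^sup>2)" by simp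
      show "(\<lambda>\<omega>. W p \<omega> * W q \<omega>) \<in> borel_measurable N"
        by (intro borel_measurable_times W'(2) pq)
    qed
    then have "integrable N (\<lambda>\<omega>. (a p * a q) * (W p \<omega> * W q \<omega>))" by (rule integrable_mult_right)
    then show ?thesis by (simp add: mult_ac)
  qed
  have "(\<integral>\<omega>. (\<Sum>p\<in>J. a p * W p \<omega>)\<^sup>2 \<partial>N) = (\<integral>\<omega>. (\<Sum>p\<in>J. \<Sum>q\<in>J. a p * W p \<omega> * (a q * W q \<omega>)) \<partial>N)"
    by (simp add: power2_eq_square sum_product)
  also have "\<dots> = (\<Sum>p\<in>J. \<integral>\<omega>. (\<Sum>q\<in>J. a p * W p \<omega> * (a q * W q \<omega>)) \<partial>N)"
    using int by (intro Bochner_Integration.integral_sum Bochner_Integration.integrable_sum)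
  also have "\<dots> = (\<Sum>p\<in>J. \<Sum>q\<in>J. \<integral>\<omega>. a p * W p \<omega> * (a q * W q \<omega>) \<partial>N)"
    using int by (intro sum.cong refl Bochner_Integration.integral_sum)
  also have "\<dots> = (\<Sum>p\<in>J. \<Sum>q\<in>J. a p * a q * W_cov p q)"
  proof (intro sum.cong refl)
    fix p q assume "p \<in> J" "q \<in> J"
    then have "(\<integral>\<omega>. W p \<omega> * W q \<omega> \<partial>N) = W_cov p q" using J(2) by (intro W'(5)) auto
    moreover have "(\<integral>\<omega>. a p * W p \<omega> * (a q * W q \<omega>) \<partial>N) = (\<integral>\<omega>. (a p * a q) * (W p \<omega> * W q \<omega>) \<partial>N)"
      by (simp add: mult_ac)
    ultimately show "(\<integral>\<omega>. a p * W p \<omega> * (a q * W q \<omega>) \<partial>N) = a p * a q * W_cov p q" by simp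
  qed
  finally show "(\<integral>\<omega>. (\<Sum>p\<in>J. a p * W p \<omega>)\<^sup>2 \<partial>N) = (\<Sum>p\<in>J. \<Sum>q\<in>J. a p * a q * W_cov p q)" .
qed

text \<open>\<open>char_power_tendsto\<close> for a combination of centered indicators; the variance
  is the quadratic form of the Brownian bridge covariance.\<close>

lemma bridge_combination_char_tendsto:
  fixes b \<sigma> :: "'i \<Rightarrow> real"
  assumes J: "finite J" and \<sigma>: "\<And>p. p \<in> J \<Longrightarrow> \<sigma> p \<in> {0..1}"
  shows "(\<lambda>n. (CLINT r|uniform01. iexp ((\<Sum>p\<in>J. b p * centered_ind (\<sigma> p) r) / sqrt (real n))) ^ n) \<longlonglongrightarrow>
    complex_of_real (exp (- (\<Sum>p\<in>J. \<Sum>q\<in>J. b p * b q * (min (\<sigma> p) (\<sigma> q) - \<sigma> p * \<sigma> q)) / 2))"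
proof -
  define f where "f r = (\<Sum>p\<in>J. b p * centered_ind (\<sigma> p) r)" for r
  have int: "integrable uniform01 (centered_ind (\<sigma> p))" if "p \<in> J" for p
    using centered_ind_abs_le[OF \<sigma>[OF that]] by (intro integrable_uniform01_bounded[where B = 1]) auto
  have int2: "integrable uniform01 (\<lambda>r. centered_ind (\<sigma> p) r * centered_ind (\<sigma> q) r)" if "p \<in> J" "q \<in> J" for p q
    using centered_ind_abs_le[OF \<sigma>[OF that(1)]] centered_ind_abs_le[OF \<sigma>[OF that(2)]]
    by (intro integrable_uniform01_bounded[where B = 1]) (auto simp: abs_mult intro!: mult_le_one)
  have bound: "\<bar>f r\<bar> \<le> (\<Sum>p\<in>J. \<bar>b p\<bar>)" for r
    unfolding f_def
  proof (intro order_trans[OF sum_abs] sum_mono)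
    fix p assume "p \<in> J"
    then show "\<bar>b p * centered_ind (\<sigma> p) r\<bar> \<le> \<bar>b p\<bar>"
      using centered_ind_abs_le[OF \<sigma>, of p r] by (simp add: abs_mult mult_left_le)
  qed
  have mean: "(\<integral>r. f r \<partial>uniform01) = 0"
    unfolding f_def using int \<sigma>
    by (subst Bochner_Integration.integral_sum) (auto intro!: sum.neutral simp: integral_centered_ind)
  have "(\<integral>r. (f r)\<^sup>2 \<partial>uniform01) = (\<integral>r. (\<Sum>p\<in>J. \<Sum>q\<in>J. b p * b q * (centered_ind (\<sigma> p) r * centered_ind (\<sigma> q) r)) \<partial>uniform01)"
    by (simp add: f_def power2_eq_square sum_product mult_ac)
  also have "\<dots> = (\<Sum>p\<in>J. \<integral>r. (\<Sum>q\<in>J. b p * b q * (centered_ind (\<sigma> p) r * centered_ind (\<sigma> q) r)) \<partial>uniform01)"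
    using int2 by (intro Bochner_Integration.integral_sum Bochner_Integration.integrable_sum integrable_mult_right)
  also have "\<dots> = (\<Sum>p\<in>J. \<Sum>q\<in>J. \<integral>r. b p * b q * (centered_ind (\<sigma> p) r * centered_ind (\<sigma> q) r) \<partial>uniform01)"
    using int2 by (intro sum.cong refl Bochner_Integration.integral_sum integrable_mult_right)
  also have "\<dots> = (\<Sum>p\<in>J. \<Sum>q\<in>J. b p * b q * (min (\<sigma> p) (\<sigma> q) - \<sigma> p * \<sigma> q))"
    using \<sigma> by (intro sum.cong refl) (simp add: integral_centered_ind_mult)
  finally have var: "(\<integral>r. (f r)\<^sup>2 \<partial>uniform01) = (\<Sum>p\<in>J. \<Sum>q\<in>J. b p * b q * (min (\<sigma> p) (\<sigma> q) - \<sigma> p * \<sigma> q))" .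
  have "f \<in> borel_measurable uniform01" unfolding f_def by measurable
  from char_power_tendsto[OF uniform01.prob_space_axioms this bound mean]
  show ?thesis unfolding var unfolding f_def .
qed

text \<open>The two limit factors belong to \<open>t * B s\<close> and \<open>s * B' t\<close> with
  independent Brownian bridges \<open>B\<close> and \<open>B'\<close>. Their covariances
  \<open>t * t' * (min s s' - s * s')\<close> and \<open>s * s' * (min t t' - t * t')\<close> add up
  to \<open>W_cov\<close>. The sizes are \<open>Suc n\<close> because the locale requires a positive
  size.\<close>

lemma fdd_cos_tendsto:
  fixes M :: "nat \<Rightarrow> 'w measure"
  assumes tr: "\<And>n. truncation (M n) (Suc n) (U n) (R n) (C n)"
    and W: "is_W_infinity N W" and J: "finite J" "J \<subseteq> unit_square"
  shows "(\<lambda>n. \<integral>\<omega>. cos (b + (\<Sum>p\<in>J. a p * truncation.L (Suc n) (R n) (C n) p \<omega>)) \<partial>M n) \<longlonglongrightarrow>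
    (\<integral>\<omega>. cos (b + (\<Sum>p\<in>J. a p * W p \<omega>)) \<partial>N)"
proof -
  let ?L = "\<lambda>n \<omega>. \<Sum>p\<in>J. a p * truncation.L (Suc n) (R n) (C n) p \<omega>"
  let ?f = "\<lambda>n::nat. (CLINT r|uniform01. iexp ((\<Sum>p\<in>J. a p * snd p * centered_ind (fst p) r) / sqrt (real n))) ^ n"
  let ?g = "\<lambda>n::nat. (CLINT r|uniform01. iexp ((\<Sum>p\<in>J. a p * fst p * centered_ind (snd p) r) / sqrt (real n))) ^ n"
  define vf where "vf = (\<Sum>p\<in>J. \<Sum>q\<in>J. (a p * snd p) * (a q * snd q) * (min (fst p) (fst q) - fst p * fst q))"
  define vg where "vg = (\<Sum>p\<in>J. \<Sum>q\<in>J. (a p * fst p) * (a q * fst q) * (min (snd p) (snd q) - snd p * snd q))"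
  have "?f \<longlonglongrightarrow> complex_of_real (exp (- vf / 2))" "?g \<longlonglongrightarrow> complex_of_real (exp (- vg / 2))"
    unfolding vf_def vg_def using J by (intro bridge_combination_char_tendsto; force simp: unit_square_def)+
  then have lim: "(\<lambda>n. ?f (Suc n) * ?g (Suc n)) \<longlonglongrightarrow> complex_of_real (exp (- vf / 2)) * complex_of_real (exp (- vg / 2))"
    by (intro tendsto_mult LIMSEQ_Suc)
  have eq: "(CLINT \<omega>|M n. iexp (?L n \<omega>)) = ?f (Suc n) * ?g (Suc n)" for n
    by (rule truncation.char_L[OF tr J(1)])
  have v: "vf + vg = (\<Sum>p\<in>J. \<Sum>q\<in>J. a p * a q * W_cov p q)"
    unfolding vf_def vg_def W_cov_def sum.distrib[symmetric]
    by (intro sum.cong refl) (simp add: case_prod_beta algebra_simps)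
  have "- vf / 2 + - vg / 2 = - (vf + vg) / 2" by simp
  then have e: "complex_of_real (exp (- vf / 2)) * complex_of_real (exp (- vg / 2)) = complex_of_real (exp (- (vf + vg) / 2))"
    by (simp only: of_real_mult[symmetric] exp_add[symmetric])
  have char: "(\<lambda>n. CLINT \<omega>|M n. iexp (?L n \<omega>)) \<longlonglongrightarrow> complex_of_real (exp (- (\<Sum>p\<in>J. \<Sum>q\<in>J. a p * a q * W_cov p q) / 2))"
    unfolding eq v[symmetric] e[symmetric] by (rule lim)
  have WG: "gaussian_rv N (\<lambda>\<omega>. \<Sum>p\<in>J. a p * W p \<omega>)" by (rule is_W_infinity_facts(7)[OF W J])
  have WN: "prob_space N" by (rule is_W_infinity_facts(1)[OF W])
  have "(CLINT \<omega>|N. iexp (\<Sum>p\<in>J. a p * W p \<omega>)) = complex_of_real (exp (- (\<Sum>p\<in>J. \<Sum>q\<in>J. a p * a q * W_cov p q) / 2))"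
    using char_centered_gaussian(2)[OF WN WG W_linear_combination(1)[OF W J]] unfolding W_linear_combination(2)[OF W J] .
  with char have "(\<lambda>n. CLINT \<omega>|M n. iexp (?L n \<omega>)) \<longlonglongrightarrow> (CLINT \<omega>|N. iexp (\<Sum>p\<in>J. a p * W p \<omega>))" by simp
  then have "(\<lambda>n. Re (iexp b * (CLINT \<omega>|M n. iexp (?L n \<omega>)))) \<longlonglongrightarrow> Re (iexp b * (CLINT \<omega>|N. iexp (\<Sum>p\<in>J. a p * W p \<omega>)))"
    by (intro tendsto_Re tendsto_mult_left)
  moreover have "(\<integral>\<omega>. cos (b + ?L n \<omega>) \<partial>M n) = Re (iexp b * (CLINT \<omega>|M n. iexp (?L n \<omega>)))" for n
  proof -
    interpret T: truncation "M n" "Suc n" "U n" "R n" "C n" by (rule tr)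
    have "(\<lambda>\<omega>. ?L n \<omega>) \<in> borel_measurable (M n)" by measurable
    then show ?thesis by (rule integral_cos_shift[OF T.prob_space_axioms])
  qed
  moreover have "(\<integral>\<omega>. cos (b + (\<Sum>p\<in>J. a p * W p \<omega>)) \<partial>N) = Re (iexp b * (CLINT \<omega>|N. iexp (\<Sum>p\<in>J. a p * W p \<omega>)))"
    using WG by (intro integral_cos_shift[OF WN]) (simp add: gaussian_rv_def)
  ultimately show ?thesis by simp
qed

lemma step_path_lipschitz:
  assumes Lh: "0 \<le> Lh" and h: "\<And>x y. x \<in> skorokhod_D \<Longrightarrow> y \<in> skorokhod_D \<Longrightarrow> \<bar>h x - h y\<bar> \<le> Lh * skorokhod_dist x y"
  shows "\<bar>h (step_path q x) - h (step_path q y)\<bar> \<le> Lh * (\<Sum>j\<in>dyadic_grid q. \<bar>x j - y j\<bar>)"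
proof -
  have "skorokhod_dist (step_path q x) (step_path q y) \<le> (\<Sum>j\<in>dyadic_grid q. \<bar>x j - y j\<bar>)"
    by (intro step_path_dist member_le_sum finite_dyadic_grid) auto
  then have "Lh * skorokhod_dist (step_path q x) (step_path q y) \<le> Lh * (\<Sum>j\<in>dyadic_grid q. \<bar>x j - y j\<bar>)"
    using Lh by (rule mult_left_mono)
  then show ?thesis using h[OF step_path_in_D step_path_in_D, of q x q y] by linarith
qed

lemma step_path_expectation_tendsto:
  fixes M :: "nat \<Rightarrow> 'w measure"
  assumes tr: "\<And>n. truncation (M n) (Suc n) (U n) (R n) (C n)"
    and W: "is_W_infinity N W" and Lh: "0 \<le> Lh"
    and h: "\<And>x y. x \<in> skorokhod_D \<Longrightarrow> y \<in> skorokhod_D \<Longrightarrow> \<bar>h x - h y\<bar> \<le> Lh * skorokhod_dist x y"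
    and B: "\<And>x. x \<in> skorokhod_D \<Longrightarrow> \<bar>h x\<bar> \<le> B"
  shows "(\<lambda>n. \<integral>\<omega>. h (step_path q (\<lambda>p. truncation.L (Suc n) (R n) (C n) p \<omega>)) \<partial>M n) \<longlonglongrightarrow>
    (\<integral>\<omega>. h (step_path q (\<lambda>p. W p \<omega>)) \<partial>N)"
proof (rule cramer_wold_lipschitz[where g = "\<lambda>v. h (step_path q v)" and J = "dyadic_grid q" and c = 4 and B = B and L = Lh])
  note W' = is_W_infinity_facts[OF W]
  show "prob_space (M n)" for n using truncation.axioms(1)[OF tr] .
  show "prob_space N" by (rule W'(1))
  show "finite (dyadic_grid q)" by (rule finite_dyadic_grid)
  show "\<bar>h (step_path q x)\<bar> \<le> B" for x using B step_path_in_D by simp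
  show "\<bar>h (step_path q x) - h (step_path q y)\<bar> \<le> Lh * (\<Sum>j\<in>dyadic_grid q. \<bar>x j - y j\<bar>)" for x y
    using Lh h by (rule step_path_lipschitz)
  show "(\<lambda>n. \<integral>\<omega>. cos (b + (\<Sum>p\<in>dyadic_grid q. a p * truncation.L (Suc n) (R n) (C n) p \<omega>)) \<partial>M n) \<longlonglongrightarrow>
    (\<integral>\<omega>. cos (b + (\<Sum>p\<in>dyadic_grid q. a p * W p \<omega>)) \<partial>N)" for a b
    by (rule fdd_cos_tendsto[OF tr W finite_dyadic_grid dyadic_grid_subset])
  fix j assume "j \<in> dyadic_grid q"
  then have j: "j \<in> unit_square" using dyadic_grid_subset by auto
  show "truncation.L (Suc n) (R n) (C n) j \<in> borel_measurable (M n)" for n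
    by (rule truncation.L_measurable[OF tr])
  show "integrable (M n) (\<lambda>\<omega>. (truncation.L (Suc n) (R n) (C n) j \<omega>)\<^sup>2)"
    "(\<integral>\<omega>. (truncation.L (Suc n) (R n) (C n) j \<omega>)\<^sup>2 \<partial>M n) \<le> 4" for n
    using truncation.L_second_moment[OF tr j] by auto
  show "W j \<in> borel_measurable N" "integrable N (\<lambda>\<omega>. (W j \<omega>)\<^sup>2)" using W'(2,3) j by auto
  obtain s t where st: "j = (s, t)" by (cases j)
  have st01: "0 \<le> s" "s \<le> 1" "0 \<le> t" "t \<le> 1" using j by (auto simp: st unit_square_def)
  have "(\<integral>\<omega>. (W j \<omega>)\<^sup>2 \<partial>N) = s * s * t + s * t * t - 2 * s * s * t * t"
    using W'(5)[OF j j] by (simp add: st W_cov_def power2_eq_square)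
  also have "\<dots> \<le> s * s * t + s * t * t" using st01 by simp
  also have "\<dots> \<le> 1 + 1" using st01 by (intro add_mono mult_le_one) auto
  finally show "(\<integral>\<omega>. (W j \<omega>)\<^sup>2 \<partial>N) \<le> 4" by simp
qed (use Lh in auto)

section \<open>Convergence in distribution\<close>

lemma step_path_tendsto:
  assumes f: "continuous_on unit_square f"
  shows "(\<lambda>k. skorokhod_dist (step_path k f) (restrict f unit_square)) \<longlonglongrightarrow> 0"
proof (rule LIMSEQ_I)
  fix r :: real assume r: "0 < r"
  have "compact unit_square" unfolding unit_square_def by (intro compact_Times compact_Icc)
  then have "uniformly_continuous_on unit_square f" using f compact_uniformly_continuous by blast
  then obtain d where d: "0 < d" "\<And>x y. x \<in> unit_square \<Longrightarrow> y \<in> unit_square \<Longrightarrow> dist y x < d \<Longrightarrow> dist (f y) (f x) < r / 2"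
    unfolding uniformly_continuous_on_def using r by (meson half_gt_zero)
  have "(\<lambda>k. (1/2) ^ k :: real) \<longlonglongrightarrow> 0" by (rule LIMSEQ_power_zero) simp
  from order_tendstoD(2)[OF this, of "d / 2"] d(1)
  obtain K where K: "\<And>k. k \<ge> K \<Longrightarrow> (1/2) ^ k < d / 2" by (auto simp: eventually_sequentially)
  have "norm (skorokhod_dist (step_path k f) (restrict f unit_square) - 0) < r" if k: "k \<ge> K" for k
  proof -
    have "skorokhod_dist (step_path k f) (restrict f unit_square) \<le> r / 2"
    proof (rule skorokhod_dist_le_uniform[OF step_path_in_D restrict_in_skorokhod_D[OF orthant_limits_continuous[OF f]]])
      fix p assume p: "p \<in> unit_square"
      let ?p = "(dyadic_floor k (fst p), dyadic_floor k (snd p))"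
      have "?p \<in> unit_square" using dyadic_floor_grid[OF p] dyadic_grid_subset by blast
      moreover have "dist ?p p < d"
      proof -
        have "dist ?p p \<le> \<bar>dyadic_floor k (fst p) - fst p\<bar> + \<bar>dyadic_floor k (snd p) - snd p\<bar>"
          using sqrt_sum_squares_le_sum_abs[of "dyadic_floor k (fst p) - fst p" "dyadic_floor k (snd p) - snd p"]
          by (simp add: dist_prod_def dist_real_def)
        moreover have "\<bar>dyadic_floor k s - s\<bar> \<le> (1/2) ^ k" for s
          using dyadic_floor_bounds(1)[of k s] dyadic_floor_bounds(2)[of s k] by (simp add: abs_le_iff)
        ultimately show ?thesis using K[OF k] by (smt (verit) field_sum_of_halves)
      qed
      ultimately have "dist (f ?p) (f p) < r / 2" using d(2) p by blast
      then show "\<bar>step_path k f p - restrict f unit_square p\<bar> \<le> r / 2"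
        using p by (simp add: step_path_def dist_real_def)
    qed
    then show ?thesis using r Skorokhod.nonneg[of "step_path k f"] by (simp add: abs_of_nonneg)
  qed
  then show "\<exists>K. \<forall>k\<ge>K. norm (skorokhod_dist (step_path k f) (restrict f unit_square) - 0) < r" by blast
qed

text \<open>Continuity of every path makes it the limit, in the Skorokhod distance, of its step
  paths; these are measurable since they involve finitely many coordinates.\<close>

lemma W_path_measurable:
  assumes W: "is_W_infinity N W"
  shows "(\<lambda>\<omega>. \<lambda>p\<in>unit_square. W p \<omega>) \<in> measurable N (borel_of_topology skorokhod_topology)"
  unfolding skorokhod_topology_def
proof (rule Skorokhod.measurable_borel_of_limit)
  note W' = is_W_infinity_facts[OF W]
  show "(\<lambda>\<omega>. step_path k (\<lambda>p. W p \<omega>)) \<in> measurable N (borel_of_topology Skorokhod.mtopology)" for k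
    unfolding skorokhod_topology_def[symmetric] using W'(2) dyadic_grid_subset
    by (intro measurable_step_path) blast
  show "(\<lambda>p\<in>unit_square. W p \<omega>) \<in> skorokhod_D" if "\<omega> \<in> space N" for \<omega>
    using W'(6)[OF that] by (intro restrict_in_skorokhod_D orthant_limits_continuous)
  show "(\<lambda>k. skorokhod_dist (step_path k (\<lambda>p. W p \<omega>)) (\<lambda>p\<in>unit_square. W p \<omega>)) \<longlonglongrightarrow> 0"
    if "\<omega> \<in> space N" for \<omega>
    by (rule step_path_tendsto[OF W'(6)[OF that]])
qed

lemma skorokhod_lipschitz_measurable:
  assumes "X \<in> measurable M (borel_of_topology skorokhod_topology)"
    and "\<And>x y. x \<in> skorokhod_D \<Longrightarrow> y \<in> skorokhod_D \<Longrightarrow> \<bar>h x - h y\<bar> \<le> Lh * skorokhod_dist x y"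
  shows "(\<lambda>\<omega>. h (X \<omega>)) \<in> borel_measurable M"
  using borel_measurable_comp_continuous_map[OF assms(1)] Skorokhod.lipschitz_continuous_map[of h Lh] assms(2)
  by (simp add: skorokhod_topology_def)

lemma step_path_W_expectation_tendsto:
  assumes W: "is_W_infinity N W"
    and h: "\<And>x y. x \<in> skorokhod_D \<Longrightarrow> y \<in> skorokhod_D \<Longrightarrow> \<bar>h x - h y\<bar> \<le> Lh * skorokhod_dist x y"
    and B: "\<And>x. x \<in> skorokhod_D \<Longrightarrow> \<bar>h x\<bar> \<le> B"
  shows "(\<lambda>q. \<integral>\<omega>. h (step_path q (\<lambda>p. W p \<omega>)) \<partial>N) \<longlonglongrightarrow> (\<integral>\<omega>. h (\<lambda>p\<in>unit_square. W p \<omega>) \<partial>N)"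
proof (rule integral_dominated_convergence[where w = "\<lambda>_. B"])
  note W' = is_W_infinity_facts[OF W]
  interpret prob_space N by (rule W'(1))
  show "(\<lambda>\<omega>. h (\<lambda>p\<in>unit_square. W p \<omega>)) \<in> borel_measurable N"
    using h by (rule skorokhod_lipschitz_measurable[OF W_path_measurable[OF W]])
  show "(\<lambda>\<omega>. h (step_path q (\<lambda>p. W p \<omega>))) \<in> borel_measurable N" for q
    using h W'(2) dyadic_grid_subset
    by (intro skorokhod_lipschitz_measurable[where h = h and Lh = Lh] measurable_step_path) blast+
  show "integrable N (\<lambda>_. B)" by simp
  show "AE \<omega> in N. norm (h (step_path q (\<lambda>p. W p \<omega>))) \<le> B" for q
    using B step_path_in_D by simp
  show "AE \<omega> in N. (\<lambda>q. h (step_path q (\<lambda>p. W p \<omega>))) \<longlonglongrightarrow> h (\<lambda>p\<in>unit_square. W p \<omega>)"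
  proof (rule AE_I2)
    fix \<omega> assume \<omega>: "\<omega> \<in> space N"
    let ?W = "\<lambda>p\<in>unit_square. W p \<omega>"
    have D: "?W \<in> skorokhod_D"
      using W'(6)[OF \<omega>] by (intro restrict_in_skorokhod_D orthant_limits_continuous)
    have "(\<lambda>q. Lh * skorokhod_dist (step_path q (\<lambda>p. W p \<omega>)) ?W) \<longlonglongrightarrow> Lh * 0"
      by (intro tendsto_mult_left step_path_tendsto[OF W'(6)[OF \<omega>]])
    then have lim0: "(\<lambda>q. Lh * skorokhod_dist (step_path q (\<lambda>p. W p \<omega>)) ?W) \<longlonglongrightarrow> 0"
      by simp
    have "(\<lambda>q. h (step_path q (\<lambda>p. W p \<omega>)) - h ?W) \<longlonglongrightarrow> 0"
    proof (rule Lim_null_comparison[OF always_eventually lim0], rule allI)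
      show "norm (h (step_path q (\<lambda>p. W p \<omega>)) - h ?W) \<le> Lh * skorokhod_dist (step_path q (\<lambda>p. W p \<omega>)) ?W" for q
        unfolding real_norm_def by (rule h[OF step_path_in_D D])
    qed
    then show "(\<lambda>q. h (step_path q (\<lambda>p. W p \<omega>))) \<longlonglongrightarrow> h ?W" by (simp add: LIM_zero_iff)
  qed
qed

text \<open>Off the exceptional event the Skorokhod distance is below the uniform one and
  \<open>h\<close> is Lipschitz; on the event only its bound \<open>B\<close> is used.\<close>

lemma (in truncation) expectation_X_close_step_path:
  fixes e v :: real
  assumes q: "1 \<le> q" "q < l" and e: "0 < e" and v: "A2 \<le> v" and Lh: "0 \<le> Lh"
    and h: "\<And>x y. x \<in> skorokhod_D \<Longrightarrow> y \<in> skorokhod_D \<Longrightarrow> \<bar>h x - h y\<bar> \<le> Lh * skorokhod_dist x y"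
    and B: "\<And>x. x \<in> skorokhod_D \<Longrightarrow> \<bar>h x\<bar> \<le> B"
  shows "\<bar>expectation (\<lambda>\<omega>. h (X \<omega>)) - expectation (\<lambda>\<omega>. h (step_path q (\<lambda>p. L p \<omega>)))\<bar> \<le>
    Lh * (6 * e + 4 * sqrt (2 ^ q) * (1/2) ^ q + 2 * sqrt n * (1/2) ^ l) +
    (B + B) * (2 * ((3 * (\<Sum>a\<in>{q<..l}. real a ^ 8 * (1/2) ^ a) + real l ^ 9 / n) / e ^ 4 + 8 * (1/2) ^ q)
      + v * (2 ^ l + 1) * real l ^ 3 / (n * e\<^sup>2))"
proof -
  let ?\<eta> = "6 * e + 4 * sqrt (2 ^ q) * (1/2) ^ q + 2 * sqrt n * (1/2) ^ l"
  obtain E where E: "E \<in> events"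
    "prob E \<le> 2 * ((3 * (\<Sum>a\<in>{q<..l}. real a ^ 8 * (1/2) ^ a) + real l ^ 9 / n) / e ^ 4 + 8 * (1/2) ^ q)
      + v * (2 ^ l + 1) * real l ^ 3 / (n * e\<^sup>2)"
    "\<And>\<omega> p. \<omega> \<in> space M - E \<Longrightarrow> p \<in> unit_square \<Longrightarrow> \<bar>X \<omega> p - step_path q (\<lambda>p. L p \<omega>) p\<bar> \<le> ?\<eta>"
    using X_close_L[OF q e v] by blast
  have XD: "X \<omega> \<in> skorokhod_D" if "\<omega> \<in> space M" for \<omega>
    using measurable_space[OF X_measurable that] by simp
  show ?thesis
  proof (rule expectation_diff_le[OF _ _ _ _ E(1,2)])
    show "(\<lambda>\<omega>. h (X \<omega>)) \<in> borel_measurable M"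
      using h by (rule skorokhod_lipschitz_measurable[OF X_measurable])
    show "(\<lambda>\<omega>. h (step_path q (\<lambda>p. L p \<omega>))) \<in> borel_measurable M"
      using h by (rule skorokhod_lipschitz_measurable[OF measurable_step_path[OF L_measurable]])
    show "0 \<le> Lh * ?\<eta>" using Lh e by simp
    fix \<omega> assume \<omega>: "\<omega> \<in> space M - E"
    have "\<bar>h (X \<omega>) - h (step_path q (\<lambda>p. L p \<omega>))\<bar> \<le> Lh * skorokhod_dist (X \<omega>) (step_path q (\<lambda>p. L p \<omega>))"
      using \<omega> by (intro h XD step_path_in_D) auto
    also have "\<dots> \<le> Lh * ?\<eta>"
      using \<omega> E(3) Lh by (intro mult_left_mono skorokhod_dist_le_uniform XD step_path_in_D) auto
    finally show "\<bar>h (X \<omega>) - h (step_path q (\<lambda>p. L p \<omega>))\<bar> \<le> Lh * ?\<eta>" .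
  qed (use B XD step_path_in_D in auto)
qed

text \<open>
  The fine mesh has width about \<open>n powr (- 3/4)\<close>: small compared with \<open>1 / sqrt n\<close>, so that
  monotonicity handles the cells, and large compared with \<open>1 / n\<close>, so that the union bound over the
  grid still works.
\<close>

definition fine_level :: "nat \<Rightarrow> nat" where
  "fine_level n = nat \<lceil>3 / 4 * log 2 (real n)\<rceil>"

lemma fine_level_bounds:
  assumes n: "1 \<le> n"
  shows "real n powr (3/4) \<le> 2 ^ fine_level n" "2 ^ fine_level n \<le> 2 * real n powr (3/4)"
    "real (fine_level n) \<le> 3 / 4 * log 2 (real n) + 1"
proof -
  define x where "x = 3 / 4 * log 2 (real n)"
  have x: "0 \<le> x" using n by (simp add: x_def)
  have l: "x \<le> real (fine_level n)" "real (fine_level n) \<le> x + 1"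
    unfolding fine_level_def x_def[symmetric] using x by linarith+
  have p: "2 powr x = real n powr (3/4)"
  proof -
    have "2 powr x = (2 powr log 2 (real n)) powr (3/4)"
      unfolding x_def powr_powr by (simp add: mult.commute)
    then show ?thesis using n by simp
  qed
  have f: "2 ^ fine_level n = 2 powr real (fine_level n)" by (simp add: powr_realpow)
  show "real (fine_level n) \<le> 3 / 4 * log 2 (real n) + 1" using l by (simp add: x_def)
  show "real n powr (3/4) \<le> 2 ^ fine_level n" unfolding f p[symmetric] using l by simp
  have "2 powr real (fine_level n) \<le> 2 powr (x + 1)" using l by simp
  then show "2 ^ fine_level n \<le> 2 * real n powr (3/4)" unfolding f p[symmetric] by (simp add: powr_add)
qed

text \<open>The limits match the errors that depend on the fine level: the change of the centering
  across a cell, the linear moment term of the two samples, and the union bound for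
  \<open>Z\<close>. The last claim makes room for any fixed coarse level.\<close>

lemma fine_level_limits:
  shows "(\<lambda>n. sqrt (real n) * (1/2) ^ fine_level n) \<longlonglongrightarrow> 0"
    and "(\<lambda>n. real (fine_level n) ^ 9 / real n) \<longlonglongrightarrow> 0"
    and "(\<lambda>n. (2 ^ fine_level n + 1) * real (fine_level n) ^ 3 / real n) \<longlonglongrightarrow> 0"
    and "\<forall>\<^sub>F n in sequentially. q < fine_level n"
proof -
  have ev: "\<forall>\<^sub>F n in sequentially. 1 \<le> (n::nat)" by (rule eventually_ge_at_top)
  show "(\<lambda>n. sqrt (real n) * (1/2) ^ fine_level n) \<longlonglongrightarrow> 0"
  proof (rule Lim_null_comparison)
    show "\<forall>\<^sub>F n in sequentially. norm (sqrt (real n) * (1/2) ^ fine_level n) \<le> sqrt (real n) / real n powr (3/4)"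
      using ev
    proof eventually_elim
      case (elim n)
      have "sqrt (real n) / 2 ^ fine_level n \<le> sqrt (real n) / real n powr (3/4)"
        using fine_level_bounds(1)[OF elim] elim by (intro divide_left_mono) auto
      then show ?case by (simp add: power_divide)
    qed
    show "(\<lambda>n::nat. sqrt (real n) / real n powr (3/4)) \<longlonglongrightarrow> 0" by real_asymp
  qed
  show "(\<lambda>n. real (fine_level n) ^ 9 / real n) \<longlonglongrightarrow> 0"
  proof (rule Lim_null_comparison)
    show "\<forall>\<^sub>F n in sequentially. norm (real (fine_level n) ^ 9 / real n) \<le> (3 / 4 * log 2 (real n) + 1) ^ 9 / real n"
      using ev
    proof eventually_elim
      case (elim n)
      then show ?case using fine_level_bounds(3)[OF elim] by (simp add: divide_right_mono power_mono)
    qed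
    show "(\<lambda>n::nat. (3 / 4 * log 2 (real n) + 1) ^ 9 / real n) \<longlonglongrightarrow> 0" by real_asymp
  qed
  show "(\<lambda>n. (2 ^ fine_level n + 1) * real (fine_level n) ^ 3 / real n) \<longlonglongrightarrow> 0"
  proof (rule Lim_null_comparison)
    show "\<forall>\<^sub>F n in sequentially. norm ((2 ^ fine_level n + 1) * real (fine_level n) ^ 3 / real n) \<le>
        (2 * real n powr (3/4) + 1) * (3 / 4 * log 2 (real n) + 1) ^ 3 / real n"
      using ev
    proof eventually_elim
      case (elim n)
      have "(2 ^ fine_level n + 1) * real (fine_level n) ^ 3 / real n \<le>
          (2 * real n powr (3/4) + 1) * (3 / 4 * log 2 (real n) + 1) ^ 3 / real n"
        using fine_level_bounds(2,3)[OF elim]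
        by (intro divide_right_mono mult_mono power_mono add_right_mono) auto
      then show ?case by simp
    qed
    show "(\<lambda>n::nat. (2 * real n powr (3/4) + 1) * (3 / 4 * log 2 (real n) + 1) ^ 3 / real n) \<longlonglongrightarrow> 0"
      by real_asymp
  qed
  have "filterlim (\<lambda>n::nat. real n powr (3/4)) at_top sequentially" by real_asymp
  then have "\<forall>\<^sub>F n in sequentially. (2 ^ q :: real) < real n powr (3/4)"
    by (simp add: filterlim_at_top_dense)
  with ev show "\<forall>\<^sub>F n in sequentially. q < fine_level n"
  proof eventually_elim
    case (elim n)
    then have "(2 ^ q :: real) < 2 ^ fine_level n" using fine_level_bounds(1)[of n] by linarith
    then show ?case by simp
  qed
qed

text \<open>The bound is uniform in \<open>l\<close>: the coarse level \<open>q\<close> is chosen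
  before \<open>n\<close>, while \<open>l\<close> grows with \<open>n\<close>.\<close>

lemma tail_sum_small:
  assumes "0 < r"
  shows "\<forall>\<^sub>F q in sequentially. \<forall>l. (\<Sum>a\<in>{q<..l}. real a ^ 8 * (1/2) ^ a) < r"
proof -
  have "summable (\<lambda>a. real a ^ 8 * (1/2) ^ a)"
  proof (rule summable_comparison_test_bigo)
    show "summable (\<lambda>n. norm ((3/4 :: real) ^ n))" by (simp add: summable_geometric)
    show "(\<lambda>a. real a ^ 8 * (1/2) ^ a) \<in> O(\<lambda>n. (3/4) ^ n)" by real_asymp
  qed
  then obtain N where N: "\<And>m n. m \<ge> N \<Longrightarrow> norm (\<Sum>a\<in>{m..<n}. real a ^ 8 * (1/2) ^ a) < r"
    unfolding summable_Cauchy using assms by blast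
  have "(\<Sum>a\<in>{q<..l}. real a ^ 8 * (1/2) ^ a) < r" if "q \<ge> N" for q l
  proof -
    have "{q<..l} = {Suc q..<Suc l}" by auto
    then show ?thesis using N[of "Suc q" "Suc l"] that by (simp add: abs_less_iff)
  qed
  then show ?thesis by (auto simp: eventually_sequentially)
qed

lemma truncation_lipschitz_tendsto:
  fixes M :: "nat \<Rightarrow> 'w measure" and v :: real
  assumes tr: "\<And>n. truncation (M n) (Suc n) (U n) (R n) (C n)"
    and v: "\<And>n. truncation.A2 (M n) (Suc n) (U n) \<le> v"
    and W: "is_W_infinity N W" and Lh: "0 \<le> Lh"
    and h: "\<And>x y. x \<in> skorokhod_D \<Longrightarrow> y \<in> skorokhod_D \<Longrightarrow> \<bar>h x - h y\<bar> \<le> Lh * skorokhod_dist x y"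
    and B: "\<And>x. x \<in> skorokhod_D \<Longrightarrow> \<bar>h x\<bar> \<le> B"
  shows "(\<lambda>n. \<integral>\<omega>. h (normalized_T (Suc n) (M n) (U n) (R n) (C n) \<omega>) \<partial>M n) \<longlonglongrightarrow>
    (\<integral>\<omega>. h (\<lambda>p\<in>unit_square. W p \<omega>) \<partial>N)"
proof (rule tendstoI)
  fix \<epsilon> :: real assume \<epsilon>: "0 < \<epsilon>"
  \<comment> \<open>Seven error terms separate the process from its coarse step path; two more lead
    to the Gaussian step path and from there to the limit.\<close>
  define \<epsilon>' where "\<epsilon>' = \<epsilon> / 9"
  have \<epsilon>': "0 < \<epsilon>'" using \<epsilon> by (simp add: \<epsilon>'_def)
  \<comment> \<open>The \<open>+ 1\<close> here and in \<open>r\<close> below avoids a division by 0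
    when \<open>Lh\<close> or \<open>B\<close> vanishes.\<close>
  define e where "e = \<epsilon>' / (6 * (Lh + 1))"
  have e: "0 < e" using \<epsilon>' Lh by (simp add: e_def)
  have e6: "Lh * (6 * e) \<le> \<epsilon>'" using \<epsilon>' Lh by (simp add: e_def field_simps)
  have "restrict (\<lambda>_. 0) unit_square \<in> skorokhod_D"
    by (intro restrict_in_skorokhod_D orthant_limits_continuous continuous_on_const)
  then have B0: "0 \<le> B" using B by fastforce
  define r where "r = \<epsilon>' * e ^ 4 / (12 * B + 1)"
  have r0: "0 < r" using \<epsilon>' e B0 by (simp add: r_def)
  have "12 * B * r / e ^ 4 = 12 * B * \<epsilon>' / (12 * B + 1)" using e by (simp add: r_def)
  also have "\<dots> \<le> \<epsilon>'" using \<epsilon>' B0 by (simp add: divide_le_eq algebra_simps)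
  finally have r: "0 < r" "12 * B * r / e ^ 4 \<le> \<epsilon>'" using r0 by auto
  let ?W = "\<lambda>\<omega>. \<lambda>p\<in>unit_square. W p \<omega>"
  let ?S = "\<lambda>q. \<integral>\<omega>. h (step_path q (\<lambda>p. W p \<omega>)) \<partial>N"
  let ?SL = "\<lambda>q n. \<integral>\<omega>. h (step_path q (\<lambda>p. truncation.L (Suc n) (R n) (C n) p \<omega>)) \<partial>M n"
  let ?X = "\<lambda>n. \<integral>\<omega>. h (normalized_T (Suc n) (M n) (U n) (R n) (C n) \<omega>) \<partial>M n"
  have "?S \<longlonglongrightarrow> (\<integral>\<omega>. h (?W \<omega>) \<partial>N)" using h B by (rule step_path_W_expectation_tendsto[OF W])
  from tendstoD[OF this \<epsilon>'] have "\<forall>\<^sub>F q in sequentially. dist (?S q) (\<integral>\<omega>. h (?W \<omega>) \<partial>N) < \<epsilon>'" .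
  moreover have "(\<lambda>q. Lh * (4 * sqrt (2 ^ q) * (1/2) ^ q)) \<longlonglongrightarrow> 0"
  proof -
    have "(\<lambda>q. Lh * 4 * (sqrt 2 / 2) ^ q) \<longlonglongrightarrow> Lh * 4 * 0"
      using sqrt2_less_2 by (intro tendsto_mult_left LIMSEQ_power_zero) simp
    moreover have "Lh * 4 * (sqrt 2 / 2) ^ q = Lh * (4 * sqrt (2 ^ q) * (1/2) ^ q)" for q
      by (simp add: real_sqrt_power power_divide)
    ultimately show ?thesis by simp
  qed
  from order_tendstoD(2)[OF this \<epsilon>'] have "\<forall>\<^sub>F q in sequentially. Lh * (4 * sqrt (2 ^ q) * (1/2) ^ q) < \<epsilon>'" .
  moreover have "(\<lambda>q::nat. 32 * B * (1/2) ^ q) \<longlonglongrightarrow> 0" by real_asymp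
  from order_tendstoD(2)[OF this \<epsilon>'] have "\<forall>\<^sub>F q in sequentially. 32 * B * (1/2) ^ q < \<epsilon>'" .
  moreover note tail_sum_small[OF r(1)] eventually_ge_at_top[of "1::nat"]
  ultimately have "\<forall>\<^sub>F q in sequentially. dist (?S q) (\<integral>\<omega>. h (?W \<omega>) \<partial>N) < \<epsilon>' \<and>
      Lh * (4 * sqrt (2 ^ q) * (1/2) ^ q) < \<epsilon>' \<and> 32 * B * (1/2) ^ q < \<epsilon>' \<and>
      (\<forall>l. (\<Sum>a\<in>{q<..l}. real a ^ 8 * (1/2) ^ a) < r) \<and> 1 \<le> q"
    by eventually_elim blast
  \<comment> \<open>\<open>q\<close> is fixed from here on; only afterwards does \<open>n\<close>
    tend to infinity, and with it the fine level.\<close>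
  then obtain q where q: "dist (?S q) (\<integral>\<omega>. h (?W \<omega>) \<partial>N) < \<epsilon>'"
      "Lh * (4 * sqrt (2 ^ q) * (1/2) ^ q) < \<epsilon>'" "32 * B * (1/2) ^ q < \<epsilon>'"
      "\<And>l. (\<Sum>a\<in>{q<..l}. real a ^ 8 * (1/2) ^ a) < r" "1 \<le> q"
    using eventually_happens'[OF sequentially_bot] by blast
  let ?l = "\<lambda>n. fine_level (Suc n)"
  have "(\<lambda>n. Lh * 2 * (sqrt (real (Suc n)) * (1/2) ^ ?l n)) \<longlonglongrightarrow> Lh * 2 * 0"
    by (intro tendsto_mult_left LIMSEQ_Suc[OF fine_level_limits(1)])
  then have "\<forall>\<^sub>F n in sequentially. Lh * 2 * (sqrt (real (Suc n)) * (1/2) ^ ?l n) < \<epsilon>'"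
    using \<epsilon>' by (intro order_tendstoD(2)) auto
  moreover have "(\<lambda>n. 4 * B / e ^ 4 * (real (?l n) ^ 9 / real (Suc n))) \<longlonglongrightarrow> 4 * B / e ^ 4 * 0"
    by (intro tendsto_mult_left LIMSEQ_Suc[OF fine_level_limits(2)])
  then have "\<forall>\<^sub>F n in sequentially. 4 * B / e ^ 4 * (real (?l n) ^ 9 / real (Suc n)) < \<epsilon>'"
    using \<epsilon>' by (intro order_tendstoD(2)) auto
  moreover have "(\<lambda>n. 2 * B * v / e\<^sup>2 * ((2 ^ ?l n + 1) * real (?l n) ^ 3 / real (Suc n))) \<longlonglongrightarrow> 2 * B * v / e\<^sup>2 * 0"
    by (intro tendsto_mult_left LIMSEQ_Suc[OF fine_level_limits(3)])
  then have "\<forall>\<^sub>F n in sequentially. 2 * B * v / e\<^sup>2 * ((2 ^ ?l n + 1) * real (?l n) ^ 3 / real (Suc n)) < \<epsilon>'"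
    using \<epsilon>' by (intro order_tendstoD(2)) auto
  moreover have "\<forall>\<^sub>F n in sequentially. q < ?l n"
    using fine_level_limits(4)[of q] by (subst eventually_sequentially_Suc)
  moreover have "?SL q \<longlonglongrightarrow> ?S q"
    using h B by (rule step_path_expectation_tendsto[OF tr W Lh])
  from tendstoD[OF this \<epsilon>'] have "\<forall>\<^sub>F n in sequentially. dist (?SL q n) (?S q) < \<epsilon>'" .
  ultimately show "\<forall>\<^sub>F n in sequentially. dist (?X n) (\<integral>\<omega>. h (?W \<omega>) \<partial>N) < \<epsilon>"
  proof eventually_elim
    case (elim n)
    define S where "S = (\<Sum>a\<in>{q<..?l n}. real a ^ 8 * (1/2) ^ a)"
    have "\<bar>?X n - ?SL q n\<bar> \<le>
      Lh * (6 * e + 4 * sqrt (2 ^ q) * (1/2) ^ q + 2 * sqrt (real (Suc n)) * (1/2) ^ ?l n) +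
      (B + B) * (2 * ((3 * S + real (?l n) ^ 9 / real (Suc n)) / e ^ 4 + 8 * (1/2) ^ q)
      + v * (2 ^ ?l n + 1) * real (?l n) ^ 3 / (real (Suc n) * e\<^sup>2))"
      unfolding S_def using h B
      by (rule truncation.expectation_X_close_step_path[OF tr q(5) elim(4) e v Lh])
    also have "\<dots> = Lh * (6 * e) + Lh * (4 * sqrt (2 ^ q) * (1/2) ^ q) + Lh * 2 * (sqrt (real (Suc n)) * (1/2) ^ ?l n)
        + 12 * B * S / e ^ 4 + 4 * B / e ^ 4 * (real (?l n) ^ 9 / real (Suc n)) + 32 * B * (1/2) ^ q
        + 2 * B * v / e\<^sup>2 * ((2 ^ ?l n + 1) * real (?l n) ^ 3 / real (Suc n))"
      by (simp add: algebra_simps add_divide_distrib)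
    also have "\<dots> < 7 * \<epsilon>'"
    proof -
      have "12 * B * S / e ^ 4 \<le> 12 * B * r / e ^ 4"
        using q(4)[of "?l n"] B0 e by (intro divide_right_mono mult_left_mono) (auto simp: S_def)
      then show ?thesis using e6 q(2,3) r(2) elim(1-3) by linarith
    qed
    finally have "dist (?X n) (?SL q n) < 7 * \<epsilon>'" by (simp add: dist_real_def)
    then have "dist (?X n) (\<integral>\<omega>. h (?W \<omega>) \<partial>N) < 9 * \<epsilon>'"
      using elim(5) q(1) dist_triangle[of "?X n" "\<integral>\<omega>. h (?W \<omega>) \<partial>N" "?SL q n"]
        dist_triangle[of "?SL q n" "\<integral>\<omega>. h (?W \<omega>) \<partial>N" "?S q"] by linarith
    then show ?case by (simp add: \<epsilon>'_def)
  qed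
qed

lemma truncationI:
  assumes "truncation_setting n M U R C" "1 \<le> n"
  shows "truncation M n U R C"
  using assms unfolding truncation_def truncation_axioms_def by (simp add: truncation_setting_def)

text \<open>A bound \<open>v\<close> common to all sizes is what the deterministic and the Haar case
  have to supply. Nothing is assumed at \<open>n = 0\<close>, so the limit is taken along
  \<open>Suc n\<close> and the shift is undone at the end; measurability is needed only
  eventually.\<close>

lemma truncation_converges:
  fixes M :: "nat \<Rightarrow> 'w measure" and v :: real
  assumes setting: "\<And>n. 1 \<le> n \<Longrightarrow> truncation_setting n (M n) (U n) (R n) (C n)"
    and W: "is_W_infinity N W"
    and v: "\<And>n. 1 \<le> n \<Longrightarrow> (\<integral>\<omega>. (\<Sum>i<n. \<Sum>j<n. ((cmod (U n \<omega> $$ (i, j)))\<^sup>2)\<^sup>2) \<partial>M n) \<le> v"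
  shows "converges_in_distribution skorokhod_topology
    M (\<lambda>n. normalized_T n (M n) (U n) (R n) (C n)) N (\<lambda>\<omega>. \<lambda>p\<in>unit_square. W p \<omega>)"
proof -
  let ?M = "\<lambda>n. M (Suc n)"
  let ?X = "\<lambda>n. normalized_T n (M n) (U n) (R n) (C n)"
  have tr: "truncation (?M n) (Suc n) (U (Suc n)) (R (Suc n)) (C (Suc n))" for n
    by (rule truncationI[OF setting]) auto
  have v': "truncation.A2 (?M n) (Suc n) (U (Suc n)) \<le> v" for n
    using v[of "Suc n"] by (simp add: truncation.A2_def[OF tr] truncation.A_def[OF tr])
  have "converges_in_distribution Skorokhod.mtopology ?M (\<lambda>n. ?X (Suc n)) N (\<lambda>\<omega>. \<lambda>p\<in>unit_square. W p \<omega>)"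
  proof (rule Skorokhod.portmanteau_lipschitz)
    show "prob_space (?M n)" for n using truncation.axioms(1)[OF tr] .
    show "prob_space N" by (rule is_W_infinity_facts(1)[OF W])
    show "?X (Suc n) \<in> measurable (?M n) (borel_of_topology Skorokhod.mtopology)" for n
      using truncation.X_measurable[OF tr, of n] by (simp add: skorokhod_topology_def)
    show "(\<lambda>\<omega>. \<lambda>p\<in>unit_square. W p \<omega>) \<in> measurable N (borel_of_topology Skorokhod.mtopology)"
      using W_path_measurable[OF W] by (simp add: skorokhod_topology_def)
    fix h :: "(real \<times> real \<Rightarrow> real) \<Rightarrow> real" and L B :: real
    assume "0 \<le> L" "\<And>x y. x \<in> skorokhod_D \<Longrightarrow> y \<in> skorokhod_D \<Longrightarrow> \<bar>h x - h y\<bar> \<le> L * skorokhod_dist x y"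
      "\<And>x. x \<in> skorokhod_D \<Longrightarrow> \<bar>h x\<bar> \<le> B"
    then show "(\<lambda>n. \<integral>\<omega>. h (?X (Suc n) \<omega>) \<partial>?M n) \<longlonglongrightarrow> (\<integral>\<omega>. h (\<lambda>p\<in>unit_square. W p \<omega>) \<partial>N)"
      by (rule truncation_lipschitz_tendsto[OF tr v' W])
  qed
  note c = this[unfolded converges_in_distribution_def]
  show ?thesis
    unfolding converges_in_distribution_def skorokhod_topology_def
  proof (intro conjI allI impI)
    show "\<forall>\<^sub>F n in sequentially. ?X n \<in> measurable (M n) (borel_of_topology Skorokhod.mtopology)"
      by (rule iffD1[OF eventually_sequentially_Suc], rule conjunct1[OF c])
    show "(\<lambda>\<omega>. \<lambda>p\<in>unit_square. W p \<omega>) \<in> measurable N (borel_of_topology Skorokhod.mtopology)"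
      by (rule conjunct1[OF conjunct2[OF c]])
    fix h :: "(real \<times> real \<Rightarrow> real) \<Rightarrow> real"
    assume h: "continuous_map Skorokhod.mtopology euclideanreal h \<and> bounded (h ` topspace Skorokhod.mtopology)"
    show "(\<lambda>n. \<integral>\<omega>. h (?X n \<omega>) \<partial>M n) \<longlonglongrightarrow> (\<integral>\<omega>. h (\<lambda>p\<in>unit_square. W p \<omega>) \<partial>N)"
      by (rule LIMSEQ_imp_Suc, rule mp[OF spec[OF conjunct2[OF conjunct2[OF c]]] h])
  qed
qed

theorem theorem3p3:
  fixes M :: "nat \<Rightarrow> 'w measure"
    and U :: "nat \<Rightarrow> 'w \<Rightarrow> complex mat"
    and R C :: "nat \<Rightarrow> nat \<Rightarrow> 'w \<Rightarrow> real"
    and N :: "'v measure"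
    and W :: "real \<times> real \<Rightarrow> 'v \<Rightarrow> real"
  assumes setting: "\<And>n. 1 \<le> n \<Longrightarrow> truncation_setting n (M n) (U n) (R n) (C n)"
    and limit: "is_W_infinity N W"
  shows "((\<forall>n\<ge>1. (AE \<omega> in M n. U n \<omega> = dft_mat n) \<or>
              (\<forall>i<n. \<forall>j<n. AE \<omega> in M n. (cmod (U n \<omega> $$ (i, j)))\<^sup>2 = 1 / real n))
            \<longrightarrow> converges_in_distribution skorokhod_topology
                  M (\<lambda>n. normalized_T n (M n) (U n) (R n) (C n)) N (\<lambda>\<omega>. \<lambda>p\<in>unit_square. W p \<omega>))
       \<and> ((\<forall>n\<ge>1. haar_distributed n (unitary_group n) (M n) (U n)) \<or>
          (\<forall>n\<ge>1. haar_distributed n (orthogonal_group n) (M n) (U n))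
            \<longrightarrow> converges_in_distribution skorokhod_topology
                  M (\<lambda>n. normalized_T n (M n) (U n) (R n) (C n)) N (\<lambda>\<omega>. \<lambda>p\<in>unit_square. W p \<omega>))"
proof (intro conjI impI)
  assume flat: "\<forall>n\<ge>1. (AE \<omega> in M n. U n \<omega> = dft_mat n) \<or>
      (\<forall>i<n. \<forall>j<n. AE \<omega> in M n. (cmod (U n \<omega> $$ (i, j)))\<^sup>2 = 1 / real n)"
  show "converges_in_distribution skorokhod_topology
      M (\<lambda>n. normalized_T n (M n) (U n) (R n) (C n)) N (\<lambda>\<omega>. \<lambda>p\<in>unit_square. W p \<omega>)"
  proof (rule truncation_converges[OF setting limit])
    fix n :: nat assume n: "1 \<le> n"
    interpret truncation "M n" n "U n" "R n" "C n"
      by (rule truncationI[OF setting[OF n] n])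
    \<comment> \<open>The exponent is purely imaginary, so the exponential has modulus 1.\<close>
    have dft: "(cmod (dft_mat n $$ (i, j)))\<^sup>2 = 1 / real n" if "i < n" "j < n" for i j
    proof -
      have "Re (- 2 * \<i> * complex_of_real pi * of_nat i * of_nat j / of_nat n) = 0"
        by (simp add: Re_divide_of_nat)
      then show ?thesis using that by (simp add: dft_mat_def norm_mult norm_divide power_divide)
    qed
    have flat': "AE \<omega> in M n. (cmod (U n \<omega> $$ (i, j)))\<^sup>2 = 1 / real n" if "i < n" "j < n" for i j
    proof -
      from flat n consider "AE \<omega> in M n. U n \<omega> = dft_mat n"
        | "\<forall>i<n. \<forall>j<n. AE \<omega> in M n. (cmod (U n \<omega> $$ (i, j)))\<^sup>2 = 1 / real n" by blast
      then show ?thesis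
      proof cases
        case 1
        then show ?thesis by eventually_elim (simp add: dft that)
      next
        case 2
        then show ?thesis using that by blast
      qed
    qed
    then have "AE \<omega> in M n. \<forall>i\<in>{..<n}. \<forall>j\<in>{..<n}. (cmod (U n \<omega> $$ (i, j)))\<^sup>2 = 1 / real n"
      by (intro AE_finite_allI) auto
    \<comment> \<open>There are \<open>n * n\<close> terms, each equal to
      \<open>1 / n^2\<close>.\<close>
    then have "AE \<omega> in M n. (\<Sum>i<n. \<Sum>j<n. ((cmod (U n \<omega> $$ (i, j)))\<^sup>2)\<^sup>2) = 1"
      by eventually_elim (use n in \<open>simp add: power2_eq_square\<close>)
    then have "expectation (\<lambda>\<omega>. \<Sum>i<n. \<Sum>j<n. ((cmod (U n \<omega> $$ (i, j)))\<^sup>2)\<^sup>2) = expectation (\<lambda>\<omega>. 1)"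
      unfolding A_def[symmetric] by (intro integral_cong_AE) auto
    then show "expectation (\<lambda>\<omega>. \<Sum>i<n. \<Sum>j<n. ((cmod (U n \<omega> $$ (i, j)))\<^sup>2)\<^sup>2) \<le> 6" by (simp add: prob_space)
  qed
next
  assume haar: "(\<forall>n\<ge>1. haar_distributed n (unitary_group n) (M n) (U n)) \<or>
      (\<forall>n\<ge>1. haar_distributed n (orthogonal_group n) (M n) (U n))"
  show "converges_in_distribution skorokhod_topology
      M (\<lambda>n. normalized_T n (M n) (U n) (R n) (C n)) N (\<lambda>\<omega>. \<lambda>p\<in>unit_square. W p \<omega>)"
  proof (rule truncation_converges[OF setting limit])
    fix n :: nat assume n: "1 \<le> n"
    interpret truncation "M n" n "U n" "R n" "C n"
      by (rule truncationI[OF setting[OF n] n])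
    show "expectation (\<lambda>\<omega>. \<Sum>i<n. \<Sum>j<n. ((cmod (U n \<omega> $$ (i, j)))\<^sup>2)\<^sup>2) \<le> 6"
    \<comment> \<open>The reflection argument needs two different rows. For \<open>n = 1\<close> the
      only entry has modulus 1.\<close>
    proof (cases "2 \<le> n")
      case True
      obtain G where "G = unitary_group n \<or> G = orthogonal_group n" "haar_distributed n G (M n) (U n)"
        using haar n by blast
      then show ?thesis by (rule haar_second_moment[OF True prob_space_axioms])
    next
      case False
      then have n1: "n = 1" using n by simp
      have "expectation (\<lambda>\<omega>. (A 0 0 \<omega>)\<^sup>2) = expectation (\<lambda>\<omega>. 1)"
        using A_sums(1)[of _ 0] by (intro Bochner_Integration.integral_cong refl) (simp add: n1)
      then have "expectation (\<lambda>\<omega>. (A 0 0 \<omega>)\<^sup>2) = 1" by (simp add: prob_space)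
      moreover have "{..<n} = {0}" using n1 by auto
      ultimately show ?thesis unfolding A_def[symmetric] by simp
    qed
  qed
qed

end
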